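(* Let $m,n\geq1$ be integers with $d:=m+n\geq3$. Let $F=\mathbb{Q}(\sqrt{-D})$ be an imaginary quadratic number field ($D$ a square-free positive integer) with ring of integers $\mathcal{O}$, let $\mathfrak{I}$ be a non-zero ideal of $\mathcal{O}$, and let $\bm{v}\in\mathcal{O}^m\times\mathcal{O}^n$. Let $\psi:[1,\infty)\to(0,\infty)$ be a decreasing function with $\int_1^\infty\psi(t)\,dt=\infty$. For $\vartheta\in\mathbf{M}_{m\times n}(\mathbb{C})$ and $T>1$, let $\mathcal{N}(\vartheta,T,\bm{v},\mathfrak{I})$ denote the number of pairs $(\bm{p},\bm{q})\in\mathcal{O}^m\times\mathcal{O}^n$ such that \[ \|\vartheta\bm{q}+\bm{p}\|_\infty^m\leq\psi(\|\bm{q}\|_\infty^n),\qquad 1\leq\|\bm{q}\|_\infty^n<T,\qquad (\bm{p},\bm{q})\equiv\bm{v}\pmod{\mathfrak{I}}. \] Let \[ E_{T,\infty}=\{(\bm{x},\bm{y})\in\mathbb{C}^m\times\mathbb{C}^n: \|\bm{x}\|_\infty^m\leq\psi(\|\bm{y}\|_\infty^n),\ 1\leq\|\bm{y}\|_\infty^n<T\}. \] Then for Lebesgue almost every $\vartheta\in\mathbf{M}_{m\times n}(\mathbb{C})$, \[ \mathcal{N}(\vartheta,T,\bm{v},\mathfrak{I})\sim 2^d|\Delta_F|^{-d/2}N(\mathfrak{I})^{-d}\operatorname{vol}(E_{T,\infty})\qquad\text{as }T\to\infty. \]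
   Context: For $z\in\mathbb{C}$, $\|z\|_\infty=|z|^2$ (the square of the usual modulus); for $\bm{x}\in\mathbb{C}^k$, $\|\bm{x}\|_\infty=\max_i\|x_i\|_\infty$. $\operatorname{vol}$ denotes the standard $2d$-dimensional Lebesgue measure on $\mathbb{C}^d=(\mathbb{R}\oplus i\mathbb{R})^d$. $\Delta_F$ is the discriminant of $F$, and $N(\mathfrak{I})=\#(\mathcal{O}/\mathfrak{I})$. The notation $f(T)\sim g(T)$ means $f(T)/g(T)\to1$. (One has $\operatorname{vol}(E_{T,\infty})=\pi^d\int_1^T\psi(t)\,dt$.) *)

theory Defs
  imports
    "HOL-Analysis.Analysis"
    "HOL-Computational_Algebra.Squarefree"
    "HOL-Algebra.QuotRing"
    "HOL-Algebra.Generated_Fields"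
    "HOL-Algebra.Algebraic_Closure_Type"
begin

section \<open>The imaginary quadratic field and its ring of integers\<close>

definition quad_field :: "nat \<Rightarrow> complex set" where
  "quad_field D = generate_field ring_of_type_algebra {\<i> * of_real (sqrt (real D))}"

definition quad_integers :: "nat \<Rightarrow> complex set" where
  "quad_integers D = {z \<in> quad_field D. algebraic_int z}"

definition quad_ring :: "nat \<Rightarrow> complex ring" where
  "quad_ring D = ring_of_type_algebra\<lparr>carrier := quad_integers D\<rparr>"

definition integral_basis :: "nat \<Rightarrow> complex \<Rightarrow> complex \<Rightarrow> bool" where
  "integral_basis D w1 w2 \<longleftrightarrow> w1 \<in> quad_integers D \<and> w2 \<in> quad_integers D \<and>
     (\<forall>z \<in> quad_integers D. \<exists>!(a, b). z = of_int a * w1 + of_int b * w2)"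

text \<open>The two embeddings of the field into the complex numbers are the inclusion and
  complex conjugation, so the discriminant is the square of the determinant with rows
  \<open>(w1, w2)\<close> and \<open>(cnj w1, cnj w2)\<close> for any integral basis.
  Existence and uniqueness of this integer are shown in \<open>discriminant_eq\<close> below.\<close>

definition discriminant :: "nat \<Rightarrow> int" where
  "discriminant D = (THE \<Delta>. \<exists>w1 w2. integral_basis D w1 w2 \<and>
     of_int \<Delta> = (w1 * cnj w2 - w2 * cnj w1)\<^sup>2)"

definition ideal_norm :: "nat \<Rightarrow> complex set \<Rightarrow> nat" where
  "ideal_norm D I = card (carrier (quad_ring D Quot I))"

definition integer_vectors :: "nat \<Rightarrow> (complex ^ 'k) set" where
  "integer_vectors D = {x. \<forall>i. x $ i \<in> quad_integers D}"

section \<open>Counting function and the associated region\<close>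

text \<open>Following the normalisation of the complex place, this is the \<^emph>\<open>square\<close> of the usual
  supremum norm.\<close>

definition norm_inf :: "complex ^ 'k \<Rightarrow> real" where
  "norm_inf x = (MAX i. (cmod (x $ i))\<^sup>2)"

definition cong_mod :: "complex set \<Rightarrow> complex ^ 'k \<Rightarrow> complex ^ 'k \<Rightarrow> bool" where
  "cong_mod I x y \<longleftrightarrow> (\<forall>i. x $ i - y $ i \<in> I)"

definition counting ::
  "nat \<Rightarrow> (real \<Rightarrow> real) \<Rightarrow> complex ^ 'n ^ 'm \<Rightarrow> real \<Rightarrow>
     (complex ^ 'm) \<times> (complex ^ 'n) \<Rightarrow> complex set \<Rightarrow> nat" where
  "counting D \<psi> \<theta> T v I =
     card {(p, q). p \<in> integer_vectors D \<and> q \<in> integer_vectors D \<and>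
       norm_inf (\<theta> *v q + p) ^ CARD('m) \<le> \<psi> (norm_inf q ^ CARD('n)) \<and>
       1 \<le> norm_inf q ^ CARD('n) \<and> norm_inf q ^ CARD('n) < T \<and>
       cong_mod I p (fst v) \<and> cong_mod I q (snd v)}"

definition region :: "(real \<Rightarrow> real) \<Rightarrow> real \<Rightarrow> ((complex ^ 'm) \<times> (complex ^ 'n)) set" where
  "region \<psi> T =
     {(x, y). norm_inf x ^ CARD('m) \<le> \<psi> (norm_inf y ^ CARD('n)) \<and>
       1 \<le> norm_inf y ^ CARD('n) \<and> norm_inf y ^ CARD('n) < T}"

section \<open>Explicit descriptions\<close>

abbreviation (input) qelt :: "nat \<Rightarrow> real \<Rightarrow> real \<Rightarrow> complex" where
  "qelt D a b \<equiv> Complex a (b * sqrt (real D))"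

lemma qelt_mult: "qelt D a b * qelt D c e = qelt D (a * c - real D * b * e) (a * e + b * c)"
  by (simp add: complex_eq_iff algebra_simps flip: power2_eq_square)

lemma quad_field_eq:
  assumes "D > 0"
  shows "quad_field D = {Complex a (b * sqrt (real D)) | a b. a \<in> \<rat> \<and> b \<in> \<rat>}" (is "_ = ?E")
proof -
  let ?R = "ring_of_type_algebra :: complex ring"
  interpret R: field ?R by (rule field_from_type_algebra)
  have car: "carrier ?R = UNIV" and ad: "x \<oplus>\<^bsub>?R\<^esub> y = x + y" and mu: "x \<otimes>\<^bsub>?R\<^esub> y = x * y"
    and on: "\<one>\<^bsub>?R\<^esub> = 1" and ze: "\<zero>\<^bsub>?R\<^esub> = 0" for x y
    by (simp_all add: ring_of_type_algebra_def)
  have um: "\<ominus>\<^bsub>?R\<^esub> x = - x" for x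
    using R.minus_equality[of "- x" x] by (simp add: car ad ze)
  have iv: "inv\<^bsub>?R\<^esub> x = inverse x" if "x \<noteq> 0" for x
    using R.comm_inv_char[of x "inverse x"] that by (simp add: car mu on)
  have E_add: "x + y \<in> ?E" if "x \<in> ?E" "y \<in> ?E" for x y
  proof -
    from that obtain a b c e where "x = qelt D a b" "y = qelt D c e" and
      r: "a \<in> \<rat>" "b \<in> \<rat>" "c \<in> \<rat>" "e \<in> \<rat>" by blast
    then have "x + y = qelt D (a + c) (b + e)" by (simp add: complex_eq_iff algebra_simps)
    with r show ?thesis by (blast intro: Rats_add)
  qed
  have E_mult: "x * y \<in> ?E" if "x \<in> ?E" "y \<in> ?E" for x y
  proof -
    from that obtain a b c e where "x = qelt D a b" "y = qelt D c e" and
      r: "a \<in> \<rat>" "b \<in> \<rat>" "c \<in> \<rat>" "e \<in> \<rat>" by blast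
    then have "x * y = qelt D (a * c - real D * b * e) (a * e + b * c)" by (simp only: qelt_mult)
    moreover have "a * c - real D * b * e \<in> \<rat>" "a * e + b * c \<in> \<rat>" using r by simp_all
    ultimately show ?thesis by blast
  qed
  have E_um: "- x \<in> ?E" if "x \<in> ?E" for x
  proof -
    from that obtain a b where "x = qelt D a b" and r: "a \<in> \<rat>" "b \<in> \<rat>" by blast
    then have "- x = qelt D (- a) (- b)" by (simp add: complex_eq_iff)
    moreover have "- a \<in> \<rat>" "- b \<in> \<rat>" using r by simp_all
    ultimately show ?thesis by blast
  qed
  have E_inv: "inverse x \<in> ?E" if "x \<in> ?E" for x
  proof -
    from that obtain a b where x: "x = qelt D a b" and r: "a \<in> \<rat>" "b \<in> \<rat>" by blast
    define N where "N = a\<^sup>2 + (b * sqrt (real D))\<^sup>2"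
    have N: "N = a\<^sup>2 + real D * b\<^sup>2" by (simp add: N_def power_mult_distrib)
    have "inverse x = qelt D (a / N) (- b / N)"
      by (simp add: x complex_eq_iff N_def)
    moreover have "a / N \<in> \<rat>" "- b / N \<in> \<rat>" using r by (simp_all add: N)
    ultimately show ?thesis by blast
  qed
  have E_1: "1 \<in> ?E"
    by (auto simp: complex_eq_iff intro!: exI[of _ 1] exI[of _ 0])
  have sE: "subfield ?E ?R"
  proof (rule R.subfieldI')
    show "subring ?E ?R"
      by (rule R.subringI) (use E_1 E_um E_mult E_add in \<open>simp_all only: car on um mu ad subset_UNIV\<close>)
    show "inv\<^bsub>?R\<^esub> k \<in> ?E" if "k \<in> ?E - {\<zero>\<^bsub>?R\<^esub>}" for k
      using that E_inv[of k] iv[of k] ze by auto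
  qed
  have wE: "\<i> * of_real (sqrt (real D)) \<in> ?E"
    by (auto simp: complex_eq_iff intro!: exI[of _ 0] exI[of _ 1])
  show ?thesis
    unfolding quad_field_def
  proof (rule R.generate_fieldI[symmetric, OF _ sE])
    fix K assume K: "subfield K ?R" "{\<i> * of_real (sqrt (real D))} \<subseteq> K"
    note sr = subfieldE(1)[OF K(1)]
    have K1: "1 \<in> K" using subringE(3)[OF sr] by (simp add: on)
    have K0: "0 \<in> K" using subringE(2)[OF sr] by (simp add: ze)
    have Ka: "x + y \<in> K" if "x \<in> K" "y \<in> K" for x y using subringE(7)[OF sr that] by (simp add: ad)
    have Km: "x * y \<in> K" if "x \<in> K" "y \<in> K" for x y using subringE(6)[OF sr that] by (simp add: mu)
    have Ku: "- x \<in> K" if "x \<in> K" for x using subringE(5)[OF sr that] by (simp add: um)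
    have Ki: "inverse x \<in> K" if "x \<in> K" for x
      using R.subfield_m_inv(1)[OF K(1), of x] that iv[of x] ze K0 by (cases "x = 0") auto
    have Kn: "of_nat k \<in> K" for k by (induction k) (auto intro: K0 K1 Ka)
    have Kz: "of_int k \<in> K" for k by (cases k rule: int_cases2) (auto intro: Kn Ku)
    have Kr: "of_real a \<in> K" if "a \<in> \<rat>" for a
    proof -
      from that obtain s t where "a = of_int s / of_int t" by (auto elim: Rats_cases')
      then have "(of_real a :: complex) = of_int s * inverse (of_int t)" by (simp add: divide_inverse)
      then show ?thesis using Km[OF Kz Ki[OF Kz]] by metis
    qed
    show "?E \<subseteq> K"
    proof
      fix x assume "x \<in> ?E"
      then obtain a b where x: "x = qelt D a b" and r: "a \<in> \<rat>" "b \<in> \<rat>" by blast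
      have "x = of_real a + of_real b * (\<i> * of_real (sqrt (real D)))"
        by (simp add: x complex_eq_iff)
      then show "x \<in> K" using Ka[OF Kr[OF r(1)] Km[OF Kr[OF r(2)]]] K(2) by auto
    qed
  qed (use wE in \<open>simp_all add: car\<close>)
qed

lemma rat_int_if_powers_bounded_denom:
  fixes x :: real
  assumes "x \<in> \<rat>" "c \<noteq> 0" "\<And>k. of_int c * x ^ k \<in> \<int>"
  shows "x \<in> \<int>"
proof -
  from assms(1) obtain p q where pq: "q > 0" "Rings.coprime p q" "x = of_int p / of_int q"
    by (auto elim: Rats_cases')
  have dv: "q ^ k dvd c" for k
  proof -
    from assms(3)[of k] obtain r where "of_int c * x ^ k = of_int r" by (auto elim: Ints_cases)
    then have "real_of_int (c * p ^ k) = real_of_int (r * q ^ k)"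
      using pq(1) by (simp add: pq(3) field_simps)
    then have "c * p ^ k = r * q ^ k" by linarith
    then have "q ^ k dvd c * p ^ k" by simp
    moreover have "Rings.coprime (q ^ k) (p ^ k)" using pq(2) by (simp add: ac_simps)
    ultimately show ?thesis by (simp add: coprime_dvd_mult_left_iff)
  qed
  have "q = 1"
  proof (rule ccontr)
    assume "q \<noteq> 1"
    then have "q \<ge> 2" using pq(1) by simp
    define k where "k = nat \<bar>c\<bar>"
    have "\<bar>c\<bar> < 2 ^ k" unfolding k_def
      by (metis abs_ge_zero int_nat_eq of_nat_less_two_power)
    also have "(2::int) ^ k \<le> q ^ k" using \<open>q \<ge> 2\<close> by (intro power_mono) auto
    also have "q ^ k \<le> \<bar>c\<bar>" using dvd_imp_le_int[OF assms(2) dv[of k]] pq(1) by simp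
    finally show False by simp
  qed
  then show ?thesis by (simp add: pq(3))
qed

lemma rat_int_if_squarefree_mult_square:
  fixes r :: real
  assumes "squarefree D" "r \<in> \<rat>" "real D * r\<^sup>2 \<in> \<int>"
  shows "r \<in> \<int>"
proof -
  from assms(2) obtain p q where pq: "q > 0" "Rings.coprime p q" "r = of_int p / of_int q"
    by (auto elim: Rats_cases')
  from assms(3) obtain s where s: "real D * r\<^sup>2 = of_int s" by (auto elim: Ints_cases)
  then have "real_of_int (int D * p\<^sup>2) = real_of_int (s * q\<^sup>2)"
    using pq(1) by (simp add: pq(3) field_simps)
  then have "int D * p\<^sup>2 = s * q\<^sup>2" by linarith
  then have "q\<^sup>2 dvd int D * p\<^sup>2" by simp
  moreover have "Rings.coprime (q\<^sup>2) (p\<^sup>2)" using pq(2) by (simp add: ac_simps)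
  ultimately have "q\<^sup>2 dvd int D" by (simp add: coprime_dvd_mult_left_iff)
  then have "int ((nat q)\<^sup>2) dvd int D" using pq(1) by simp
  then have "(nat q)\<^sup>2 dvd D" by (simp only: int_dvd_int_iff)
  then have "nat q dvd 1" by (rule squarefreeD[OF assms(1)])
  then have "q = 1" using pq(1) by simp
  then show ?thesis by (simp add: pq(3))
qed

lemma algebraic_int_powers_bounded_denom:
  assumes "algebraic_int (qelt D a b)" "a \<in> \<rat>" "b \<in> \<rat>"
  obtains c :: int where "c \<noteq> 0"
    "\<And>k. \<exists>u v :: int. of_int c * qelt D a b ^ k = qelt D (of_int u) (of_int v)"
proof -
  define z where "z = qelt D a b"
  define L where "L = {qelt D (of_int u) (of_int v) | u v :: int. True}"
  have L_add: "x + y \<in> L" if "x \<in> L" "y \<in> L" for x y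
  proof -
    from that obtain u v u' v' where "x = qelt D (of_int u) (of_int v)" "y = qelt D (of_int u') (of_int v')"
      unfolding L_def by blast
    then have "x + y = qelt D (of_int (u + u')) (of_int (v + v'))"
      by (simp add: complex_eq_iff algebra_simps)
    then show ?thesis unfolding L_def by blast
  qed
  have L_mult: "x * y \<in> L" if "x \<in> L" "y \<in> L" for x y
  proof -
    from that obtain u v u' v' where "x = qelt D (of_int u) (of_int v)" "y = qelt D (of_int u') (of_int v')"
      unfolding L_def by blast
    then have "x * y = qelt D (of_int (u * u' - int D * v * v')) (of_int (u * v' + v * u'))"
      by (simp add: qelt_mult)
    then show ?thesis unfolding L_def by blast
  qed
  have L_int: "of_int k \<in> L" for k
    unfolding L_def by (auto simp: complex_eq_iff intro!: exI[of _ k] exI[of _ 0])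
  have L_sum: "sum f A \<in> L" if "\<And>i. i \<in> A \<Longrightarrow> f i \<in> L" for f and A :: "nat set"
    using that
  proof (induction A rule: infinite_finite_induct)
    case (insert x F) then show ?case by (simp add: L_add)
  qed (use L_int[of 0] in simp_all)
  have L_pow: "x ^ k \<in> L" if "x \<in> L" for x k
    using that L_int[of 1] by (induction k) (auto intro: L_mult)
  from assms(2) obtain p q where pq: "q > 0" "a = of_int p / of_int q" by (auto elim: Rats_cases')
  from assms(3) obtain r s where rs: "s > 0" "b = of_int r / of_int s" by (auto elim: Rats_cases')
  define e where "e = q * s"
  have e0: "e \<noteq> 0" using pq rs by (simp add: e_def)
  have "of_int e * z = qelt D (of_int (p * s)) (of_int (r * q))"
    using pq(1) rs(1) by (simp add: z_def e_def pq(2) rs(2) complex_eq_iff field_simps)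
  then have ez: "of_int e * z \<in> L" unfolding L_def by blast
  from assms(1) obtain P where P: "Polynomial.lead_coeff P = 1" "\<forall>i. Polynomial.coeff P i \<in> \<int>" "poly P z = 0"
    unfolding z_def[symmetric] by (auto elim: algebraic_int.cases)
  define n where "n = Polynomial.degree P"
  have "0 = (\<Sum>i\<le>n. Polynomial.coeff P i * z ^ i)" using P(3) by (simp add: poly_altdef n_def)
  also have "\<dots> = z ^ n + (\<Sum>i<n. Polynomial.coeff P i * z ^ i)"
    using P(1) by (simp add: n_def lessThan_Suc_atMost[symmetric])
  finally have zn: "z ^ n = - (\<Sum>i<n. Polynomial.coeff P i * z ^ i)" by (simp add: eq_neg_iff_add_eq_0)
  have main: "of_int (e ^ n) * z ^ k \<in> L" for k
  proof (induction k rule: less_induct)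
    case (less k)
    show ?case
    proof (cases "k < n")
      case True
      then have "of_int (e ^ n) * z ^ k = of_int (e ^ (n - k)) * (of_int e * z) ^ k"
        by (simp add: power_mult_distrib flip: power_add mult.assoc)
      then show ?thesis using L_mult[OF L_int L_pow[OF ez]] by metis
    next
      case False
      then have "z ^ k = z ^ n * z ^ (k - n)" by (simp flip: power_add)
      also have "\<dots> = (\<Sum>i<n. - Polynomial.coeff P i * z ^ (i + (k - n)))"
        by (simp add: zn sum_distrib_right sum_negf power_add mult.assoc)
      finally have *: "of_int (e ^ n) * z ^ k =
          (\<Sum>i<n. - Polynomial.coeff P i * (of_int (e ^ n) * z ^ (i + (k - n))))"
        by (simp add: sum_distrib_left algebra_simps sum_negf)
      have "- Polynomial.coeff P i * (of_int (e ^ n) * z ^ (i + (k - n))) \<in> L" if "i < n" for i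
      proof -
        from P(2) have "- Polynomial.coeff P i \<in> \<int>" by simp
        then obtain j where "- Polynomial.coeff P i = of_int j" by (rule Ints_cases)
        then have "- Polynomial.coeff P i \<in> L" using L_int by metis
        moreover have "of_int (e ^ n) * z ^ (i + (k - n)) \<in> L"
          using False that by (intro less.IH) simp
        ultimately show ?thesis by (rule L_mult)
      qed
      then show ?thesis unfolding * by (intro L_sum) auto
    qed
  qed
  show ?thesis
  proof (rule that[of "e ^ n"])
    show "e ^ n \<noteq> 0" using e0 by simp
    show "\<exists>u v :: int. of_int (e ^ n) * qelt D a b ^ k = qelt D (of_int u) (of_int v)" for k
      using main[of k] unfolding L_def z_def by blast
  qed
qed

lemma algebraic_int_norm_int:
  assumes "algebraic_int (qelt D a b)" "a \<in> \<rat>" "b \<in> \<rat>"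
  shows "a\<^sup>2 + real D * b\<^sup>2 \<in> \<int>"
proof -
  obtain c :: int where c: "c \<noteq> 0"
    "\<And>k. \<exists>u v :: int. of_int c * qelt D a b ^ k = qelt D (of_int u) (of_int v)"
    using algebraic_int_powers_bounded_denom[OF assms] by blast
  have nrm: "(cmod (qelt D x y))\<^sup>2 = x\<^sup>2 + real D * y\<^sup>2" for x y
    by (simp add: cmod_power2 power_mult_distrib)
  show ?thesis
  proof (rule rat_int_if_powers_bounded_denom[of _ "c\<^sup>2"])
    show "a\<^sup>2 + real D * b\<^sup>2 \<in> \<rat>" using assms by simp
    show "c\<^sup>2 \<noteq> 0" using c by simp
    fix k
    obtain u v :: int where uv: "of_int c * qelt D a b ^ k = qelt D (of_int u) (of_int v)"
      using c(2) by blast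
    have "of_int (c\<^sup>2) * (a\<^sup>2 + real D * b\<^sup>2) ^ k = (cmod (of_int c * qelt D a b ^ k))\<^sup>2"
      by (simp add: norm_mult norm_power power_mult_distrib nrm flip: power_mult)
        (simp add: power_mult mult.commute[of k] nrm)
    also have "\<dots> = of_int (u\<^sup>2 + int D * v\<^sup>2)" by (simp add: uv nrm)
    finally show "of_int (c\<^sup>2) * (a\<^sup>2 + real D * b\<^sup>2) ^ k \<in> \<int>" by (metis Ints_of_int)
  qed
qed

lemma algebraic_int_add_1:
  fixes z :: complex
  assumes "algebraic_int z" shows "algebraic_int (z + 1)"
proof -
  from assms obtain P where P: "Polynomial.lead_coeff P = 1"
      "\<forall>i. Polynomial.coeff P i \<in> \<int>" "poly P z = 0"
    by (auto elim: algebraic_int.cases)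
  define Q where "Q = pcompose P [:-1, 1:]"
  have "Polynomial.lead_coeff Q = 1"
    unfolding Q_def by (subst lead_coeff_comp) (use P in auto)
  moreover have "\<forall>i. Polynomial.coeff Q i \<in> \<int>"
    unfolding Q_def using P(2)
  proof (induction P)
    case (pCons a p)
    have "Polynomial.coeff p i \<in> \<int>" for i using pCons.prems[rule_format, of "Suc i"] by simp
    then have "\<forall>i. Polynomial.coeff (pcompose p [:-1, 1:]) i \<in> \<int>" by (intro pCons.IH) simp
    moreover have "a \<in> \<int>" using pCons.prems[rule_format, of 0] by simp
    ultimately show ?case by (simp add: pcompose_pCons coeff_pCons split: nat.splits)
  qed simp
  moreover have "poly Q (z + 1) = 0" using P(3) by (simp add: Q_def poly_pcompose)
  ultimately show ?thesis by (intro algebraic_int.intros)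
qed

lemma quad_integers_iff:
  assumes "D > 0" "squarefree D"
  shows "z \<in> quad_integers D \<longleftrightarrow>
    (\<exists>s t :: int. z = Complex (of_int s / 2) (of_int t / 2 * sqrt (real D)) \<and>
       4 dvd s\<^sup>2 + int D * t\<^sup>2)"
proof
  assume "z \<in> quad_integers D"
  then obtain a b where z: "z = qelt D a b" and r: "a \<in> \<rat>" "b \<in> \<rat>" and alg: "algebraic_int z"
    by (auto simp: quad_integers_def quad_field_eq[OF assms(1)])
  have N: "a\<^sup>2 + real D * b\<^sup>2 \<in> \<int>"
    using algebraic_int_norm_int alg r by (simp add: z)
  have "z + 1 = qelt D (a + 1) b" by (simp add: z complex_eq_iff)
  then have "(a + 1)\<^sup>2 + real D * b\<^sup>2 \<in> \<int>"
    using algebraic_int_norm_int[of "a + 1" b D] algebraic_int_add_1[OF alg] r by simp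
  from Ints_diff[OF Ints_diff[OF this N] Ints_1] have "2 * a \<in> \<int>"
    by (simp add: power2_eq_square algebra_simps)
  then obtain s where s: "2 * a = of_int s" by (auto elim: Ints_cases)
  from N obtain w where w: "a\<^sup>2 + real D * b\<^sup>2 = of_int w" by (auto elim: Ints_cases)
  have "real D * (2 * b)\<^sup>2 = 4 * (a\<^sup>2 + real D * b\<^sup>2) - (2 * a)\<^sup>2"
    by (simp add: power2_eq_square algebra_simps)
  also have "\<dots> = of_int (4 * w - s\<^sup>2)" by (simp only: w s) simp
  finally have "real D * (2 * b)\<^sup>2 \<in> \<int>" by (metis Ints_of_int)
  moreover have "2 * b \<in> \<rat>" using r by simp
  ultimately have "2 * b \<in> \<int>" by (rule rat_int_if_squarefree_mult_square[OF assms(2), rotated])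
  then obtain t where t: "2 * b = of_int t" by (auto elim: Ints_cases)
  have "real_of_int (s\<^sup>2 + int D * t\<^sup>2) = of_int (4 * w)"
    by (simp flip: s t w add: power2_eq_square algebra_simps)
  then have "s\<^sup>2 + int D * t\<^sup>2 = 4 * w" by linarith
  moreover have "z = qelt D (of_int s / 2) (of_int t / 2)" by (simp add: z flip: s t)
  ultimately show "\<exists>s t :: int. z = qelt D (of_int s / 2) (of_int t / 2) \<and> 4 dvd s\<^sup>2 + int D * t\<^sup>2"
    by (metis dvd_triv_left)
next
  assume "\<exists>s t :: int. z = qelt D (of_int s / 2) (of_int t / 2) \<and> 4 dvd s\<^sup>2 + int D * t\<^sup>2"
  then obtain s t w :: int where z: "z = qelt D (of_int s / 2) (of_int t / 2)"
    and w: "s\<^sup>2 + int D * t\<^sup>2 = 4 * w" by (elim exE conjE dvdE) (rule that)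
  have w': "(real_of_int s)\<^sup>2 + real D * (real_of_int t)\<^sup>2 = 4 * of_int w"
    using arg_cong[OF w, of real_of_int] by simp
  have "poly [:of_int w, - of_int s, 1:] z = 0"
    using w' by (simp add: z complex_eq_iff algebra_simps power2_eq_square)
  then have "algebraic_int z"
    by (intro algebraic_int.intros[of "[:of_int w, - of_int s, 1:]"])
      (auto simp: coeff_pCons split: nat.splits)
  moreover have "real_of_int s / 2 \<in> \<rat>" "real_of_int t / 2 \<in> \<rat>" by simp_all
  then have "z \<in> quad_field D"
    unfolding quad_field_eq[OF assms(1)] z by blast
  ultimately show "z \<in> quad_integers D" by (simp add: quad_integers_def)
qed

lemma quad_form_dvd_4_iff:
  fixes s t :: int
  assumes "squarefree D"
  shows "4 dvd s\<^sup>2 + int D * t\<^sup>2 \<longleftrightarrow>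
    (if D mod 4 = 3 then even (s - t) else even s \<and> even t)"
proof -
  have "D mod 4 \<noteq> 0"
    using squarefreeD[OF assms, of 2] by (auto simp: mod_eq_0_iff_dvd)
  then have D: "D mod 4 = 1 \<or> D mod 4 = 2 \<or> D mod 4 = 3" by linarith
  have sq: "x\<^sup>2 mod 4 = (if even x then 0 else 1)" for x :: int
  proof (cases "even x")
    case True
    then obtain y where "x = 2 * y" by (elim evenE)
    then show ?thesis by (simp add: power2_eq_square)
  next
    case False
    then obtain y where "x = 2 * y + 1" by (elim oddE)
    then have "x\<^sup>2 = 4 * (y\<^sup>2 + y) + 1" by (simp add: power2_eq_square algebra_simps)
    then have "x\<^sup>2 mod 4 = 1" by presburger
    then show ?thesis using False by simp
  qed
  define r where "r = int (D mod 4)"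
  have "(s\<^sup>2 + int D * t\<^sup>2) mod 4 = (s\<^sup>2 mod 4 + r * (t\<^sup>2 mod 4)) mod 4"
    unfolding r_def by (intro mod_add_cong mod_mult_cong) (simp_all add: zmod_int)
  also have "\<dots> = ((if even s then 0 else 1) + r * (if even t then 0 else 1)) mod 4"
    by (simp only: sq)
  also have "\<dots> = 0 \<longleftrightarrow> (if D mod 4 = 3 then even (s - t) else even s \<and> even t)"
    using D by (cases "even s"; cases "even t") (auto simp: r_def)
  finally show ?thesis unfolding dvd_eq_mod_eq_0[of 4 "s\<^sup>2 + int D * t\<^sup>2"] .
qed

lemma cring_quad_ring:
  assumes "D > 0" "squarefree D"
  shows "cring (quad_ring D)"
proof -
  let ?R = "ring_of_type_algebra :: complex ring" and ?O = "quad_integers D"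
  interpret R: cring ?R by (rule cring_from_type_algebra)
  have car: "carrier ?R = UNIV" and ad: "x \<oplus>\<^bsub>?R\<^esub> y = x + y" and mu: "x \<otimes>\<^bsub>?R\<^esub> y = x * y"
    and on: "\<one>\<^bsub>?R\<^esub> = 1" and ze: "\<zero>\<^bsub>?R\<^esub> = 0" for x y
    by (simp_all add: ring_of_type_algebra_def)
  have um: "\<ominus>\<^bsub>?R\<^esub> x = - x" for x
    using R.minus_equality[of "- x" x] by (simp add: car ad ze)
  note O = quad_integers_iff[OF assms] and dv = quad_form_dvd_4_iff[OF assms(2)]
  have "1 \<in> ?O"
    unfolding O by (intro exI[of _ 2] exI[of _ 0]) (simp add: complex_eq_iff)
  moreover have "- x \<in> ?O" if x: "x \<in> ?O" for x
  proof -
    from x obtain s t :: int where "x = qelt D (of_int s / 2) (of_int t / 2)"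
      "4 dvd s\<^sup>2 + int D * t\<^sup>2" unfolding O by blast
    then show ?thesis unfolding O
      by (intro exI[of _ "- s"] exI[of _ "- t"]) (simp add: complex_eq_iff)
  qed
  moreover have "x + y \<in> ?O" if x: "x \<in> ?O" and y: "y \<in> ?O" for x y
  proof -
    from x obtain s t :: int where 1: "x = qelt D (of_int s / 2) (of_int t / 2)"
      "4 dvd s\<^sup>2 + int D * t\<^sup>2" unfolding O by blast
    from y obtain s' t' :: int where 2: "y = qelt D (of_int s' / 2) (of_int t' / 2)"
      "4 dvd s'\<^sup>2 + int D * t'\<^sup>2" unfolding O by blast
    have "4 dvd (s + s')\<^sup>2 + int D * (t + t')\<^sup>2"
      using 1(2) 2(2) unfolding dv by (auto split: if_splits)
    with 1(1) 2(1) show ?thesis unfolding O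
      by (intro exI[of _ "s + s'"] exI[of _ "t + t'"]) (simp add: complex_eq_iff field_simps)
  qed
  moreover have "x * y \<in> ?O" if x: "x \<in> ?O" and y: "y \<in> ?O" for x y
  proof -
    from x obtain s t :: int where 1: "x = qelt D (of_int s / 2) (of_int t / 2)"
      "4 dvd s\<^sup>2 + int D * t\<^sup>2" unfolding O by blast
    from y obtain s' t' :: int where 2: "y = qelt D (of_int s' / 2) (of_int t' / 2)"
      "4 dvd s'\<^sup>2 + int D * t'\<^sup>2" unfolding O by blast
    define S T where "S = s * s' - int D * t * t'" and "T = s * t' + t * s'"
    have "odd D" if "D mod 4 = 3" using that by presburger
    then have ev: "even S" "even T"
      using 1(2) 2(2) unfolding dv S_def T_def
      by (simp_all split: if_splits)
    obtain S' T' where ST: "S = 2 * S'" "T = 2 * T'" using ev by (elim evenE)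
    obtain u u' where u: "s\<^sup>2 + int D * t\<^sup>2 = 4 * u" "s'\<^sup>2 + int D * t'\<^sup>2 = 4 * u'"
      using 1(2) 2(2) by (elim dvdE)
    have "S\<^sup>2 + int D * T\<^sup>2 = (s\<^sup>2 + int D * t\<^sup>2) * (s'\<^sup>2 + int D * t'\<^sup>2)"
      by (simp add: S_def T_def power2_eq_square algebra_simps)
    then have "S'\<^sup>2 + int D * T'\<^sup>2 = 4 * (u * u')"
      unfolding u ST by (simp add: power2_eq_square)
    moreover have "real_of_int s * s' - real D * t * t' = 2 * S'" "real_of_int s * t' + t * s' = 2 * T'"
      using ST[unfolded S_def T_def, THEN arg_cong[of _ _ real_of_int]] by simp_all
    then have "of_int s / 2 * (of_int s' / 2) - real D * (of_int t / 2) * (of_int t' / 2) = of_int S' / 2"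
      "of_int s / 2 * (of_int t' / 2) + of_int t / 2 * (of_int s' / 2) = real_of_int T' / 2"
      by (auto simp: mult_ac)
    then have "x * y = qelt D (of_int S' / 2) (of_int T' / 2)"
      unfolding 1(1) 2(1) qelt_mult by (simp only:)
    ultimately show ?thesis unfolding O by (metis dvd_triv_left)
  qed
  ultimately have "subring ?O ?R"
    by (intro R.subringI) (simp_all only: car on um mu ad subset_UNIV)
  then have "subcring ?O ?R" by (rule R.subcringI')
  then show ?thesis unfolding quad_ring_def by (simp add: R.subcring_iff car)
qed

lemma integral_basis_exists:
  assumes "D > 0" "squarefree D"
  obtains w1 w2 where "integral_basis D w1 w2"
    "(w1 * cnj w2 - w2 * cnj w1)\<^sup>2 =
       of_int (if D mod 4 = 3 then - int D else - 4 * int D)"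
proof (cases "D mod 4 = 3")
  case True
  note O = quad_integers_iff[OF assms] and dv = quad_form_dvd_4_iff[OF assms(2)]
  let ?w = "qelt D (1 / 2) (1 / 2)"
  have rep: "of_int a * 1 + of_int b * ?w = qelt D (of_int (2 * a + b) / 2) (of_int b / 2)" for a b :: int
    by (simp add: complex_eq_iff add_divide_distrib)
  have "1 \<in> quad_integers D"
    unfolding O by (intro exI[of _ 2] exI[of _ 0]) (simp add: complex_eq_iff)
  moreover have "?w \<in> quad_integers D"
    unfolding O dv using True by (intro exI[of _ 1]) (simp add: complex_eq_iff)
  moreover have "\<exists>!(a, b). z = of_int a * 1 + of_int b * ?w" if "z \<in> quad_integers D" for z
  proof -
    from that obtain s t :: int where z: "z = qelt D (of_int s / 2) (of_int t / 2)" and "even (s - t)"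
      unfolding O dv using True by auto
    then obtain a where "s - t = 2 * a" by (elim evenE)
    then have s: "s = 2 * a + t" by simp
    show ?thesis
    proof (rule ex1I[of _ "(a, t)"])
      show "case (a, t) of (a, b) \<Rightarrow> z = of_int a * 1 + of_int b * ?w"
        unfolding prod.case rep z s ..
      fix ab assume "case ab of (a, b) \<Rightarrow> z = of_int a * 1 + of_int b * ?w"
      then obtain a' b' where ab: "ab = (a', b')" and "z = of_int a' * 1 + of_int b' * ?w"
        by (cases ab) auto
      then have eq: "qelt D (of_int (2 * a + t) / 2) (of_int t / 2) =
          qelt D (of_int (2 * a' + b') / 2) (of_int b' / 2)"
        unfolding z s rep by simp
      then have "of_int t * sqrt (real D) = of_int b' * sqrt (real D)"
        by (simp add: complex_eq_iff)
      then have "t = b'" using assms(1) by simp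
      moreover have "real_of_int (2 * a + t) = of_int (2 * a' + b')" using eq by (simp add: complex_eq_iff)
      then have "2 * a + t = 2 * a' + b'" by linarith
      ultimately show "ab = (a, t)" by (simp add: ab)
    qed
  qed
  ultimately have "integral_basis D 1 ?w" unfolding integral_basis_def by blast
  moreover have "(1 * cnj ?w - ?w * cnj 1)\<^sup>2 = of_int (- int D)"
    by (simp add: complex_eq_iff power2_eq_square)
  ultimately show ?thesis using that True by simp
next
  case False
  note O = quad_integers_iff[OF assms] and dv = quad_form_dvd_4_iff[OF assms(2)]
  let ?w = "qelt D 0 1"
  have rep: "of_int a * 1 + of_int b * ?w = qelt D (of_int a) (of_int b)" for a b :: int
    by (simp add: complex_eq_iff)
  have "1 \<in> quad_integers D"
    unfolding O by (intro exI[of _ 2] exI[of _ 0]) (simp add: complex_eq_iff)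
  moreover have "?w \<in> quad_integers D"
    unfolding O dv using False by (intro exI[of _ 0] exI[of _ 2]) (simp add: complex_eq_iff)
  moreover have "\<exists>!(a, b). z = of_int a * 1 + of_int b * ?w" if "z \<in> quad_integers D" for z
  proof -
    from that obtain s t :: int where z: "z = qelt D (of_int s / 2) (of_int t / 2)" and ev: "even s" "even t"
      unfolding O dv using False by auto
    obtain a b where "s = 2 * a" "t = 2 * b" using ev by (elim evenE)
    then have z: "z = qelt D (of_int a) (of_int b)" by (simp add: z)
    show ?thesis
    proof (rule ex1I[of _ "(a, b)"])
      show "case (a, b) of (a, b) \<Rightarrow> z = of_int a * 1 + of_int b * ?w"
        unfolding prod.case rep z ..
      fix ab assume "case ab of (a, b) \<Rightarrow> z = of_int a * 1 + of_int b * ?w"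
      then obtain a' b' where ab: "ab = (a', b')" and "z = of_int a' * 1 + of_int b' * ?w"
        by (cases ab) auto
      then have "qelt D (of_int a) (of_int b) = qelt D (of_int a') (of_int b')"
        unfolding z rep by simp
      then show "ab = (a, b)" using assms(1) by (simp add: ab complex_eq_iff)
    qed
  qed
  ultimately have "integral_basis D 1 ?w" unfolding integral_basis_def by blast
  moreover have "(1 * cnj ?w - ?w * cnj 1)\<^sup>2 = of_int (- 4 * int D)"
    by (simp add: complex_eq_iff power2_eq_square)
  ultimately show ?thesis using that False by simp
qed

lemma integral_basis_det_multiple:
  assumes "integral_basis D w1 w2" "integral_basis D v1 v2"
  obtains k :: int where "v1 * cnj v2 - v2 * cnj v1 = of_int k * (w1 * cnj w2 - w2 * cnj w1)"
proof -
  from assms have "\<exists>!(a, b). v1 = of_int a * w1 + of_int b * w2"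
    "\<exists>!(a, b). v2 = of_int a * w1 + of_int b * w2"
    unfolding integral_basis_def by blast+
  then obtain a b c e :: int where "v1 = of_int a * w1 + of_int b * w2" "v2 = of_int c * w1 + of_int e * w2"
    by (auto elim!: ex1E)
  then have "v1 * cnj v2 - v2 * cnj v1 = of_int (a * e - b * c) * (w1 * cnj w2 - w2 * cnj w1)"
    by (simp add: algebra_simps)
  then show ?thesis by (rule that)
qed

theorem discriminant_eq:
  assumes "D > 0" "squarefree D"
  shows "discriminant D = (if D mod 4 = 3 then - int D else - 4 * int D)" (is "_ = ?\<Delta>")
proof -
  obtain w1 w2 where w: "integral_basis D w1 w2" "(w1 * cnj w2 - w2 * cnj w1)\<^sup>2 = of_int ?\<Delta>"
    using integral_basis_exists[OF assms] by blast
  show ?thesis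
    unfolding discriminant_def
  proof (rule the_equality)
    show "\<exists>w1 w2. integral_basis D w1 w2 \<and> of_int ?\<Delta> = (w1 * cnj w2 - w2 * cnj w1)\<^sup>2"
      using w by metis
    fix \<Delta> assume "\<exists>w1 w2. integral_basis D w1 w2 \<and> of_int \<Delta> = (w1 * cnj w2 - w2 * cnj w1)\<^sup>2"
    then obtain v1 v2 where v: "integral_basis D v1 v2" "of_int \<Delta> = (v1 * cnj v2 - v2 * cnj v1)\<^sup>2"
      by blast
    obtain k where k: "v1 * cnj v2 - v2 * cnj v1 = of_int k * (w1 * cnj w2 - w2 * cnj w1)"
      using integral_basis_det_multiple[OF w(1) v(1)] .
    obtain l where l: "w1 * cnj w2 - w2 * cnj w1 = of_int l * (v1 * cnj v2 - v2 * cnj v1)"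
      using integral_basis_det_multiple[OF v(1) w(1)] .
    have "of_int \<Delta> = (of_int (k\<^sup>2 * ?\<Delta>) :: complex)"
      unfolding v(2) k power_mult_distrib w(2) by simp
    then have 1: "\<Delta> = k\<^sup>2 * ?\<Delta>" unfolding of_int_eq_iff .
    have "of_int ?\<Delta> = (of_int (l\<^sup>2 * \<Delta>) :: complex)"
      unfolding w(2)[symmetric] l power_mult_distrib v(2)[symmetric] by simp
    then have 2: "?\<Delta> = l\<^sup>2 * \<Delta>" unfolding of_int_eq_iff .
    have "?\<Delta> \<noteq> 0" using assms(1) by simp
    moreover have "?\<Delta> = (l\<^sup>2 * k\<^sup>2) * ?\<Delta>" using 1 2 by (metis mult.assoc)
    ultimately have "l\<^sup>2 * k\<^sup>2 = 1" by simp
    then have "k\<^sup>2 dvd 1" by (metis dvd_triv_right)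
    then have "k\<^sup>2 = 1" by (simp add: zdvd1_eq)
    then show "\<Delta> = ?\<Delta>" using 1 by simp
  qed
qed

end

theory Submission
  imports Defs
begin

text \<open>
  Write \<open>I\<close> as a finite union of residue classes modulo \<open>N \<O>\<close> for an integer \<open>N \<in> I\<close>. For fixed \<open>q\<close>
  the number of admissible \<open>p\<close> is a function \<open>h\<^sub>q\<close> of \<open>\<theta>\<close> that is periodic modulo the matrices over
  \<open>N \<O>\<close>, so it can be averaged over a period cell. Translation invariance of this average gives the
  mean of \<open>h\<^sub>q\<close> exactly and shows that \<open>h\<^sub>q\<close> and \<open>h\<^bsub>q'\<^esub>\<close> are uncorrelated when \<open>q\<close> and \<open>q'\<close> are linearly
  independent. If \<open>q = (a / b) q'\<close> with \<open>b\<close> a denominator of least modulus, then the correlation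
  exceeds the product of the means at most by the effect of enlarging the radius of approximation
  by \<open>O(1 / \<bar>b\<bar>)\<close>. Summing over \<open>a\<close>, \<open>b\<close> and \<open>q'\<close>, which converges because \<open>m + n \<ge> 3\<close>, bounds the
  variance of the counting function by \<open>O(V\<^bsup>2 - 1/(2m)\<^esup>)\<close>, where \<open>V\<close> is the volume of the region.
  Chebyshev's inequality along values of \<open>T\<close> with \<open>V \<approx> k\<^bsup>4m\<^esup>\<close>, the Borel-Cantelli argument and
  monotonicity in \<open>T\<close> conclude the proof.
\<close>

text \<open>The averages run over the torus of matrices modulo N \<O>, and their one tool is the
  substitution of \<theta> + c for \<theta> with c of rank one: it moves the form \<theta>q by any
  prescribed vector, so the shift in the counting problem can be averaged away. For proportional q
  and q' both forms move together; this is the obstacle that shapes the proof. As \<O> need not have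
  unique factorisation, there are no lowest terms to rely on. The saving in the variance comes from
  r^(2m) growing by about 2m delta r^(2m-1) when the radius r grows by delta, while r is at most of
  order V^(1/(2m)). Along the chosen values the variance divided by V^2 is O(1/k^2), which is
  summable, and consecutive values of V have ratio tending to 1, so that monotonicity loses nothing.
  Replacing the ideal by N \<O> makes every lattice a product of copies of one planar lattice with a
  rectangular cell; the ideal norm returns only through the number of residue classes.\<close>

section \<open>Sums over countable sets, translations and dilations under the integral\<close>

lemma borel_measurable_nn_integral_count_space:
  fixes f :: "'i \<Rightarrow> 'a \<Rightarrow> ennreal"
  assumes I: "countable I" and f: "\<And>i. i \<in> I \<Longrightarrow> f i \<in> borel_measurable M"
  shows "(\<lambda>x. \<integral>\<^sup>+i. f i x \<partial>count_space I) \<in> borel_measurable M"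
proof (cases "finite I")
  case True
  then show ?thesis using f by (simp add: nn_integral_count_space_finite)
next
  case False
  note * = bij_betw_from_nat_into[OF I False]
  have "(\<lambda>x. \<integral>\<^sup>+i. f i x \<partial>count_space I) = (\<lambda>x. \<Sum>n. f (from_nat_into I n) x)"
    by (simp add: nn_integral_bij_count_space[symmetric, OF *] nn_integral_count_space_nat)
  moreover have "f (from_nat_into I n) \<in> borel_measurable M" for n
    using f from_nat_into[of I n] False by auto
  ultimately show ?thesis by simp
qed

lemma nn_integral_lborel_shift:
  fixes c :: "'a::euclidean_space"
  assumes "f \<in> borel_measurable borel"
  shows "(\<integral>\<^sup>+x. f (x + c) \<partial>lborel) = (\<integral>\<^sup>+x. f x \<partial>lborel)"
proof -
  have "(\<integral>\<^sup>+x. f x \<partial>lborel) = (\<integral>\<^sup>+x. f x \<partial>distr lborel borel ((+) c))"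
    by (simp add: lborel_distr_plus)
  also have "\<dots> = (\<integral>\<^sup>+x. f (c + x) \<partial>lborel)"
    using assms by (subst nn_integral_distr) simp_all
  finally show ?thesis by (simp add: add.commute)
qed

lemma nn_integral_lborel_scale:
  fixes f :: "'a::euclidean_space \<Rightarrow> ennreal"
  assumes "c > 0" and f: "f \<in> borel_measurable borel"
  shows "(\<integral>\<^sup>+x. f x \<partial>lborel) = ennreal (c ^ DIM('a)) * (\<integral>\<^sup>+x. f (c *\<^sub>R x) \<partial>lborel)"
proof -
  have "(\<integral>\<^sup>+x. f x \<partial>lborel) =
      (\<integral>\<^sup>+x. f x \<partial>density (distr lborel borel (\<lambda>x::'a. 0 + c *\<^sub>R x)) (\<lambda>_. \<bar>c ^ DIM('a)\<bar>))"
    using lborel_affine[of c "0::'a"] assms(1) by simp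
  also have "\<dots> = (\<integral>\<^sup>+x. ennreal (c ^ DIM('a)) * f (c *\<^sub>R x) \<partial>lborel)"
    using assms by (simp add: nn_integral_density nn_integral_distr)
  also have "\<dots> = ennreal (c ^ DIM('a)) * (\<integral>\<^sup>+x. f (c *\<^sub>R x) \<partial>lborel)"
    using f by (intro nn_integral_cmult) simp
  finally show ?thesis .
qed

section \<open>Tilings by lattice translates\<close>

text \<open>Summation over the coset \<open>y + L\<close> is written as an \<open>ennreal\<close>
  integral against counting measure: no summability is at stake and Tonelli applies.\<close>

definition periodization :: "'a::ab_group_add set \<Rightarrow> ('a \<Rightarrow> ennreal) \<Rightarrow> 'a \<Rightarrow> ennreal" where
  "periodization L f y = (\<integral>\<^sup>+l. f (y + l) \<partial>count_space L)"

text \<open>The set \<open>F\<close> is an exact fundamental domain: \<open>ex1_translate\<close>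
  holds at every point, so unfolding involves no null sets. Applied to 0 it shows that
  \<open>L\<close> is nonempty, hence a subgroup by \<open>diff_L\<close>.\<close>

locale tiling =
  fixes L F :: "'a::euclidean_space set"
  assumes countable_L: "countable L"
    and diff_L: "\<And>x y. x \<in> L \<Longrightarrow> y \<in> L \<Longrightarrow> x - y \<in> L"
    and F_borel [measurable]: "F \<in> sets borel"
    and F_bounded: "bounded F"
    and ex1_translate: "\<And>x. \<exists>!l. l \<in> L \<and> x + l \<in> F"
begin

lemma zero_L: "0 \<in> L"
  using ex1_translate[of 0] diff_L by (metis diff_self)

lemma uminus_L: "x \<in> L \<Longrightarrow> - x \<in> L"
  using diff_L[OF zero_L] by simp

lemma add_L: "x \<in> L \<Longrightarrow> y \<in> L \<Longrightarrow> x + y \<in> L"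
  using diff_L[of x "- y"] uminus_L[of y] by simp

lemma periodization_measurable [measurable]:
  assumes [measurable]: "f \<in> borel_measurable borel"
  shows "periodization L f \<in> borel_measurable borel"
  unfolding periodization_def
  by (rule borel_measurable_nn_integral_count_space[OF countable_L]) simp

lemma periodization_periodic:
  assumes "l \<in> L"
  shows "periodization L f (y + l) = periodization L f y"
proof -
  have "bij_betw (\<lambda>k. l + k) L L"
    by (rule bij_betw_byWitness[of _ "\<lambda>k. k - l"]) (use assms add_L diff_L in auto)
  from nn_integral_bij_count_space[OF this, of "\<lambda>k. f (y + k)"] show ?thesis
    unfolding periodization_def by (simp add: add.assoc)
qed

lemma periodization_indicator_F: "periodization L (indicator F) y = 1"
proof -
  define l where "l = (THE l. l \<in> L \<and> y + l \<in> F)"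
  have l: "l \<in> L" "y + l \<in> F" unfolding l_def using theI'[OF ex1_translate[of y]] by simp_all
  have uniq: "k = l" if "k \<in> L" "y + k \<in> F" for k
    unfolding l_def using the1_equality[OF ex1_translate[of y], of k] that by simp
  have "periodization L (indicator F) y = (\<integral>\<^sup>+k. indicator {l} k \<partial>count_space L)"
    unfolding periodization_def
  proof (rule nn_integral_cong)
    fix k assume "k \<in> space (count_space L)"
    then have k: "k \<in> L" by simp
    have "y + k \<in> F \<longleftrightarrow> k = l" using l(2) uniq[OF k] by (cases "k = l") auto
    then show "indicator F (y + k) = (indicator {l} k :: ennreal)" by (simp add: indicator_def)
  qed
  also have "\<dots> = 1" using l(1) by (simp add: one_ennreal_def)
  finally show ?thesis .
qed

text \<open>Tonelli applied to the fact that translates of \<open>F\<close> cover each point once,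
  that is, the indicators of \<open>F\<close> at \<open>x - l\<close> sum to 1 over
  \<open>L\<close>.\<close>

lemma nn_integral_unfold:
  assumes [measurable]: "f \<in> borel_measurable borel"
  shows "(\<integral>\<^sup>+x. f x \<partial>lborel) = (\<integral>\<^sup>+x\<in>F. periodization L f x \<partial>lborel)"
proof -
  have "(\<integral>\<^sup>+x\<in>F. periodization L f x \<partial>lborel)
      = (\<integral>\<^sup>+x. \<integral>\<^sup>+l. f (x + l) * indicator F x \<partial>count_space L \<partial>lborel)"
    unfolding periodization_def by (intro nn_integral_cong nn_integral_multc[symmetric]) simp
  also have "\<dots> = (\<integral>\<^sup>+l. \<integral>\<^sup>+x. f (x + l) * indicator F x \<partial>lborel \<partial>count_space L)"
    by (rule nn_integral_count_space_nn_integral[OF countable_L]) simp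
  also have "\<dots> = (\<integral>\<^sup>+l. \<integral>\<^sup>+x. f x * indicator F (x - l) \<partial>lborel \<partial>count_space L)"
  proof (rule nn_integral_cong)
    fix l
    show "(\<integral>\<^sup>+x. f (x + l) * indicator F x \<partial>lborel) = (\<integral>\<^sup>+x. f x * indicator F (x - l) \<partial>lborel)"
      using nn_integral_lborel_shift[of "\<lambda>x. f x * indicator F (x - l)" l] by simp
  qed
  also have "\<dots> = (\<integral>\<^sup>+x. \<integral>\<^sup>+l. f x * indicator F (x - l) \<partial>count_space L \<partial>lborel)"
    by (rule nn_integral_count_space_nn_integral[OF countable_L, symmetric]) simp
  also have "\<dots> = (\<integral>\<^sup>+x. f x \<partial>lborel)"
  proof (rule nn_integral_cong)
    fix x
    have "bij_betw uminus L L"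
      by (rule bij_betw_byWitness[of _ uminus]) (use uminus_L in auto)
    from nn_integral_bij_count_space[OF this, of "\<lambda>l. indicator F (x + l)"]
    have "(\<integral>\<^sup>+l. indicator F (x - l) \<partial>count_space L) = (1::ennreal)"
      using periodization_indicator_F[of x] by (simp add: periodization_def)
    then show "(\<integral>\<^sup>+l. f x * indicator F (x - l) \<partial>count_space L) = f x"
      by (subst nn_integral_cmult) simp_all
  qed
  finally show ?thesis by simp
qed

text \<open>The left side is the integral of \<open>g\<close> over \<open>F + c\<close>, another
  fundamental domain. Unfolding \<open>g\<close> times the indicator of \<open>F + c\<close> shows
  that a periodic function has the same integral over both.\<close>

lemma nn_integral_F_shift:
  assumes [measurable]: "g \<in> borel_measurable borel"
    and per: "\<And>x l. l \<in> L \<Longrightarrow> g (x + l) = g x"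
  shows "(\<integral>\<^sup>+x\<in>F. g (x + c) \<partial>lborel) = (\<integral>\<^sup>+x\<in>F. g x \<partial>lborel)"
proof -
  have "(\<integral>\<^sup>+x\<in>F. g (x + c) \<partial>lborel) = (\<integral>\<^sup>+x. g x * indicator F (x - c) \<partial>lborel)"
    using nn_integral_lborel_shift[of "\<lambda>x. g x * indicator F (x - c)" c] by simp
  also have "\<dots> = (\<integral>\<^sup>+x\<in>F. periodization L (\<lambda>x. g x * indicator F (x - c)) x \<partial>lborel)"
    by (rule nn_integral_unfold) simp
  also have "\<dots> = (\<integral>\<^sup>+x\<in>F. g x \<partial>lborel)"
  proof (intro nn_integral_cong)
    fix x
    have "periodization L (\<lambda>x. g x * indicator F (x - c)) x
        = (\<integral>\<^sup>+l. g x * indicator F ((x - c) + l) \<partial>count_space L)"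
      unfolding periodization_def
    proof (rule nn_integral_cong)
      fix l assume "l \<in> space (count_space L)"
      then have l: "l \<in> L" by simp
      have "x + l - c = x - c + l" by simp
      then show "g (x + l) * indicator F (x + l - c) = g x * indicator F (x - c + l)"
        by (simp only: per[OF l])
    qed
    also have "\<dots> = g x * periodization L (indicator F) (x - c)"
      unfolding periodization_def by (rule nn_integral_cmult) simp
    finally show "periodization L (\<lambda>x. g x * indicator F (x - c)) x * indicator F x = g x * indicator F x"
      by (simp add: periodization_indicator_F)
  qed
  finally show ?thesis .
qed

lemma emeasure_F_finite: "emeasure lborel F < \<infinity>"
  using emeasure_bounded_finite[OF F_bounded] .

text \<open>If \<open>F\<close> were null, unfolding the constant 1 would make the whole space
  null.\<close>

lemma emeasure_F_pos: "emeasure lborel F > 0"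
proof (rule ccontr)
  assume "\<not> emeasure lborel F > 0"
  then have 0: "emeasure lborel F = 0" by simp
  have "(\<integral>\<^sup>+x. (1::ennreal) \<partial>(lborel :: 'a measure)) = (\<integral>\<^sup>+x\<in>F. periodization L (\<lambda>_. 1) x \<partial>lborel)"
    by (rule nn_integral_unfold) simp
  also have "\<dots> = 0"
    by (rule nn_integral_null_set) (use 0 in \<open>auto simp: null_sets_def\<close>)
  finally show False by simp
qed

definition vol :: real where "vol = measure lborel F"

lemma vol_pos: "vol > 0"
  unfolding vol_def measure_def using emeasure_F_finite emeasure_F_pos
  by (simp add: enn2real_positive_iff)

lemma emeasure_F: "emeasure lborel F = ennreal vol"
  unfolding vol_def using emeasure_F_finite by (simp add: emeasure_eq_ennreal_measure)

lemma nn_integral_periodization_shift: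
  assumes [measurable]: "f \<in> borel_measurable borel"
  shows "(\<integral>\<^sup>+x\<in>F. periodization L f (x + c) \<partial>lborel) = (\<integral>\<^sup>+x. f x \<partial>lborel)"
  by (simp add: nn_integral_F_shift[of "periodization L f"] periodization_periodic
      nn_integral_unfold[symmetric])

text \<open>The moment estimates live on one cell, the final claim on the whole space; countably
  many translates of the exceptional set are still null.\<close>

lemma AE_of_AE_F:
  assumes "AE x in lborel. x \<in> F \<longrightarrow> P x" and P: "\<And>x l. l \<in> L \<Longrightarrow> P (x + l) \<Longrightarrow> P x"
  shows "AE x in lborel. P x"
proof -
  have "AE x in lborel. x + l \<in> F \<longrightarrow> P (x + l)" if "l \<in> L" for l
  proof -
    have "AE x in distr lborel borel ((+) l). x \<in> F \<longrightarrow> P x"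
      unfolding lborel_distr_plus by (rule assms(1))
    then have "AE x in lborel. l + x \<in> F \<longrightarrow> P (l + x)"
      by (rule AE_distrD[rotated]) simp
    then show ?thesis by (simp add: add.commute)
  qed
  then have "AE x in lborel. \<forall>l\<in>L. x + l \<in> F \<longrightarrow> P (x + l)"
    by (simp only: AE_ball_countable[OF countable_L] ball_simps) blast
  then show ?thesis
    by eventually_elim (use ex1_translate P in metis)
qed

end

section \<open>Products of tilings\<close>

definition vec_set :: "'a set \<Rightarrow> ('a ^ 'k) set" where
  "vec_set A = {x. \<forall>i. x $ i \<in> A}"

lemma vec_set_iff: "x \<in> vec_set A \<longleftrightarrow> (\<forall>i. x $ i \<in> A)"
  by (simp add: vec_set_def)

lemma bij_betw_vec_set: "bij_betw vec_nth (vec_set A :: ('a ^ 'k) set) (UNIV \<rightarrow>\<^sub>E A)"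
  by (rule bij_betw_byWitness[of _ vec_lambda]) (auto simp: vec_set_iff PiE_def Pi_def)

lemma countable_vec_set:
  assumes "countable A" shows "countable (vec_set A :: ('a ^ 'k) set)"
proof -
  have "countable ((UNIV :: 'k set) \<rightarrow>\<^sub>E A)" using assms by (intro countable_PiE) auto
  then have "countable (vec_nth ` (vec_set A :: ('a ^ 'k) set))"
    using bij_betw_imp_surj_on[OF bij_betw_vec_set[of A, where 'k = 'k]] by simp
  then show ?thesis
    using bij_betw_imp_inj_on[OF bij_betw_vec_set[of A, where 'k = 'k]] by (rule countable_image_inj_on)
qed

lemma card_vec_set: "card (vec_set A :: ('a ^ 'k) set) = card A ^ CARD('k)"
  using bij_betw_same_card[OF bij_betw_vec_set[of A, where 'k = 'k]] by (simp add: card_PiE)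

lemma finite_vec_set: "finite A \<Longrightarrow> finite (vec_set A :: ('a ^ 'k) set)"
  using bij_betw_finite[OF bij_betw_vec_set[of A, where 'k = 'k]] by (simp add: finite_PiE)

lemma borel_measurable_vec_nth [measurable]:
  "(\<lambda>x::'a::euclidean_space ^ 'k. x $ i) \<in> borel_measurable borel"
  by (intro borel_measurable_continuous_onI continuous_intros)

text \<open>Applied twice this tiles the space of matrices, which are vectors of vectors.\<close>

lemma tiling_vec_set:
  assumes "tiling L F"
  shows "tiling (vec_set L) (vec_set F :: ('a::euclidean_space ^ 'k) set)"
proof -
  interpret tiling L F by fact
  show ?thesis
  proof
    show "countable (vec_set L :: ('a ^ 'k) set)" by (rule countable_vec_set[OF countable_L])
    show "x - y \<in> vec_set L" if "x \<in> vec_set L" "y \<in> vec_set L" for x y :: "'a ^ 'k"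
      using that diff_L by (simp add: vec_set_iff)
    have "(vec_set F :: ('a ^ 'k) set) = (\<Inter>i. (\<lambda>x. x $ i) -` F \<inter> space borel)"
      by (auto simp: vec_set_iff)
    also have "\<dots> \<in> sets borel" by measurable
    finally show "(vec_set F :: ('a ^ 'k) set) \<in> sets borel" .
    obtain B where B: "\<And>x. x \<in> F \<Longrightarrow> norm x \<le> B" using F_bounded by (auto simp: bounded_iff)
    have "norm x \<le> real CARD('k) * B" if "x \<in> vec_set F" for x :: "'a ^ 'k"
    proof -
      have "norm x \<le> (\<Sum>i\<in>UNIV. norm (x $ i))" unfolding norm_vec_def by (rule L2_set_le_sum) simp
      also have "\<dots> \<le> (\<Sum>i\<in>(UNIV::'k set). B)" by (intro sum_mono B) (use that in \<open>simp add: vec_set_iff\<close>)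
      finally show ?thesis by simp
    qed
    then show "bounded (vec_set F :: ('a ^ 'k) set)" by (auto simp: bounded_iff)
    fix x :: "'a ^ 'k"
    define l where "l = (\<chi> i. THE k. k \<in> L \<and> x $ i + k \<in> F)"
    have l: "l $ i \<in> L \<and> x $ i + l $ i \<in> F" for i
      unfolding l_def using theI'[OF ex1_translate[of "x $ i"]] by simp
    show "\<exists>!l. l \<in> vec_set L \<and> x + l \<in> vec_set F"
    proof (rule ex1I[of _ l])
      show "l \<in> vec_set L \<and> x + l \<in> vec_set F" using l by (simp add: vec_set_iff)
      fix k assume "k \<in> vec_set L \<and> x + k \<in> vec_set F"
      then show "k = l" using l ex1_translate by (simp add: vec_set_iff vec_eq_iff) metis
    qed
  qed
qed

section \<open>The sup modulus and polydiscs\<close>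

text \<open>The square root of \<open>norm_inf\<close>. Unlike that square it satisfies the triangle
  inequality; the price is that the exponents m and n become 2m and 2n.\<close>

definition sup_cmod :: "complex ^ 'k \<Rightarrow> real" where
  "sup_cmod x = (MAX i. cmod (x $ i))"

lemma sup_cmod_le_iff: "sup_cmod x \<le> r \<longleftrightarrow> (\<forall>i. cmod (x $ i) \<le> r)"
  unfolding sup_cmod_def by (subst Max_le_iff) auto

lemma cmod_le_sup_cmod: "cmod (x $ i) \<le> sup_cmod x"
  using sup_cmod_le_iff by blast

lemma sup_cmod_nonneg: "0 \<le> sup_cmod x"
  using cmod_le_sup_cmod[of x undefined] norm_ge_zero order_trans by blast

lemma sup_cmod_attained: obtains i where "sup_cmod x = cmod (x $ i)"
proof -
  have "sup_cmod x \<in> range (\<lambda>i. cmod (x $ i))" unfolding sup_cmod_def by (intro Max_in) auto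
  then show ?thesis using that by blast
qed

lemma sup_cmod_triangle: "sup_cmod (x + y) \<le> sup_cmod x + sup_cmod y"
  unfolding sup_cmod_le_iff vector_add_component
  by (intro allI norm_triangle_le add_mono cmod_le_sup_cmod)

lemma sup_cmod_uminus [simp]: "sup_cmod (- x) = sup_cmod x"
  by (simp add: sup_cmod_def)

lemma sup_cmod_0 [simp]: "sup_cmod 0 = 0"
  by (simp add: sup_cmod_def)

lemma sup_cmod_mult:
  fixes x y :: "complex ^ 'k"
  assumes "\<And>i. x $ i = c * y $ i" shows "sup_cmod x = cmod c * sup_cmod y"
proof -
  obtain i where i: "sup_cmod x = cmod (x $ i)" by (rule sup_cmod_attained)
  obtain j where j: "sup_cmod y = cmod (y $ j)" by (rule sup_cmod_attained)
  have "sup_cmod x \<le> cmod c * sup_cmod y"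
    unfolding i assms norm_mult by (intro mult_left_mono cmod_le_sup_cmod) simp
  moreover have "cmod c * sup_cmod y \<le> sup_cmod x"
    using cmod_le_sup_cmod[of x j] unfolding j assms norm_mult .
  ultimately show ?thesis by simp
qed

lemma sup_cmod_scaleR: "sup_cmod (c *\<^sub>R x) = \<bar>c\<bar> * sup_cmod x"
proof -
  have "sup_cmod (c *\<^sub>R x) = cmod (of_real c) * sup_cmod x"
    by (rule sup_cmod_mult) (simp only: vector_scaleR_component, simp add: scaleR_conv_of_real)
  then show ?thesis by simp
qed

lemma sup_cmod_eq_0_iff: "sup_cmod x = 0 \<longleftrightarrow> x = 0"
proof
  assume "sup_cmod x = 0"
  then show "x = 0" using sup_cmod_le_iff[of x 0] by (simp add: vec_eq_iff)
qed simp

lemma borel_measurable_sup_cmod [measurable]: "sup_cmod \<in> borel_measurable borel"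
proof (subst borel_measurable_iff_le, rule allI)
  fix a
  have "{w \<in> space borel. sup_cmod w \<le> a} = (\<Inter>i. {w. cmod (w $ i) \<le> a})"
    by (auto simp: sup_cmod_le_iff)
  also have "closed \<dots>"
    by (intro closed_INT ballI closed_Collect_le continuous_intros)
  finally show "{w \<in> space borel. sup_cmod w \<le> a} \<in> sets borel" by (rule borel_closed)
qed

lemma norm_inf_eq: "norm_inf x = (sup_cmod x)\<^sup>2"
proof -
  obtain i where i: "sup_cmod x = cmod (x $ i)" by (rule sup_cmod_attained)
  show ?thesis unfolding norm_inf_def
  proof (rule Max_eqI)
    show "y \<le> (sup_cmod x)\<^sup>2" if "y \<in> range (\<lambda>i. (cmod (x $ i))\<^sup>2)" for y
      using that by (auto intro!: power_mono cmod_le_sup_cmod)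
    show "(sup_cmod x)\<^sup>2 \<in> range (\<lambda>i. (cmod (x $ i))\<^sup>2)" using i by auto
  qed simp
qed

lemma norm_inf_power: "norm_inf x ^ k = sup_cmod x ^ (2 * k)"
  by (simp add: norm_inf_eq flip: power_mult)

definition polydisc :: "real \<Rightarrow> (complex ^ 'k) set" where
  "polydisc r = {x. sup_cmod x \<le> r}"

lemma polydisc_borel [measurable]: "polydisc r \<in> sets borel"
  unfolding polydisc_def by measurable

lemma bounded_sup_cmod_le: "bounded {x :: complex ^ 'k. sup_cmod x \<le> r}"
proof -
  have "norm x \<le> real CARD('k) * r" if "sup_cmod x \<le> r" for x :: "complex ^ 'k"
  proof -
    have "norm x \<le> (\<Sum>i\<in>UNIV. norm (x $ i))" unfolding norm_vec_def by (rule L2_set_le_sum) simp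
    also have "\<dots> \<le> (\<Sum>i\<in>(UNIV::'k set). r)" using that by (intro sum_mono) (simp add: sup_cmod_le_iff)
    finally show ?thesis by simp
  qed
  then show ?thesis by (auto simp: bounded_iff)
qed

text \<open>The known value is the k-th power of pi. It stays symbolic because the count and the
  volume of the region contain the same constants, which cancel in the quotient.\<close>

definition polydisc_vol :: "'k::finite itself \<Rightarrow> real" where
  "polydisc_vol _ = measure lborel (polydisc 1 :: (complex ^ 'k) set)"

lemma dim_complex_vec: "DIM(complex ^ 'k) = 2 * CARD('k)"
  by (simp add: DIM_cart)

lemma emeasure_sup_cmod_scale:
  assumes "r > 0" and [measurable]: "A \<in> sets borel"
  shows "emeasure lborel {x :: complex ^ 'k. (1 / r) *\<^sub>R x \<in> A}
    = ennreal (r ^ (2 * CARD('k))) * emeasure lborel A"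
proof -
  have "(\<lambda>x. indicator A ((1 / r) *\<^sub>R x)) = (indicator {x. (1 / r) *\<^sub>R x \<in> A} :: complex ^ 'k \<Rightarrow> ennreal)"
    by (auto simp: indicator_def)
  moreover have "{x :: complex ^ 'k. (1 / r) *\<^sub>R x \<in> A} \<in> sets borel" by measurable
  ultimately have "emeasure lborel {x :: complex ^ 'k. (1 / r) *\<^sub>R x \<in> A}
      = (\<integral>\<^sup>+x. indicator A ((1 / r) *\<^sub>R x) \<partial>lborel)"
    by simp
  also have "\<dots> = ennreal (r ^ (2 * CARD('k))) * (\<integral>\<^sup>+x. indicator A x \<partial>lborel)"
    using assms(1) by (subst nn_integral_lborel_scale[of r]) (auto simp: dim_complex_vec mult.commute)
  finally show ?thesis by simp
qed

lemma emeasure_polydisc: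
  assumes "r \<ge> 0"
  shows "emeasure lborel (polydisc r :: (complex ^ 'k) set)
    = ennreal (polydisc_vol TYPE('k) * r ^ (2 * CARD('k)))"
proof (cases "r = 0")
  case True
  have "(polydisc 0 :: (complex ^ 'k) set) = {0}"
    using sup_cmod_eq_0_iff by (fastforce simp: polydisc_def intro: antisym[OF _ sup_cmod_nonneg])
  then show ?thesis using True by (simp add: zero_power)
next
  case False
  then have r: "r > 0" using assms by simp
  have "(polydisc r :: (complex ^ 'k) set) = {x. (1 / r) *\<^sub>R x \<in> polydisc 1}"
    using r by (auto simp: polydisc_def sup_cmod_scaleR field_simps)
  also have "emeasure lborel \<dots> = ennreal (r ^ (2 * CARD('k))) * emeasure lborel (polydisc 1 :: (complex ^ 'k) set)"
    by (rule emeasure_sup_cmod_scale[OF r]) simp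
  also have "emeasure lborel (polydisc 1 :: (complex ^ 'k) set) = ennreal (polydisc_vol TYPE('k))"
    unfolding polydisc_vol_def
    by (rule emeasure_eq_ennreal_measure) (use emeasure_bounded_finite[OF bounded_sup_cmod_le[of 1, where 'k = 'k]] in \<open>auto simp: polydisc_def\<close>)
  finally show ?thesis using r by (simp add: polydisc_vol_def ennreal_mult mult.commute)
qed

lemma polydisc_vol_pos: "polydisc_vol TYPE('k::finite) > 0"
proof -
  have "ball (0::complex ^ 'k) 1 \<subseteq> polydisc 1"
    by (auto simp: polydisc_def sup_cmod_le_iff intro: order_trans[OF Finite_Cartesian_Product.norm_nth_le])
  then have "emeasure lborel (ball (0::complex ^ 'k) 1) \<le> emeasure lborel (polydisc 1 :: (complex ^ 'k) set)"
    by (intro emeasure_mono) auto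
  moreover have "emeasure lborel (ball (0::complex ^ 'k) 1) > 0"
    by (simp add: emeasure_ball)
  ultimately have "ennreal (polydisc_vol TYPE('k)) > 0"
    using emeasure_polydisc[of 1, where 'k = 'k] by (metis less_le_trans mult_1_right power_one zero_le_one)
  then show ?thesis by simp
qed

text \<open>Scaling alone shows that the boundary is null: closed polydiscs of radius r (1 -
  1/(n+1)) lie inside, and their volumes converge to that of the closed polydisc of radius
  r.\<close>

lemma emeasure_open_polydisc:
  assumes "r \<ge> 0"
  shows "emeasure lborel {x :: complex ^ 'k. sup_cmod x < r}
    = ennreal (polydisc_vol TYPE('k) * r ^ (2 * CARD('k)))" (is "?E = _")
proof (rule antisym)
  have "?E \<le> emeasure lborel (polydisc r :: (complex ^ 'k) set)"
    by (intro emeasure_mono) (auto simp: polydisc_def)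
  then show "?E \<le> ennreal (polydisc_vol TYPE('k) * r ^ (2 * CARD('k)))"
    by (simp add: emeasure_polydisc[OF assms])
next
  let ?f = "\<lambda>n. r * (1 - 1 / real (Suc n))"
  have "(\<lambda>n. ennreal (polydisc_vol TYPE('k) * ?f n ^ (2 * CARD('k))))
      \<longlonglongrightarrow> ennreal (polydisc_vol TYPE('k) * (r * (1 - 0)) ^ (2 * CARD('k)))"
    by (intro tendsto_ennrealI tendsto_intros LIMSEQ_Suc lim_1_over_n)
  moreover have "ennreal (polydisc_vol TYPE('k) * ?f n ^ (2 * CARD('k))) \<le> ?E" for n
  proof (cases "r = 0")
    case False
    then have "?f n < r" "0 \<le> ?f n" using assms by (simp_all add: field_simps)
    then have "emeasure lborel (polydisc (?f n) :: (complex ^ 'k) set) \<le> ?E"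
      by (intro emeasure_mono) (auto simp: polydisc_def)
    then show ?thesis unfolding emeasure_polydisc[OF \<open>0 \<le> ?f n\<close>] .
  qed (simp add: zero_power)
  ultimately show "ennreal (polydisc_vol TYPE('k) * r ^ (2 * CARD('k))) \<le> ?E"
    by (intro LIMSEQ_le_const2[of _ _ ?E]) auto
qed

lemma Basis_vec_prod:
  fixes u :: "'a::euclidean_space"
  shows "(\<Prod>b\<in>Basis. (\<chi> i::'k::finite. u) \<bullet> b) = (\<Prod>b\<in>Basis. u \<bullet> b) ^ CARD('k)"
proof -
  have "(\<Prod>b\<in>(Basis :: ('a ^ 'k) set). (\<chi> i. u) \<bullet> b)
      = (\<Prod>b\<in>(\<Union>i::'k. (\<lambda>e. axis i e) ` Basis). (\<chi> i. u) \<bullet> b)"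
    by (rule prod.cong) (auto simp: Basis_vec_def)
  also have "\<dots> = (\<Prod>i\<in>(UNIV :: 'k set). \<Prod>b\<in>(\<lambda>e. axis i e) ` Basis. (\<chi> i. u) \<bullet> b)"
    by (rule prod.UNION_disjoint) (auto simp: axis_eq_axis)
  also have "\<dots> = (\<Prod>i\<in>(UNIV :: 'k set). \<Prod>e\<in>Basis. u \<bullet> e)"
  proof (rule prod.cong)
    fix i :: 'k
    have "inj_on (axis i) (Basis :: 'a set)" by (auto simp: inj_on_def axis_eq_axis)
    then show "(\<Prod>b\<in>axis i ` Basis. (\<chi> i. u) \<bullet> b) = (\<Prod>e\<in>Basis. u \<bullet> e)"
      by (subst prod.reindex) (simp_all add: inner_axis)
  qed simp
  finally show ?thesis by simp
qed

text \<open>The half-open product cell is squeezed between an open and a closed box of equal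
  volume.\<close>

lemma emeasure_vec_set_box:
  fixes F :: "'a::euclidean_space set"
  assumes F: "box 0 u \<subseteq> F" "F \<subseteq> cbox 0 u" "F \<in> sets borel" and u: "\<And>b. b \<in> Basis \<Longrightarrow> u \<bullet> b \<ge> 0"
    and m: "(vec_set F :: ('a ^ 'k) set) \<in> sets borel"
  shows "emeasure lborel (vec_set F :: ('a ^ 'k) set) = ennreal ((\<Prod>b\<in>Basis. u \<bullet> b) ^ CARD('k))"
proof -
  let ?U = "(\<chi> i. u) :: 'a ^ 'k"
  have U: "0 \<bullet> b \<le> ?U \<bullet> b" if "b \<in> Basis" for b
    using that u by (auto simp: Basis_vec_def inner_axis)
  have "box 0 ?U \<subseteq> vec_set F"
    using F(1) by (auto simp: mem_box Basis_vec_def inner_axis vec_set_iff subset_iff)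
  moreover have "vec_set F \<subseteq> cbox 0 ?U"
    using F(2) by (fastforce simp: mem_box Basis_vec_def inner_axis vec_set_iff)
  ultimately have "emeasure lborel (box 0 ?U) \<le> emeasure lborel (vec_set F :: ('a ^ 'k) set)"
    "emeasure lborel (vec_set F :: ('a ^ 'k) set) \<le> emeasure lborel (cbox 0 ?U)"
    using m by (auto intro!: emeasure_mono)
  moreover have "emeasure lborel (box 0 ?U) = ennreal (\<Prod>b\<in>Basis. ?U \<bullet> b)"
    using emeasure_lborel_box[OF U] by simp
  moreover have "emeasure lborel (cbox 0 ?U) = ennreal (\<Prod>b\<in>Basis. ?U \<bullet> b)"
    using emeasure_lborel_cbox[OF U] by simp
  ultimately show ?thesis by (simp add: Basis_vec_prod)
qed

section \<open>Rings of imaginary quadratic integers as planar lattices\<close>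

locale imag_quad =
  fixes D :: nat
  assumes D_pos: "D > 0" and D_squarefree: "squarefree D"
begin

abbreviation \<O> :: "complex set" where "\<O> \<equiv> quad_integers D"

text \<open>The imaginary part of the second basis element of \<O>, hence the covolume of \<O>; 2
  \<eta> is the square root of the absolute discriminant.\<close>

definition \<eta> :: real where "\<eta> = (if D mod 4 = 3 then sqrt (real D) / 2 else sqrt (real D))"

definition \<omega> :: complex where "\<omega> = Complex (if D mod 4 = 3 then 1 / 2 else 0) \<eta>"

lemma \<eta>_pos: "\<eta> > 0"
  using D_pos by (simp add: \<eta>_def)

lemma Im_\<omega> [simp]: "Im \<omega> = \<eta>"
  by (simp add: \<omega>_def)

lemma abs_discriminant: "\<bar>real_of_int (discriminant D)\<bar> = (2 * \<eta>)\<^sup>2"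
  using D_pos by (simp add: discriminant_eq[OF D_pos D_squarefree] \<eta>_def power_mult_distrib power_divide)

lemma quad_integers_eq: "\<O> = {of_int x + of_int y * \<omega> | x y. True}"
proof (intro equalityI subsetI)
  fix z assume "z \<in> \<O>"
  then obtain s t :: int where z: "z = Complex (of_int s / 2) (of_int t / 2 * sqrt (real D))"
    and "4 dvd s\<^sup>2 + int D * t\<^sup>2" using quad_integers_iff[OF D_pos D_squarefree] by blast
  then have st: "if D mod 4 = 3 then even (s - t) else even s \<and> even t"
    using quad_form_dvd_4_iff[OF D_squarefree] by simp
  show "z \<in> {of_int x + of_int y * \<omega> | x y. True}"
  proof (cases "D mod 4 = 3")
    case True
    with st have "even (s - t)" by simp
    then obtain a where a: "s - t = 2 * a" by (elim evenE)
    have "s = 2 * a + t" using a by simp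
    then have "z = of_int a + of_int t * \<omega>"
      using True by (simp add: z \<omega>_def \<eta>_def complex_eq_iff add_divide_distrib)
    then show ?thesis by blast
  next
    case False
    with st have "even s" "even t" by simp_all
    then obtain a b where "s = 2 * a" "t = 2 * b" by (elim evenE)
    then have "z = of_int a + of_int b * \<omega>" using False by (simp add: z \<omega>_def \<eta>_def complex_eq_iff)
    then show ?thesis by blast
  qed
next
  fix z assume "z \<in> {of_int x + of_int y * \<omega> | x y. True}"
  then obtain x y :: int where z: "z = of_int x + of_int y * \<omega>" by blast
  show "z \<in> \<O>"
  proof (cases "D mod 4 = 3")
    case True
    have "z = Complex (of_int (2 * x + y) / 2) (of_int y / 2 * sqrt (real D))"
      using True by (simp add: z \<omega>_def \<eta>_def complex_eq_iff add_divide_distrib)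
    moreover have "4 dvd (2 * x + y)\<^sup>2 + int D * y\<^sup>2"
      using True by (subst quad_form_dvd_4_iff[OF D_squarefree]) simp
    ultimately show ?thesis using quad_integers_iff[OF D_pos D_squarefree] by blast
  next
    case False
    have "z = Complex (of_int (2 * x) / 2) (of_int (2 * y) / 2 * sqrt (real D))"
      using False by (simp add: z \<omega>_def \<eta>_def complex_eq_iff)
    moreover have "4 dvd (2 * x)\<^sup>2 + int D * (2 * y)\<^sup>2"
      using False by (subst quad_form_dvd_4_iff[OF D_squarefree]) simp
    ultimately show ?thesis using quad_integers_iff[OF D_pos D_squarefree] by blast
  qed
qed

lemma carrier_quad_ring: "carrier (quad_ring D) = \<O>"
  and add_quad_ring: "x \<oplus>\<^bsub>quad_ring D\<^esub> y = x + y"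
  and mult_quad_ring: "x \<otimes>\<^bsub>quad_ring D\<^esub> y = x * y"
  and zero_quad_ring: "\<zero>\<^bsub>quad_ring D\<^esub> = 0"
  by (simp_all add: quad_ring_def ring_of_type_algebra_def)

lemma mult_mem: "x \<in> \<O> \<Longrightarrow> y \<in> \<O> \<Longrightarrow> x * y \<in> \<O>"
proof -
  interpret R: cring "quad_ring D" by (rule cring_quad_ring[OF D_pos D_squarefree])
  show "x \<in> \<O> \<Longrightarrow> y \<in> \<O> \<Longrightarrow> x * y \<in> \<O>"
    using R.m_closed[of x y] by (simp add: carrier_quad_ring mult_quad_ring)
qed

lemma of_int_mem: "of_int k \<in> \<O>"
proof -
  have "(of_int k :: complex) = of_int k + of_int 0 * \<omega>" by simp
  then show ?thesis unfolding quad_integers_eq by blast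
qed

lemma zero_mem: "0 \<in> \<O>" and one_mem: "1 \<in> \<O>"
  using of_int_mem[of 0] of_int_mem[of 1] by simp_all

lemma diff_mem:
  assumes "x \<in> \<O>" "y \<in> \<O>" shows "x - y \<in> \<O>"
proof -
  from assms obtain a b c e where "x = of_int a + of_int b * \<omega>" "y = of_int c + of_int e * \<omega>"
    unfolding quad_integers_eq by blast
  then have "x - y = of_int (a - c) + of_int (b - e) * \<omega>" by (simp add: algebra_simps)
  then show ?thesis unfolding quad_integers_eq by blast
qed

lemma uminus_mem: "x \<in> \<O> \<Longrightarrow> - x \<in> \<O>"
  using diff_mem[OF zero_mem] by simp

lemma add_mem: "x \<in> \<O> \<Longrightarrow> y \<in> \<O> \<Longrightarrow> x + y \<in> \<O>"
  using diff_mem[of x "- y"] uminus_mem[of y] by simp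

text \<open>Puts the norm \<open>cnj x * x\<close> into every ideal that contains \<open>x\<close>,
  so that a non-zero ideal contains a positive rational integer.\<close>

lemma cnj_mem:
  assumes "z \<in> \<O>" shows "cnj z \<in> \<O>"
proof -
  obtain s t :: int where "z = Complex (of_int s / 2) (of_int t / 2 * sqrt (real D))"
    "4 dvd s\<^sup>2 + int D * t\<^sup>2" using assms quad_integers_iff[OF D_pos D_squarefree] by blast
  then have "cnj z = Complex (of_int s / 2) (of_int (- t) / 2 * sqrt (real D))"
    "4 dvd s\<^sup>2 + int D * (- t)\<^sup>2" by (simp_all add: complex_eq_iff)
  then show ?thesis using quad_integers_iff[OF D_pos D_squarefree] by blast
qed

lemma countable_quad_integers: "countable \<O>"
proof -
  have "\<O> = (\<lambda>(x, y). of_int x + of_int y * \<omega>) ` (UNIV :: (int \<times> int) set)"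
    unfolding quad_integers_eq by auto
  then show ?thesis by simp
qed

lemma quad_integer_coords:
  assumes "z \<in> \<O>"
  obtains s t :: int where "z = Complex (of_int s / 2) (of_int t / 2 * sqrt (real D))"
    "\<bar>s\<bar> \<le> 2 * cmod z" "\<bar>t\<bar> \<le> 2 * cmod z"
proof -
  obtain s t :: int where z: "z = Complex (of_int s / 2) (of_int t / 2 * sqrt (real D))"
    using assms quad_integers_iff[OF D_pos D_squarefree] by blast
  have "real_of_int \<bar>t\<bar> * 1 \<le> real_of_int \<bar>t\<bar> * sqrt (real D)" using D_pos by (intro mult_left_mono) auto
  also have "\<dots> = 2 * \<bar>Im z\<bar>" by (simp add: z abs_mult)
  also have "\<dots> \<le> 2 * cmod z" using abs_Im_le_cmod[of z] by simp
  finally have "\<bar>t\<bar> \<le> 2 * cmod z" by simp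
  moreover have "\<bar>s\<bar> \<le> 2 * cmod z" using abs_Re_le_cmod[of z] by (simp add: z)
  ultimately show ?thesis using that z by blast
qed

text \<open>Norms of algebraic integers are rational integers. This discreteness yields both
  \<open>cmod_ge_1\<close> and the existence of elements of least modulus.\<close>

lemma norm_square_nat:
  assumes "z \<in> \<O>" obtains k :: nat where "(cmod z)\<^sup>2 = real k"
proof -
  obtain s t :: int where z: "z = Complex (of_int s / 2) (of_int t / 2 * sqrt (real D))"
    and "4 dvd s\<^sup>2 + int D * t\<^sup>2" using assms quad_integers_iff[OF D_pos D_squarefree] by blast
  then obtain w where w: "s\<^sup>2 + int D * t\<^sup>2 = 4 * w" by (elim dvdE)
  have "4 * (cmod z)\<^sup>2 = real_of_int (s\<^sup>2 + int D * t\<^sup>2)"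
    by (simp add: z cmod_power2 power_mult_distrib field_simps)
  also have "\<dots> = 4 * of_int w" unfolding w by simp
  finally have "(cmod z)\<^sup>2 = of_int w" by simp
  moreover from this have "w \<ge> 0" using zero_le_power2[of "cmod z"] by simp
  ultimately show ?thesis using that[of "nat w"] by simp
qed

lemma cmod_ge_1:
  assumes "z \<in> \<O>" "z \<noteq> 0" shows "cmod z \<ge> 1"
proof -
  obtain k where k: "(cmod z)\<^sup>2 = real k" using norm_square_nat[OF assms(1)] .
  have "k \<noteq> 0" using k assms(2) by (metis norm_eq_zero of_nat_0 zero_eq_power2)
  then have "1 \<le> (cmod z)\<^sup>2" unfolding k by simp
  then show ?thesis by (simp add: power2_nonneg_ge_1_iff)
qed

lemma finite_quad_integers_le: "finite {z \<in> \<O>. cmod z \<le> R}"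
proof -
  let ?K = "{- \<lceil>2 * R\<rceil>..\<lceil>2 * R\<rceil>}"
  have "{z \<in> \<O>. cmod z \<le> R}
      \<subseteq> (\<lambda>(s, t). Complex (of_int s / 2) (of_int t / 2 * sqrt (real D))) ` (?K \<times> ?K)"
  proof clarify
    fix z assume z: "z \<in> \<O>" "cmod z \<le> R"
    obtain s t :: int where st: "z = Complex (of_int s / 2) (of_int t / 2 * sqrt (real D))"
      "\<bar>s\<bar> \<le> 2 * cmod z" "\<bar>t\<bar> \<le> 2 * cmod z" using quad_integer_coords[OF z(1)] .
    have "\<bar>k\<bar> \<le> \<lceil>2 * R\<rceil>" if "\<bar>k\<bar> \<le> 2 * cmod z" for k :: int
      using that z(2) by linarith
    from this[OF st(2)] this[OF st(3)] have "s \<in> ?K" "t \<in> ?K" by (auto simp: abs_le_iff)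
    then show "z \<in> (\<lambda>(s, t). Complex (of_int s / 2) (of_int t / 2 * sqrt (real D))) ` (?K \<times> ?K)"
      using st(1) by (intro image_eqI[of _ _ "(s, t)"]) auto
  qed
  then show ?thesis by (rule finite_subset) simp
qed

text \<open>The exponent only has to exceed 2.\<close>

lemma sum_cmod_powr_bounded:
  obtains S where "S > 0" "\<And>A. finite A \<Longrightarrow> A \<subseteq> \<O> - {0} \<Longrightarrow> (\<Sum>a\<in>A. cmod a powr - (9 / 4)) \<le> S"
proof -
  \<comment> \<open>Both coordinates of a are at most 2|a|, so |a|^(-9/4) is bounded by a product of
    two one-dimensional terms of exponent 9/8, each summable over the integers. The maximum with 1
    takes care of a vanishing coordinate.\<close>
  define h :: "int \<Rightarrow> real" where "h k = (max 1 \<bar>of_int k\<bar>) powr - (9 / 8)" for k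
  have "summable (\<lambda>n. real n powr - (9 / 8))"
    by (subst summable_real_powr_iff) simp
  then have "summable (\<lambda>n. real (Suc n) powr - (9 / 8))" by (subst summable_Suc_iff)
  moreover have "h (int (Suc n)) = real (Suc n) powr - (9 / 8)" for n by (simp add: h_def)
  ultimately have "summable (\<lambda>n. h (int (Suc n)))" by simp
  then have sm: "summable (\<lambda>n. h (int n))" by (subst (asm) summable_Suc_iff)
  define G where "G = (\<Sum>n. h (int n))"
  have h_nonneg: "h k \<ge> 0" for k by (simp add: h_def)
  have h_abs: "h k = h (int (nat \<bar>k\<bar>))" for k by (simp add: h_def)
  have part: "sum h U \<le> G" if "finite U" "inj_on (\<lambda>k. nat \<bar>k\<bar>) U" for U
  proof -
    have "sum h U = (\<Sum>n\<in>(\<lambda>k. nat \<bar>k\<bar>) ` U. h (int n))"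
      using that(2) by (subst sum.reindex) (auto intro!: sum.cong simp: h_def)
    also have "\<dots> \<le> G" unfolding G_def by (rule sum_le_suminf[OF sm]) (use that h_nonneg in auto)
    finally show ?thesis .
  qed
  have B: "sum h U \<le> 2 * G" if "finite U" for U
  proof -
    have "sum h U = sum h (U \<inter> {0..}) + sum h (U - {0..})"
      using that by (rule sum.Int_Diff)
    also have "\<dots> \<le> G + G" using that by (intro add_mono part) (auto simp: inj_on_def)
    finally show ?thesis by simp
  qed
  have G0: "G \<ge> 0" using B[of "{}"] by simp
  have main: "(\<Sum>a\<in>A. cmod a powr - (9 / 4)) \<le> 2 powr (9 / 4) * (2 * G)\<^sup>2"
    if A: "finite A" "A \<subseteq> \<O> - {0}" for A
  proof -
    define g where "g st = Complex (of_int (fst st) / 2) (of_int (snd st) / 2 * sqrt (real D))" for st :: "int \<times> int"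
    have "\<exists>st. g st = a \<and> \<bar>real_of_int (fst st)\<bar> \<le> 2 * cmod a \<and> \<bar>real_of_int (snd st)\<bar> \<le> 2 * cmod a" if "a \<in> A" for a
    proof -
      have "a \<in> \<O>" using A(2) that by blast
      then obtain s t :: int where "a = Complex (of_int s / 2) (of_int t / 2 * sqrt (real D))"
        "\<bar>s\<bar> \<le> 2 * cmod a" "\<bar>t\<bar> \<le> 2 * cmod a" by (rule quad_integer_coords)
      then show ?thesis by (intro exI[of _ "(s, t)"]) (simp add: g_def)
    qed
    then obtain c where c: "\<And>a. a \<in> A \<Longrightarrow> g (c a) = a"
      "\<And>a. a \<in> A \<Longrightarrow> \<bar>real_of_int (fst (c a))\<bar> \<le> 2 * cmod a" "\<And>a. a \<in> A \<Longrightarrow> \<bar>real_of_int (snd (c a))\<bar> \<le> 2 * cmod a"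
      by metis
    have inj: "inj_on c A" using c(1) by (rule inj_on_inverseI)
    have bd: "cmod a powr - (9 / 4) \<le> 2 powr (9 / 4) * (h (fst (c a)) * h (snd (c a)))" if "a \<in> A" for a
    proof -
      have a1: "cmod a \<ge> 1" using cmod_ge_1 A that by blast
      have h2: "(2 * cmod a) powr - (9 / 8) \<le> h k" if "\<bar>k\<bar> \<le> 2 * cmod a" for k :: int
        unfolding h_def by (rule powr_mono2') (use that a1 in auto)
      have "cmod a powr - (9 / 4) = 2 powr (9 / 4) * ((2 * cmod a) powr - (9 / 8) * (2 * cmod a) powr - (9 / 8))"
      proof -
        have "(2 * cmod a) powr - (9 / 8) * (2 * cmod a) powr - (9 / 8) = (2 * cmod a) powr - (9 / 4)"
          by (subst powr_add[symmetric]) simp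
        also have "\<dots> = 2 powr - (9 / 4) * cmod a powr - (9 / 4)" by (rule powr_mult)
        finally show ?thesis by (simp add: powr_minus)
      qed
      also have "\<dots> \<le> 2 powr (9 / 4) * (h (fst (c a)) * h (snd (c a)))"
        by (intro mult_left_mono mult_mono h2 h_nonneg) (use c(2,3)[OF that] in auto)
      finally show ?thesis .
    qed
    define U where "U = fst ` c ` A"
    define V where "V = snd ` c ` A"
    have "(\<Sum>a\<in>A. cmod a powr - (9 / 4)) \<le> (\<Sum>a\<in>A. 2 powr (9 / 4) * (h (fst (c a)) * h (snd (c a))))"
      by (intro sum_mono bd)
    also have "\<dots> = 2 powr (9 / 4) * (\<Sum>x\<in>c ` A. h (fst x) * h (snd x))"
      by (simp add: sum_distrib_left sum.reindex[OF inj])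
    also have "(\<Sum>x\<in>c ` A. h (fst x) * h (snd x)) \<le> (\<Sum>x\<in>U \<times> V. h (fst x) * h (snd x))"
      by (rule sum_mono2) (use A h_nonneg subset_fst_snd[of "c ` A"] in \<open>simp_all add: U_def V_def\<close>)
    also have "\<dots> = sum h U * sum h V"
      by (simp add: sum_product sum.cartesian_product case_prod_beta)
    also have "\<dots> \<le> (2 * G)\<^sup>2" unfolding power2_eq_square
      by (intro mult_mono B sum_nonneg h_nonneg) (use A G0 in \<open>auto simp: U_def V_def\<close>)
    finally show ?thesis by simp
  qed
  show ?thesis
  proof (rule that[of "2 powr (9 / 4) * (2 * G)\<^sup>2 + 1"])
    show "2 powr (9 / 4) * (2 * G)\<^sup>2 + 1 > 0" by (simp add: add_nonneg_pos)
    fix A assume "finite A" "A \<subseteq> \<O> - {0}"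
    then show "(\<Sum>a\<in>A. cmod a powr - (9 / 4)) \<le> 2 powr (9 / 4) * (2 * G)\<^sup>2 + 1"
      using main[of A] by linarith
  qed
qed

section \<open>The planar lattice of multiples of N and its cell\<close>

definition multiples :: "nat \<Rightarrow> complex set" where
  "multiples N = (\<lambda>z. of_nat N * z) ` \<O>"

text \<open>The period parallelogram spanned by N and N \<omega>, sheared into a rectangle of the
  same area. This is possible because the first period is real, and it makes the cell a product of
  intervals.\<close>

definition rect :: "nat \<Rightarrow> complex set" where
  "rect N = {z. 0 \<le> Re z \<and> Re z < N \<and> 0 \<le> Im z \<and> Im z < N * \<eta>}"

lemma multiples_subset: "multiples N \<subseteq> \<O>"
  using mult_mem[OF of_int_mem[of "int N"]] by (auto simp: multiples_def)

lemma multiples_mult: "x \<in> multiples N \<Longrightarrow> y \<in> \<O> \<Longrightarrow> x * y \<in> multiples N"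
  by (auto simp: multiples_def mult.assoc intro!: imageI mult_mem)

lemma multiples_diff: "x \<in> multiples N \<Longrightarrow> y \<in> multiples N \<Longrightarrow> x - y \<in> multiples N"
  by (auto simp: multiples_def right_diff_distrib[symmetric] intro!: imageI diff_mem)

lemma rect_box: "box 0 (Complex N (N * \<eta>)) \<subseteq> rect N" "rect N \<subseteq> cbox 0 (Complex N (N * \<eta>))"
  by (auto simp: rect_def mem_box Basis_complex_def)

lemma rect_borel [measurable]: "rect N \<in> sets borel"
  unfolding rect_def by measurable

lemma int_in_unit_interval:
  fixes r c :: real
  assumes "c > 0" shows "\<exists>!k::int. 0 \<le> r + c * k \<and> r + c * k < c"
proof (rule ex1I[of _ "- \<lfloor>r / c\<rfloor>"])
  have "of_int \<lfloor>r / c\<rfloor> * c \<le> r"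
    using of_int_floor_le[of "r / c"] unfolding pos_le_divide_eq[OF assms] .
  moreover have "r < (of_int \<lfloor>r / c\<rfloor> + 1) * c"
    using floor_correct[of "r / c"] unfolding pos_divide_less_eq[OF assms] by simp
  ultimately show "0 \<le> r + c * of_int (- \<lfloor>r / c\<rfloor>) \<and> r + c * of_int (- \<lfloor>r / c\<rfloor>) < c"
    by (simp add: algebra_simps)
  fix k :: int assume "0 \<le> r + c * k \<and> r + c * k < c"
  then have "of_int (- k) \<le> r / c" "r / c < of_int (- k) + 1"
    unfolding pos_le_divide_eq[OF assms] pos_divide_less_eq[OF assms] by (simp_all add: algebra_simps)
  then have "\<lfloor>r / c\<rfloor> = - k" by (simp add: floor_unique)
  then show "k = - \<lfloor>r / c\<rfloor>" by simp
qed

lemma int_in_unit_interval_unique: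
  fixes r c :: real and k l :: int
  assumes "c > 0" "0 \<le> r + c * k" "r + c * k < c" "0 \<le> r + c * l" "r + c * l < c"
  shows "k = l"
proof -
  have "c * real_of_int k < c * real_of_int (l + 1)" "c * real_of_int l < c * real_of_int (k + 1)"
    using assms by (simp_all add: distrib_left)
  then have "k < l + 1" "l < k + 1" using assms(1) by (simp_all only: mult_less_cancel_left_pos of_int_less_iff)
  then show ?thesis by simp
qed

lemma tiling_multiples:
  assumes "N > 0" shows "tiling (multiples N) (rect N)"
proof
  show "countable (multiples N)" unfolding multiples_def using countable_quad_integers by simp
  show "x - y \<in> multiples N" if "x \<in> multiples N" "y \<in> multiples N" for x y
    using that by (rule multiples_diff)
  show "bounded (rect N)" using rect_box(2) bounded_cbox bounded_subset by blast
  fix z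
  have N\<eta>: "real N * \<eta> > 0" using assms \<eta>_pos by simp
  have mem: "l \<in> multiples N \<longleftrightarrow> (\<exists>x y. l = of_nat N * (of_int x + of_int y * \<omega>))" for l
    by (auto simp: multiples_def quad_integers_eq)
  have rect: "z + of_nat N * (of_int x + of_int y * \<omega>) \<in> rect N \<longleftrightarrow>
    0 \<le> (Re z + N * y * Re \<omega>) + real N * x \<and> (Re z + N * y * Re \<omega>) + real N * x < N \<and>
    0 \<le> Im z + N * \<eta> * y \<and> Im z + N * \<eta> * y < N * \<eta>" for x y :: int
    by (auto simp: rect_def algebra_simps)
  \<comment> \<open>The imaginary part determines \<open>y\<close>; once \<open>y\<close> is fixed,
    the real part, offset by the shear term with Re \<omega>, determines \<open>x\<close>.\<close>
  obtain y :: int where y: "0 \<le> Im z + N * \<eta> * y" "Im z + N * \<eta> * y < N * \<eta>"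
    using ex1_implies_ex[OF int_in_unit_interval[OF N\<eta>]] by blast
  obtain x :: int where x: "0 \<le> (Re z + N * y * Re \<omega>) + real N * x"
      "(Re z + N * y * Re \<omega>) + real N * x < N"
    using ex1_implies_ex[OF int_in_unit_interval[of N]] assms by (auto simp del: of_nat_0_less_iff)
  show "\<exists>!l. l \<in> multiples N \<and> z + l \<in> rect N"
  proof (rule ex1I)
    show "of_nat N * (of_int x + of_int y * \<omega>) \<in> multiples N \<and>
        z + of_nat N * (of_int x + of_int y * \<omega>) \<in> rect N"
      unfolding rect using x y by (simp add: mem) blast
    fix l assume l: "l \<in> multiples N \<and> z + l \<in> rect N"
    then obtain x' y' :: int where l': "l = of_nat N * (of_int x' + of_int y' * \<omega>)"
      unfolding mem by blast
    have "y' = y"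
      using int_in_unit_interval_unique[OF N\<eta>, of "Im z" y' y] l y unfolding l' rect by blast
    moreover have "x' = x"
      using int_in_unit_interval_unique[of N "Re z + N * y * Re \<omega>" x' x] l x assms
      unfolding l' rect calculation by (simp del: of_nat_0_less_iff add: of_nat_0_less_iff)
    ultimately show "l = of_nat N * (of_int x + of_int y * \<omega>)" by (simp add: l')
  qed
qed simp

lemma multiples_1: "multiples 1 = \<O>"
  by (simp add: multiples_def)

lemma emeasure_vec_set_rect:
  assumes "N > 0"
  shows "emeasure lborel (vec_set (rect N) :: (complex ^ 'k) set) = ennreal ((real N ^ 2 * \<eta>) ^ CARD('k))"
proof -
  interpret tiling "vec_set (multiples N)" "vec_set (rect N) :: (complex ^ 'k) set"
    by (rule tiling_vec_set[OF tiling_multiples[OF assms]])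
  have "emeasure lborel (vec_set (rect N) :: (complex ^ 'k) set)
      = ennreal ((\<Prod>b\<in>Basis. Complex N (N * \<eta>) \<bullet> b) ^ CARD('k))"
    using \<eta>_pos F_borel by (intro emeasure_vec_set_box rect_box rect_borel) (auto simp: Basis_complex_def)
  then show ?thesis by (simp add: Basis_complex_def power2_eq_square mult.assoc)
qed

lemma obtain_min_cmod:
  assumes "z \<in> A" "A \<subseteq> \<O>"
  obtains m where "m \<in> A" "\<And>x. x \<in> A \<Longrightarrow> cmod m \<le> cmod x"
proof -
  have fl: "real (nat \<lfloor>(cmod x)\<^sup>2\<rfloor>) = (cmod x)\<^sup>2" if "x \<in> A" for x
    using norm_square_nat[of x] that assms(2) by (metis floor_of_nat nat_int subsetD)
  obtain m where m: "m \<in> A" "\<And>x. x \<in> A \<Longrightarrow> nat \<lfloor>(cmod m)\<^sup>2\<rfloor> \<le> nat \<lfloor>(cmod x)\<^sup>2\<rfloor>"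
    using ex_has_least_nat[of "\<lambda>x. x \<in> A" z "\<lambda>x. nat \<lfloor>(cmod x)\<^sup>2\<rfloor>"] assms(1) by blast
  have "cmod m \<le> cmod x" if "x \<in> A" for x
  proof -
    have "(cmod m)\<^sup>2 \<le> (cmod x)\<^sup>2"
      using m(2)[OF that] fl[OF m(1)] fl[OF that] by (metis of_nat_le_iff)
    then show ?thesis by simp
  qed
  then show ?thesis using that m(1) by blast
qed

end

section \<open>Packing and covering bounds by the covolume\<close>

context tiling
begin

text \<open>Each coset of \<open>L\<close> meets \<open>A\<close> at most once, so the periodized
  indicator is at most 1; unfolding then compares \<open>A\<close> with one cell.\<close>

lemma Blichfeldt:
  assumes [measurable]: "A \<in> sets borel" and A: "\<And>x y. x \<in> A \<Longrightarrow> y \<in> A \<Longrightarrow> x - y \<in> L \<Longrightarrow> x = y"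
  shows "emeasure lborel A \<le> ennreal vol"
proof -
  have "periodization L (indicator A) y \<le> 1" for y
  proof (cases "\<exists>l\<in>L. y + l \<in> A")
    case True
    then obtain l where l: "l \<in> L" "y + l \<in> A" by blast
    have "periodization L (indicator A) y \<le> (\<integral>\<^sup>+k. indicator {l} k \<partial>count_space L)"
      unfolding periodization_def
    proof (rule nn_integral_mono)
      fix k assume "k \<in> space (count_space L)"
      then have "y + k - (y + l) \<in> L" using diff_L[OF _ l(1)] by simp
      then have "k = l" if "y + k \<in> A" using A[OF that l(2)] by simp
      then show "indicator A (y + k) \<le> (indicator {l} k :: ennreal)" by (auto simp: indicator_def)
    qed
    also have "\<dots> = 1" using l(1) by (simp add: one_ennreal_def)
    finally show ?thesis .
  next
    case False
    then have "periodization L (indicator A) y = (\<integral>\<^sup>+k. 0 \<partial>count_space L)"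
      unfolding periodization_def by (intro nn_integral_cong) auto
    then show ?thesis by simp
  qed
  then have "(\<integral>\<^sup>+x\<in>F. periodization L (indicator A) x \<partial>lborel) \<le> (\<integral>\<^sup>+x. indicator F x \<partial>lborel)"
    by (intro nn_integral_mono) (auto simp: indicator_def)
  then show ?thesis using nn_integral_unfold[of "indicator A"] by (simp add: emeasure_F)
qed

text \<open>The opposite estimate: \<open>A\<close> lies in the union of \<open>card U\<close>
  translates of the cell. Together with packing it pins down the number of integers in a
  disc.\<close>

lemma card_ge_of_cover:
  assumes X: "finite U" and cov: "\<And>x. x \<in> A \<Longrightarrow> \<exists>l\<in>U. x + l \<in> F" and [measurable]: "A \<in> sets borel"
  shows "emeasure lborel A \<le> of_nat (card U) * ennreal vol"
proof -
  have "emeasure lborel A \<le> emeasure lborel (\<Union>l\<in>U. {x. x + l \<in> F})"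
    using cov X by (intro emeasure_mono) auto
  also have "\<dots> \<le> (\<Sum>l\<in>U. emeasure lborel {x. x + l \<in> F})"
    using X by (intro emeasure_subadditive_finite) auto
  also have "\<dots> = (\<Sum>l\<in>U. ennreal vol)"
  proof (rule sum.cong[OF refl])
    fix l
    have "emeasure lborel {x. x + l \<in> F} = (\<integral>\<^sup>+x. indicator {x. x + l \<in> F} x \<partial>lborel)" by simp
    also have "\<dots> = (\<integral>\<^sup>+x. indicator F (x + l) \<partial>lborel)"
      by (intro nn_integral_cong) (auto simp: indicator_def)
    also have "\<dots> = ennreal vol" by (simp add: nn_integral_lborel_shift emeasure_F)
    finally show "emeasure lborel {x. x + l \<in> F} = ennreal vol" .
  qed
  finally show ?thesis by simp
qed

end

section \<open>Denominators of least modulus\<close>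

context imag_quad
begin

text \<open>A denominator \<open>b\<close> of \<open>\<alpha> / \<beta>\<close> of least modulus is dual to the fractional ideal
  \<open>\<O> + (\<alpha> / \<beta>) \<O>\<close>: if \<open>w\<close> is a shortest non-zero element of the latter, then multiplication by
  \<open>\<alpha> / \<beta>\<close> maps the points of \<open>\<O>\<close> of modulus below \<open>\<bar>b\<bar> / 2\<close> to \<open>\<bar>w\<bar>\<close>-separated classes modulo \<open>\<O>\<close>,
  so comparing areas bounds \<open>\<bar>b\<bar> \<bar>w\<bar>\<close>. This replaces unique factorisation.\<close>

lemma least_denominator:
  obtains C where "C > 0" "\<And>\<alpha> \<beta>. \<alpha> \<in> \<O> \<Longrightarrow> \<beta> \<in> \<O> \<Longrightarrow> \<alpha> \<noteq> 0 \<Longrightarrow> \<beta> \<noteq> 0 \<Longrightarrow>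
    \<exists>a b. a \<in> \<O> - {0} \<and> b \<in> \<O> - {0} \<and> a * \<beta> = \<alpha> * b \<and>
      (\<forall>x\<in>\<O> - {0}. \<alpha> / \<beta> * x \<in> \<O> \<longrightarrow> cmod b \<le> cmod x) \<and>
      (\<forall>z. \<exists>u\<in>\<O>. \<exists>v\<in>\<O>. cmod (z + u + \<alpha> / \<beta> * v) \<le> C / cmod b)"
proof -
  interpret T: tiling \<O> "rect 1" by (rule tiling_multiples[of 1, unfolded multiples_1]) simp
  obtain d where d: "d > 0" "\<And>x. x \<in> rect 1 \<Longrightarrow> cmod x \<le> d"
    using T.F_bounded by (auto simp: bounded_pos)
  define B where "B = unit_ball_vol 2"
  have B: "B > 0" by (simp add: B_def)
  have ball: "emeasure lborel (ball (z::complex) r) = ennreal (B * r\<^sup>2)" if "r \<ge> 0" for z r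
    using emeasure_ball[OF that, of z] by (simp add: B_def)
  \<comment> \<open>The summand 2d alone settles the case that the disc of radius |b|/2 is too small
    for a comparison of areas; the other one comes from that comparison.\<close>
  define K where "K = 2 * d + 4 * T.vol / B"
  have K: "K > 0" using d B T.vol_pos by (simp add: K_def add_pos_pos)
  show ?thesis
  proof (rule that[of "d * K"])
    show "d * K > 0" using d K by simp
    fix \<alpha> \<beta> assume ab: "\<alpha> \<in> \<O>" "\<beta> \<in> \<O>" "\<alpha> \<noteq> 0" "\<beta> \<noteq> 0"
    define \<mu> where "\<mu> = \<alpha> / \<beta>"
    have \<mu>: "\<mu> \<noteq> 0" "\<mu> * \<beta> = \<alpha>" using ab by (simp_all add: \<mu>_def)
    have "\<beta> \<in> {x \<in> \<O> - {0}. \<mu> * x \<in> \<O>}" using ab \<mu> by simp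
    then obtain b where "b \<in> {x \<in> \<O> - {0}. \<mu> * x \<in> \<O>}"
      and "\<And>x. x \<in> {x \<in> \<O> - {0}. \<mu> * x \<in> \<O>} \<Longrightarrow> cmod b \<le> cmod x"
      by (rule obtain_min_cmod) auto
    then have b: "b \<in> \<O>" "b \<noteq> 0" "\<mu> * b \<in> \<O>"
      and b_min: "\<And>x. x \<in> \<O> \<Longrightarrow> x \<noteq> 0 \<Longrightarrow> \<mu> * x \<in> \<O> \<Longrightarrow> cmod b \<le> cmod x" by auto
    \<comment> \<open>Multiplication by \<beta> carries \<O> + \<mu> \<O> into \<O>, where an
      element of least modulus exists; \<open>w\<close> is that element divided by \<beta>.\<close>
    let ?M = "{z \<in> \<O> - {0}. \<exists>u\<in>\<O>. \<exists>v\<in>\<O>. z = \<beta> * u + \<alpha> * v}"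
    have "\<beta> = \<beta> * 1 + \<alpha> * 0" by simp
    then have "\<beta> \<in> ?M" using ab zero_mem one_mem by blast
    then obtain w0 where "w0 \<in> ?M" and w0_min: "\<And>x. x \<in> ?M \<Longrightarrow> cmod w0 \<le> cmod x"
      by (rule obtain_min_cmod) auto
    then obtain u0 v0 where w0: "w0 \<noteq> 0" "u0 \<in> \<O>" "v0 \<in> \<O>" "w0 = \<beta> * u0 + \<alpha> * v0" by blast
    define w where "w = u0 + \<mu> * v0"
    have w0w: "w0 = \<beta> * w" using ab by (simp add: w0(4) w_def \<mu>_def algebra_simps)
    then have w: "w \<noteq> 0" using w0(1) by auto
    have w_min: "cmod w \<le> cmod (u + \<mu> * v)" if "u \<in> \<O>" "v \<in> \<O>" "u + \<mu> * v \<noteq> 0" for u v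
    proof -
      have "\<beta> * (u + \<mu> * v) = \<beta> * u + \<alpha> * v" using ab by (simp add: \<mu>_def algebra_simps)
      moreover have "\<beta> * u + \<alpha> * v \<in> \<O>" using that ab by (intro add_mem mult_mem)
      moreover have "\<beta> * (u + \<mu> * v) \<noteq> 0" using that ab by simp
      ultimately have "\<beta> * (u + \<mu> * v) \<in> ?M" using that by auto
      from w0_min[OF this] show ?thesis using ab by (simp add: w0w norm_mult)
    qed
    have w_le: "cmod w \<le> 1" using w_min[of 1 0] by (simp add: zero_mem one_mem)
    \<comment> \<open>Two points of modulus below |b|/2 differ by less than |b|, so their difference
      cannot be a non-zero denominator of \<mu>.\<close>
    define R where "R = cmod b / 2"
    define U where "U = {x \<in> \<O>. cmod x < R}"
    have "finite U" using finite_quad_integers_le[of R] by (rule finite_subset[rotated]) (auto simp: U_def)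
    have U_inj: "x = y" if "x \<in> U" "y \<in> U" "\<mu> * (x - y) \<in> \<O>" for x y
    proof (rule ccontr)
      assume "x \<noteq> y"
      then have "cmod b \<le> cmod (x - y)" using that by (intro b_min) (auto simp: U_def diff_mem)
      also have "\<dots> < R + R" using that norm_triangle_ineq4[of x y] by (simp add: U_def)
      finally show False by (simp add: R_def)
    qed
    \<comment> \<open>Distinct points of \<open>U\<close> have images under \<mu> at distance at
      least |w| modulo \<O>, so discs of radius |w|/2 about the images stay disjoint even modulo
      \<O>.\<close>
    define S where "S x = ball (- \<mu> * x) (cmod w / 2)" for x
    have S_eq: "x = y \<and> l = 0" if xy: "x \<in> U" "y \<in> U" "l \<in> \<O>" "s \<in> S x" "t \<in> S y" "s - t = l" for x y s t l
    proof -
      have "dist s (- \<mu> * x) < cmod w / 2" "dist t (- \<mu> * y) < cmod w / 2"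
        using xy(4,5) by (simp_all add: S_def dist_commute)
      then have "cmod (s + \<mu> * x) < cmod w / 2" "cmod (t + \<mu> * y) < cmod w / 2"
        by (simp_all add: dist_norm)
      moreover have "(s + \<mu> * x) - (t + \<mu> * y) = l + \<mu> * (x - y)" using xy(6) by (simp add: algebra_simps)
      ultimately have "cmod (l + \<mu> * (x - y)) < cmod w"
        using norm_triangle_ineq4[of "s + \<mu> * x" "t + \<mu> * y"] by simp
      moreover have "x - y \<in> \<O>" using xy by (simp add: U_def diff_mem)
      ultimately have 0: "l + \<mu> * (x - y) = 0" using w_min[OF xy(3)] by fastforce
      then have "\<mu> * (x - y) = - l" by (simp add: add_eq_0_iff)
      then have "\<mu> * (x - y) \<in> \<O>" using uminus_mem[OF xy(3)] by simp
      then have "x = y" using U_inj xy by blast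
      then show ?thesis using 0 by simp
    qed
    have "of_nat (card U) * ennreal (B * (cmod w / 2)\<^sup>2) = (\<Sum>x\<in>U. emeasure lborel (S x))"
      by (simp add: S_def ball)
    also have "\<dots> = emeasure lborel (\<Union>x\<in>U. S x)"
    proof (rule sum_emeasure)
      show "disjoint_family_on S U"
        unfolding disjoint_family_on_def using S_eq[OF _ _ zero_mem] by fastforce
    qed (use \<open>finite U\<close> in \<open>auto simp: S_def\<close>)
    also have "\<dots> \<le> ennreal T.vol"
    proof (rule T.Blichfeldt)
      show "(\<Union>x\<in>U. S x) \<in> sets borel" by (intro borel_open open_UN) (simp add: S_def)
      fix s t assume "s \<in> (\<Union>x\<in>U. S x)" "t \<in> (\<Union>x\<in>U. S x)" "s - t \<in> \<O>"
      then show "s = t" using S_eq by (metis UN_E eq_iff_diff_eq_0)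
    qed
    finally have "ennreal (real (card U) * (B * (cmod w / 2)\<^sup>2)) \<le> ennreal T.vol"
      by (simp add: ennreal_mult' ennreal_of_nat_eq_real_of_nat)
    then have up: "real (card U) * (B * (cmod w / 2)\<^sup>2) \<le> T.vol"
      using T.vol_pos by simp
    have bw: "cmod b * cmod w \<le> K"
    proof (cases "R \<le> d")
      case True
      then have "cmod b * cmod w \<le> (2 * d) * 1" using w_le d by (intro mult_mono) (auto simp: R_def)
      also have "\<dots> \<le> K" using T.vol_pos B by (simp add: K_def)
      finally show ?thesis .
    next
      case False
      have "ennreal (B * (R - d)\<^sup>2) = emeasure lborel (ball (0::complex) (R - d))"
        using False by (simp add: ball)
      also have "\<dots> \<le> of_nat (card U) * ennreal T.vol"
      proof (rule T.card_ge_of_cover[OF \<open>finite U\<close>])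
        fix x :: complex assume x: "x \<in> ball 0 (R - d)"
        obtain l where l: "l \<in> \<O>" "x + l \<in> rect 1" using ex1_implies_ex[OF T.ex1_translate[of x]] by blast
        have "cmod l \<le> cmod (x + l) + cmod x" using norm_triangle_ineq4[of "x + l" x] by simp
        then have "cmod l < R" using d(2)[OF l(2)] x by simp
        then show "\<exists>l\<in>U. x + l \<in> rect 1" using l by (auto simp: U_def)
      qed simp
      also have "\<dots> = ennreal (real (card U) * T.vol)"
        by (simp add: ennreal_mult' ennreal_of_nat_eq_real_of_nat)
      finally have lo: "B * (R - d)\<^sup>2 \<le> real (card U) * T.vol" using T.vol_pos by simp
      \<comment> \<open>The product of the lower and the upper estimate eliminates
        \<open>card U\<close>; taking square roots bounds |b| |w|.\<close>
      have "(B * ((R - d) * (cmod w / 2)))\<^sup>2 = (B * (R - d)\<^sup>2) * (B * (cmod w / 2)\<^sup>2)"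
        by (simp add: power2_eq_square)
      also have "\<dots> \<le> (real (card U) * T.vol) * (B * (cmod w / 2)\<^sup>2)"
        using lo B by (intro mult_right_mono) auto
      also have "\<dots> = T.vol * (real (card U) * (B * (cmod w / 2)\<^sup>2))" by simp
      also have "\<dots> \<le> T.vol * T.vol" using up T.vol_pos by (intro mult_left_mono) auto
      finally have "(B * ((R - d) * (cmod w / 2)))\<^sup>2 \<le> T.vol\<^sup>2" by (simp add: power2_eq_square)
      then have "B * ((R - d) * (cmod w / 2)) \<le> T.vol"
        by (rule power2_le_imp_le) (use T.vol_pos in simp)
      then have "(R - d) * cmod w * B \<le> 2 * T.vol" by (simp add: mult_ac)
      then have "(R - d) * cmod w \<le> 2 * T.vol / B" unfolding pos_le_divide_eq[OF B] .
      then have "cmod b * cmod w \<le> 4 * T.vol / B + 2 * d * cmod w" by (simp add: R_def algebra_simps)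
      also have "2 * d * cmod w \<le> 2 * d * 1" using w_le d by (intro mult_left_mono) auto
      finally show ?thesis by (simp add: K_def)
    qed
    \<comment> \<open>The sublattice w \<O> of \<O> + \<mu> \<O> already suffices: the points of its
      cell have modulus at most d |w|, and |w| is at most K / |b|.\<close>
    have cover: "\<exists>u\<in>\<O>. \<exists>v\<in>\<O>. cmod (z + u + \<mu> * v) \<le> d * K / cmod b" for z
    proof -
      obtain l where l: "l \<in> \<O>" "z / w + l \<in> rect 1" using ex1_implies_ex[OF T.ex1_translate[of "z / w"]] by blast
      have "z + u0 * l + \<mu> * (v0 * l) = w * (z / w + l)" using w by (simp add: w_def field_simps)
      then have "cmod (z + u0 * l + \<mu> * (v0 * l)) = cmod w * cmod (z / w + l)" by (simp add: norm_mult)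
      also have "\<dots> \<le> (K / cmod b) * d"
        using bw d(2)[OF l(2)] b K by (intro mult_mono) (auto simp: field_simps)
      finally show ?thesis using l w0 mult_mem by (intro bexI[of _ "u0 * l"] bexI[of _ "v0 * l"]) (auto simp: mult.commute)
    qed
    show "\<exists>a b. a \<in> \<O> - {0} \<and> b \<in> \<O> - {0} \<and> a * \<beta> = \<alpha> * b \<and>
      (\<forall>x\<in>\<O> - {0}. \<alpha> / \<beta> * x \<in> \<O> \<longrightarrow> cmod b \<le> cmod x) \<and>
      (\<forall>z. \<exists>u\<in>\<O>. \<exists>v\<in>\<O>. cmod (z + u + \<alpha> / \<beta> * v) \<le> d * K / cmod b)"
      unfolding \<mu>_def[symmetric]
      by (rule exI[of _ "\<mu> * b"], rule exI[of _ b]) (use b \<mu> b_min cover in auto)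
  qed
qed

text \<open>Here N is the norm of a non-zero element of \<open>I\<close> and \<open>R\<close>
  collects the residues modulo N that lie in \<open>I\<close>. The cardinality formula counts all
  N^2 residues of \<O> by their cosets of \<open>I\<close>: translation by c matches those in a
  coset with those in \<open>I\<close>, so each coset receives \<open>card R\<close> of
  them.\<close>

lemma ideal_residues:
  assumes "ideal I (quad_ring D)" "I \<noteq> {0}"
  obtains N :: nat and R where "N > 0" "multiples N \<subseteq> I" "I \<subseteq> \<O>"
    "\<And>x y. x \<in> I \<Longrightarrow> y \<in> I \<Longrightarrow> x - y \<in> I" "\<And>x y. x \<in> I \<Longrightarrow> y \<in> I \<Longrightarrow> x + y \<in> I"
    "finite R" "R \<subseteq> I" "card R * ideal_norm D I = N\<^sup>2"
    "\<And>z. z \<in> I \<Longrightarrow> \<exists>!r. r \<in> R \<and> z - r \<in> multiples N"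
proof -
  interpret ideal I "quad_ring D" by fact
  have I_sub: "I \<subseteq> \<O>" using a_subset by (simp add: carrier_quad_ring)
  have I_mult: "c * x \<in> I" if "c \<in> \<O>" "x \<in> I" for c x
    using I_l_closed[of x c] that by (simp add: carrier_quad_ring mult_quad_ring)
  have I_add: "x + y \<in> I" if "x \<in> I" "y \<in> I" for x y
    using additive_subgroup.a_closed[OF additive_subgroup_axioms that] by (simp add: add_quad_ring)
  have I_diff: "x - y \<in> I" if "x \<in> I" "y \<in> I" for x y
    using I_add[OF that(1) I_mult[OF of_int_mem[of "- 1"] that(2)]] by simp
  obtain x where x: "x \<in> I" "x \<noteq> 0"
    using assms(2) additive_subgroup.zero_closed[OF additive_subgroup_axioms] zero_quad_ring by auto
  obtain N where N: "(cmod x)\<^sup>2 = real N" using norm_square_nat x I_sub by blast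
  have "N > 0" using N x(2) by (metis of_nat_0 of_nat_0_less_iff zero_less_norm_iff zero_less_power)
  have "of_nat N = cnj x * x" using N complex_norm_square[of x] by (metis mult.commute of_real_of_nat_eq)
  then have NI: "of_nat N \<in> I" using I_mult[OF cnj_mem x(1)] x(1) I_sub by auto
  have mult_sub: "multiples N \<subseteq> I" using I_mult[OF _ NI] by (auto simp: multiples_def mult.commute)
  define P where "P = (\<lambda>(x, y). of_int x + of_int y * \<omega>) ` ({0..<int N} \<times> {0..<int N})"
  have inj: "inj (\<lambda>(x::int, y::int). of_int x + of_int y * \<omega>)"
    using \<eta>_pos by (auto simp: inj_on_def complex_eq_iff)
  have cardP: "card P = N\<^sup>2"
    unfolding P_def by (subst card_image) (use inj in \<open>auto simp: inj_on_def card_cartesian_product power2_eq_square\<close>)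
  have finP: "finite P" by (simp add: P_def)
  have P_sub: "P \<subseteq> \<O>" by (auto simp: P_def quad_integers_eq)
  have P_res: "\<exists>!p. p \<in> P \<and> z - p \<in> multiples N" if zO: "z \<in> \<O>" for z
  proof -
    obtain x y :: int where z: "z = of_int x + of_int y * \<omega>" using zO unfolding quad_integers_eq by blast
    have mem: "of_int s + of_int t * \<omega> \<in> multiples N \<longleftrightarrow> int N dvd s \<and> int N dvd t" for s t :: int
    proof
      assume "of_int s + of_int t * \<omega> \<in> multiples N"
      then obtain s' t' :: int where "of_int s + of_int t * \<omega> = of_nat N * (of_int s' + of_int t' * \<omega>)"
        unfolding multiples_def quad_integers_eq by blast
      also have "\<dots> = of_int (int N * s') + of_int (int N * t') * \<omega>" by (simp add: algebra_simps)
      finally have "(s, t) = (int N * s', int N * t')" using injD[OF inj, of "(s, t)" "(int N * s', int N * t')"] by simp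
      then show "int N dvd s \<and> int N dvd t" by simp
    next
      assume "int N dvd s \<and> int N dvd t"
      then obtain s' t' where "s = int N * s'" "t = int N * t'" by (auto elim!: dvdE)
      then have "of_int s + of_int t * \<omega> = of_nat N * (of_int s' + of_int t' * \<omega>)" by (simp add: algebra_simps)
      then show "of_int s + of_int t * \<omega> \<in> multiples N" unfolding multiples_def quad_integers_eq by blast
    qed
    have diff: "z - (of_int s + of_int t * \<omega>) = of_int (x - s) + of_int (y - t) * \<omega>" for s t :: int
      by (simp add: z algebra_simps)
    show ?thesis
    proof (rule ex1I)
      show "of_int (x mod int N) + of_int (y mod int N) * \<omega> \<in> P \<and>
          z - (of_int (x mod int N) + of_int (y mod int N) * \<omega>) \<in> multiples N"
        unfolding diff mem using \<open>N > 0\<close> by (auto simp: P_def minus_mod_eq_mult_div)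
      fix p assume p: "p \<in> P \<and> z - p \<in> multiples N"
      then obtain s t where st: "0 \<le> s" "s < int N" "0 \<le> t" "t < int N" "p = of_int s + of_int t * \<omega>"
        by (auto simp: P_def)
      then have "int N dvd x - s" "int N dvd y - t" using p unfolding st diff mem by simp_all
      then have "x mod int N = s mod int N" "y mod int N = t mod int N" by (simp_all add: mod_eq_dvd_iff)
      then show "p = of_int (x mod int N) + of_int (y mod int N) * \<omega>" using st by simp
    qed
  qed
  define res where "res z = (THE p. p \<in> P \<and> z - p \<in> multiples N)" for z
  have res: "res z \<in> P" "z - res z \<in> multiples N" if "z \<in> \<O>" for z
    unfolding res_def using theI'[OF P_res[OF that]] by simp_all
  have res_eq: "res z = p" if "z \<in> \<O>" "p \<in> P" "z - p \<in> multiples N" for z p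
    unfolding res_def using the1_equality[OF P_res[OF that(1)]] that by simp
  define R where "R = I \<inter> P"
  have fiber: "card {p \<in> P. p - c \<in> I} = card R" if c: "c \<in> \<O>" for c
  proof (rule bij_betw_same_card[OF bij_betw_byWitness[of _ "\<lambda>r. res (r + c)" "\<lambda>p. res (p - c)"]])
    have r_in: "res (p - c) \<in> R" and r_back: "res (res (p - c) + c) = p" if p: "p \<in> {p \<in> P. p - c \<in> I}" for p
    proof -
      have pc: "p - c \<in> \<O>" using p c P_sub diff_mem by blast
      note r = res[OF pc]
      have "p - c - (p - c - res (p - c)) \<in> I" by (rule I_diff) (use p r mult_sub in blast)+
      then show "res (p - c) \<in> R" using r by (simp add: R_def)
      \<comment> \<open>Closure under negation as 0 - x, where the product with 0 exhibits 0 as an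
        element of \<open>multiples N\<close>.\<close>
      have "- (p - c - res (p - c)) \<in> multiples N"
        using multiples_diff[OF _ r(2), of "0 * (p - c - res (p - c))"] multiples_mult[OF r(2) zero_mem] by simp
      then have "res (p - c) + c - p \<in> multiples N" by (simp add: algebra_simps)
      then show "res (res (p - c) + c) = p" using p r P_sub c by (intro res_eq add_mem) auto
    qed
    have s_in: "res (r + c) \<in> {p \<in> P. p - c \<in> I}" and s_back: "res (res (r + c) - c) = r" if rr: "r \<in> R" for r
    proof -
      have rc: "r + c \<in> \<O>" using rr c P_sub add_mem by (auto simp: R_def)
      note r = res[OF rc]
      have "r - (r + c - res (r + c)) \<in> I" by (rule I_diff) (use rr r mult_sub in \<open>unfold R_def, blast\<close>)+
      then show "res (r + c) \<in> {p \<in> P. p - c \<in> I}" using r by simp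
      have "- (r + c - res (r + c)) \<in> multiples N"
        using multiples_diff[OF _ r(2), of "0 * (r + c - res (r + c))"] multiples_mult[OF r(2) zero_mem] by simp
      then have "res (r + c) - c - r \<in> multiples N" by (simp add: algebra_simps)
      then show "res (res (r + c) - c) = r" using rr r P_sub c by (intro res_eq diff_mem) (auto simp: R_def)
    qed
    show "\<forall>p\<in>{p \<in> P. p - c \<in> I}. res (res (p - c) + c) = p" using r_back by blast
    show "\<forall>r\<in>R. res (res (r + c) - c) = r" using s_back by blast
    show "(\<lambda>p. res (p - c)) ` {p \<in> P. p - c \<in> I} \<subseteq> R" using r_in by blast
    show "(\<lambda>r. res (r + c)) ` R \<subseteq> {p \<in> P. p - c \<in> I}" using s_in by blast
  qed
  define Q where "Q c = I +>\<^bsub>quad_ring D\<^esub> c" for c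
  have Q: "Q c = {z. z - c \<in> I}" for c
  proof -
    have "Q c = (\<lambda>h. h + c) ` I"
      by (auto simp: Q_def a_r_coset_def' add_quad_ring)
    also have "\<dots> = {z. z - c \<in> I}" by (auto intro!: image_eqI[of _ _ "_ - c"])
    finally show ?thesis .
  qed
  have Q_eq: "Q p = Q c \<longleftrightarrow> p - c \<in> I" for p c
  proof
    assume "Q p = Q c"
    moreover have "p \<in> Q p" using I_diff[OF x(1) x(1)] by (simp add: Q)
    ultimately show "p - c \<in> I" by (simp add: Q)
  next
    assume pc: "p - c \<in> I"
    show "Q p = Q c" unfolding Q
    proof (intro Collect_cong iffI)
      show "z - c \<in> I" if "z - p \<in> I" for z using I_add[OF that pc] by simp
      show "z - p \<in> I" if "z - c \<in> I" for z using I_diff[OF that pc] by simp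
    qed
  qed
  have car: "carrier (quad_ring D Quot I) = Q ` \<O>"
    by (auto simp: FactRing_def A_RCOSETS_def' Q_def carrier_quad_ring)
  have "Q ` \<O> = Q ` P"
  proof -
    have "Q z \<in> Q ` P" if "z \<in> \<O>" for z
      using res[OF that] mult_sub Q_eq by (metis image_eqI subsetD)
    then show ?thesis using P_sub by blast
  qed
  then have "card P = (\<Sum>C\<in>Q ` \<O>. \<Sum>p\<in>{p \<in> P. Q p = C}. 1)"
    using sum.group[of P "Q ` \<O>" Q "\<lambda>_. 1::nat"] finP by simp
  also have "\<dots> = (\<Sum>C\<in>Q ` \<O>. card R)"
  proof (rule sum.cong[OF refl])
    fix C assume "C \<in> Q ` \<O>"
    then obtain c where "c \<in> \<O>" "C = Q c" by blast
    then show "(\<Sum>p\<in>{p \<in> P. Q p = C}. 1) = card R" using fiber[of c] by (simp add: Q_eq)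
  qed
  finally have cardR: "card R * ideal_norm D I = N\<^sup>2"
    by (simp add: ideal_norm_def car cardP)
  have R_res: "\<exists>!r. r \<in> R \<and> z - r \<in> multiples N" if z: "z \<in> I" for z
  proof (rule ex1I[of _ "res z"])
    have zO: "z \<in> \<O>" using z I_sub by blast
    have "z - (z - res z) \<in> I" by (rule I_diff) (use z res[OF zO] mult_sub in blast)+
    then show "res z \<in> R \<and> z - res z \<in> multiples N" using res[OF zO] by (simp add: R_def)
    fix r assume "r \<in> R \<and> z - r \<in> multiples N"
    then show "r = res z" using res_eq[OF zO, of r] by (simp add: R_def)
  qed
  have fR: "finite R" "R \<subseteq> I" using finP by (auto simp: R_def)
  show ?thesis
    by (rule that[of N R]) (fact \<open>N > 0\<close> mult_sub I_sub I_diff I_add fR cardR R_res)+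
qed

end

section \<open>Correlations of periodic functions of linear forms\<close>

lemma measurable_matrix_vector_mult [measurable]:
  "(\<lambda>\<theta>::complex ^ 'n ^ 'm. \<theta> *v q) \<in> borel_measurable borel"
  unfolding matrix_vector_mult_def
  by (intro borel_measurable_continuous_onI continuous_on_vec_lambda continuous_intros)

text \<open>Adding such a matrix to \<theta> moves \<theta>q by \<open>z\<close> whenever e has
  product sum 1 with q, and leaves forms alone whose vectors have product sum 0 with e. These are
  the translations by which correlations are computed.\<close>

lemma rank_one_mult_vec:
  fixes e q :: "complex ^ 'n" and z :: "complex ^ 'm"
  shows "(\<chi> i j. z $ i * e $ j) *v q = (\<chi> i. z $ i * (\<Sum>j\<in>UNIV. e $ j * q $ j))"
  by (simp add: vec_eq_iff matrix_vector_mult_def sum_distrib_left mult.assoc)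

locale congruence_lattice = imag_quad +
  fixes N :: nat
  assumes N_pos: "N > 0"
begin

text \<open>The covolume of N \<O> in the complex plane.\<close>

definition \<kappa> :: real where "\<kappa> = (real N)\<^sup>2 * \<eta>"

lemma \<kappa>_pos: "\<kappa> > 0"
  using N_pos \<eta>_pos by (simp add: \<kappa>_def)

abbreviation lat :: "(complex ^ 'k) set" where "lat \<equiv> vec_set (multiples N)"
abbreviation cell :: "(complex ^ 'k) set" where "cell \<equiv> vec_set (rect N)"
abbreviation mat_lat :: "(complex ^ 'n ^ 'm) set" where "mat_lat \<equiv> vec_set (vec_set (multiples N))"
abbreviation mat_cell :: "(complex ^ 'n ^ 'm) set" where "mat_cell \<equiv> vec_set (vec_set (rect N))"

lemma tiling_vec: "tiling lat (cell :: (complex ^ 'k) set)"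
  by (intro tiling_vec_set tiling_multiples N_pos)

lemma tiling_mat: "tiling mat_lat (mat_cell :: (complex ^ 'n ^ 'm) set)"
  by (intro tiling_vec_set tiling_multiples N_pos)

lemma emeasure_cell: "emeasure lborel (cell :: (complex ^ 'k) set) = ennreal (\<kappa> ^ CARD('k))"
  unfolding \<kappa>_def by (rule emeasure_vec_set_rect[OF N_pos])

lemma mat_mult_lat:
  assumes "l \<in> (mat_lat :: (complex ^ 'n ^ 'm) set)" "q \<in> vec_set \<O>"
  shows "l *v q \<in> lat"
proof -
  have "(\<Sum>j\<in>A. l $ i $ j * q $ j) \<in> multiples N" for i and A :: "'n set"
  proof (induction A rule: infinite_finite_induct)
    case (insert j A)
    have "l $ i $ j * q $ j \<in> multiples N"
      using assms by (intro multiples_mult) (simp_all add: vec_set_iff)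
    moreover have "0 - (\<Sum>j\<in>A. l $ i $ j * q $ j) \<in> multiples N"
      using multiples_diff[OF multiples_diff[OF insert.IH insert.IH] insert.IH] by simp
    ultimately show ?case using insert multiples_diff[of "l $ i $ j * q $ j"] by fastforce
  qed (auto simp: multiples_def zero_mem intro!: image_eqI[of _ _ 0])
  then show ?thesis by (simp add: vec_set_iff matrix_vector_mult_def)
qed

text \<open>The shift \<open>x\<close> is an auxiliary variable. Averaging over it is easy for every
  \<open>g\<close>; invariance in \<open>x\<close>, exact or up to a larger radius, then recovers
  the value at the shift that is wanted.\<close>

definition corr :: "complex ^ 'n \<Rightarrow> (complex ^ 'n ^ 'm \<Rightarrow> ennreal) \<Rightarrow> (complex ^ 'm \<Rightarrow> ennreal) \<Rightarrow> complex ^ 'm \<Rightarrow> ennreal" where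
  "corr q g f x = (\<integral>\<^sup>+\<theta>\<in>mat_cell. periodization lat f (x + \<theta> *v q) * g \<theta> \<partial>lborel)"

text \<open>After exchanging the integrals, the average over the shift for fixed \<theta> is the
  integral of \<open>f\<close>, whatever \<theta> is, so the two factors separate.\<close>

lemma nn_integral_corr:
  fixes f :: "complex ^ 'm \<Rightarrow> ennreal" and g :: "complex ^ 'n ^ 'm \<Rightarrow> ennreal"
  assumes [measurable]: "f \<in> borel_measurable borel" "g \<in> borel_measurable borel"
  shows "(\<integral>\<^sup>+x\<in>cell. corr q g f x \<partial>lborel) = (\<integral>\<^sup>+x. f x \<partial>lborel) * (\<integral>\<^sup>+\<theta>\<in>mat_cell. g \<theta> \<partial>lborel)"
proof -
  interpret V: tiling lat "cell :: (complex ^ 'm) set" by (rule tiling_vec)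
  interpret W: tiling mat_lat "mat_cell :: (complex ^ 'n ^ 'm) set" by (rule tiling_mat)
  have "(\<integral>\<^sup>+x\<in>cell. corr q g f x \<partial>lborel)
      = (\<integral>\<^sup>+x. \<integral>\<^sup>+\<theta>. periodization lat f (x + \<theta> *v q) * g \<theta> * indicator mat_cell \<theta> * indicator cell x \<partial>lborel \<partial>lborel)"
    unfolding corr_def by (intro nn_integral_cong nn_integral_multc[symmetric]) measurable
  also have "\<dots> = (\<integral>\<^sup>+\<theta>. \<integral>\<^sup>+x. periodization lat f (x + \<theta> *v q) * g \<theta> * indicator mat_cell \<theta> * indicator cell x \<partial>lborel \<partial>lborel)"
    by (rule lborel_pair.Fubini') measurable
  also have "\<dots> = (\<integral>\<^sup>+\<theta>. (\<integral>\<^sup>+x. f x \<partial>lborel) * (g \<theta> * indicator mat_cell \<theta>) \<partial>lborel)"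
  proof (rule nn_integral_cong)
    fix \<theta> :: "complex ^ 'n ^ 'm"
    have "(\<integral>\<^sup>+x. periodization lat f (x + \<theta> *v q) * g \<theta> * indicator mat_cell \<theta> * indicator cell x \<partial>lborel)
      = (\<integral>\<^sup>+x. periodization lat f (x + \<theta> *v q) * indicator cell x * (g \<theta> * indicator mat_cell \<theta>) \<partial>lborel)"
      by (intro nn_integral_cong) (simp add: mult_ac)
    also have "\<dots> = (\<integral>\<^sup>+x\<in>cell. periodization lat f (x + \<theta> *v q) \<partial>lborel) * (g \<theta> * indicator mat_cell \<theta>)"
      by (rule nn_integral_multc) measurable
    finally show "(\<integral>\<^sup>+x. periodization lat f (x + \<theta> *v q) * g \<theta> * indicator mat_cell \<theta> * indicator cell x \<partial>lborel)
      = (\<integral>\<^sup>+x. f x \<partial>lborel) * (g \<theta> * indicator mat_cell \<theta>)"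
      by (simp add: V.nn_integral_periodization_shift)
  qed
  also have "\<dots> = (\<integral>\<^sup>+x. f x \<partial>lborel) * (\<integral>\<^sup>+\<theta>\<in>mat_cell. g \<theta> \<partial>lborel)"
    by (rule nn_integral_cmult) measurable
  finally show ?thesis .
qed

text \<open>Integrate the hypothesis over \<open>y\<close> in the cell: the left side is constant
  and the right side is the average just computed.\<close>

lemma corr_le:
  fixes f f' :: "complex ^ 'm \<Rightarrow> ennreal" and g :: "complex ^ 'n ^ 'm \<Rightarrow> ennreal"
  assumes [measurable]: "f' \<in> borel_measurable borel" "g \<in> borel_measurable borel"
    and le: "\<And>y. corr q g f x \<le> corr q g f' y"
  shows "ennreal (\<kappa> ^ CARD('m)) * corr q g f x
    \<le> (\<integral>\<^sup>+x. f' x \<partial>lborel) * (\<integral>\<^sup>+\<theta>\<in>mat_cell. g \<theta> \<partial>lborel)"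
proof -
  have "(\<integral>\<^sup>+y\<in>(cell :: (complex ^ 'm) set). corr q g f x \<partial>lborel) \<le> (\<integral>\<^sup>+y\<in>cell. corr q g f' y \<partial>lborel)"
    by (intro nn_integral_mono mult_right_mono le) simp
  moreover interpret V: tiling lat "cell :: (complex ^ 'm) set" by (rule tiling_vec)
  have "(\<integral>\<^sup>+y\<in>(cell :: (complex ^ 'm) set). corr q g f x \<partial>lborel) = ennreal (\<kappa> ^ CARD('m)) * corr q g f x"
    by (subst nn_integral_cmult_indicator) (simp_all add: emeasure_cell mult.commute)
  ultimately show ?thesis by (simp add: nn_integral_corr)
qed

lemma corr_eq:
  fixes f :: "complex ^ 'm \<Rightarrow> ennreal" and g :: "complex ^ 'n ^ 'm \<Rightarrow> ennreal"
  assumes [measurable]: "f \<in> borel_measurable borel" "g \<in> borel_measurable borel"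
    and eq: "\<And>y. corr q g f y = corr q g f x"
  shows "ennreal (\<kappa> ^ CARD('m)) * corr q g f x
    = (\<integral>\<^sup>+x. f x \<partial>lborel) * (\<integral>\<^sup>+\<theta>\<in>mat_cell. g \<theta> \<partial>lborel)"
proof -
  interpret V: tiling lat "cell :: (complex ^ 'm) set" by (rule tiling_vec)
  have "(\<integral>\<^sup>+y\<in>(cell :: (complex ^ 'm) set). corr q g f y \<partial>lborel)
      = (\<integral>\<^sup>+y\<in>(cell :: (complex ^ 'm) set). corr q g f x \<partial>lborel)"
    by (intro nn_integral_cong arg_cong2[where f = "(*)"] eq refl)
  also have "\<dots> = ennreal (\<kappa> ^ CARD('m)) * corr q g f x"
    by (subst nn_integral_cmult_indicator) (simp_all add: emeasure_cell mult.commute)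
  finally show ?thesis by (simp add: nn_integral_corr)
qed

text \<open>Translation of \<theta> by \<open>c\<close> does not change the integral over the torus,
  is invisible to \<open>g\<close>, and moves the linear form by \<open>c *v q\<close>.\<close>

lemma corr_translate:
  fixes f :: "complex ^ 'm \<Rightarrow> ennreal" and g :: "complex ^ 'n ^ 'm \<Rightarrow> ennreal"
  assumes [measurable]: "f \<in> borel_measurable borel" "g \<in> borel_measurable borel"
    and q: "q \<in> vec_set \<O>" and per: "\<And>\<theta> l. l \<in> mat_lat \<Longrightarrow> g (\<theta> + l) = g \<theta>"
    and inv: "\<And>\<theta>. g (\<theta> + c) = g \<theta>"
  shows "corr q g f (x + c *v q) = corr q g f x"
proof -
  interpret V: tiling lat "cell :: (complex ^ 'm) set" by (rule tiling_vec)
  interpret W: tiling mat_lat "mat_cell :: (complex ^ 'n ^ 'm) set" by (rule tiling_mat)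
  let ?h = "\<lambda>\<theta>. periodization lat f (x + \<theta> *v q) * g \<theta>"
  have "corr q g f (x + c *v q) = (\<integral>\<^sup>+\<theta>\<in>mat_cell. ?h (\<theta> + c) \<partial>lborel)"
    unfolding corr_def by (simp add: inv matrix_vector_mult_add_rdistrib ac_simps)
  also have "\<dots> = corr q g f x" unfolding corr_def
  proof (rule W.nn_integral_F_shift)
    show "?h \<in> borel_measurable borel" by measurable
    fix \<theta> l :: "complex ^ 'n ^ 'm" assume l: "l \<in> mat_lat"
    have "x + (\<theta> + l) *v q = (x + \<theta> *v q) + l *v q"
      by (simp add: matrix_vector_mult_add_rdistrib ac_simps)
    then show "?h (\<theta> + l) = ?h \<theta>"
      by (simp only: per[OF l] V.periodization_periodic[OF mat_mult_lat[OF l q]])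
  qed
  finally show ?thesis .
qed

lemma periodization_linear_form_periodic:
  fixes f :: "complex ^ 'm \<Rightarrow> ennreal"
  assumes "q \<in> vec_set \<O>" "l \<in> (mat_lat :: (complex ^ 'n ^ 'm) set)"
  shows "periodization lat f (x + (\<theta> + l) *v q) = periodization lat f (x + \<theta> *v q)"
proof -
  interpret V: tiling lat "cell :: (complex ^ 'm) set" by (rule tiling_vec)
  have "x + (\<theta> + l) *v q = (x + \<theta> *v q) + l *v q"
    by (simp add: matrix_vector_mult_add_rdistrib ac_simps)
  then show ?thesis by (simp only: V.periodization_periodic[OF mat_mult_lat[OF assms(2,1)]])
qed

lemma first_moment:
  fixes f :: "complex ^ 'm \<Rightarrow> ennreal" and q :: "complex ^ 'n"
  assumes [measurable]: "f \<in> borel_measurable borel" and q: "q \<in> vec_set \<O>" "q \<noteq> 0"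
  shows "ennreal (\<kappa> ^ CARD('m)) * (\<integral>\<^sup>+\<theta>\<in>mat_cell. periodization lat f (x + \<theta> *v q) \<partial>lborel)
    = (\<integral>\<^sup>+x. f x \<partial>lborel) * emeasure lborel (mat_cell :: (complex ^ 'n ^ 'm) set)"
proof -
  interpret W: tiling mat_lat "mat_cell :: (complex ^ 'n ^ 'm) set" by (rule tiling_mat)
  obtain j where j: "q $ j \<noteq> 0" using q(2) by (auto simp: vec_eq_iff)
  have "corr q (\<lambda>_ :: complex ^ 'n ^ 'm. 1) f y = corr q (\<lambda>_. 1) f x" for y
  proof -
    \<comment> \<open>With this \<open>?e\<close> the rank-one matrix moves \<theta>q by exactly y -
      x, so the correlation with 1 is constant in the shift.\<close>
    let ?e = "(\<chi> k. if k = j then 1 / q $ j else 0) :: complex ^ 'n"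
    have "(\<Sum>k\<in>UNIV. ?e $ k * q $ k) = 1" using j by (simp add: if_distrib if_distribR cong: if_cong)
    then have "(\<chi> i k. (y - x) $ i * ?e $ k) *v q = y - x"
      unfolding rank_one_mult_vec by (simp add: vec_eq_iff)
    with corr_translate[OF assms(1) _ q(1), of "\<lambda>_. 1" "\<chi> i k. (y - x) $ i * ?e $ k" x]
    show ?thesis by simp
  qed
  from corr_eq[OF _ _ this] show ?thesis by (simp add: corr_def)
qed

lemma independent_correlation:
  fixes f f' :: "complex ^ 'm \<Rightarrow> ennreal" and q q' :: "complex ^ 'n"
  assumes [measurable]: "f \<in> borel_measurable borel" "f' \<in> borel_measurable borel"
    and q: "q \<in> vec_set \<O>" "q' \<in> vec_set \<O>" and ind: "q $ i * q' $ j \<noteq> q $ j * q' $ i"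
  shows "ennreal (\<kappa> ^ CARD('m)) * (\<integral>\<^sup>+\<theta>\<in>mat_cell. periodization lat f (x + \<theta> *v q) *
      periodization lat f' (x' + \<theta> *v q') \<partial>lborel)
    = (\<integral>\<^sup>+x. f x \<partial>lborel) * (\<integral>\<^sup>+\<theta>\<in>(mat_cell :: (complex ^ 'n ^ 'm) set). periodization lat f' (x' + \<theta> *v q') \<partial>lborel)"
proof -
  interpret V: tiling lat "cell :: (complex ^ 'm) set" by (rule tiling_vec)
  interpret W: tiling mat_lat "mat_cell :: (complex ^ 'n ^ 'm) set" by (rule tiling_mat)
  define g where "g \<theta> = periodization lat f' (x' + \<theta> *v q')" for \<theta> :: "complex ^ 'n ^ 'm"
  have [measurable]: "g \<in> borel_measurable borel" unfolding g_def by measurable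
  define \<Delta> where "\<Delta> = q $ i * q' $ j - q $ j * q' $ i"
  have "\<Delta> \<noteq> 0" "i \<noteq> j" using ind by (auto simp: \<Delta>_def)
  have "corr q g f y = corr q g f x" for y
  proof -
    \<comment> \<open>Cramer's rule for the two equations that the product sum of e be 1 with
      \<open>q\<close> and 0 with \<open>q'\<close>: the form at \<open>q\<close> moves freely while
      the one at \<open>q'\<close> stands still.\<close>
    define e :: "complex ^ 'n" where "e = (\<chi> k. if k = i then q' $ j / \<Delta> else if k = j then - q' $ i / \<Delta> else 0)"
    have e: "(\<Sum>k\<in>UNIV. e $ k * r $ k) = (q' $ j * r $ i - q' $ i * r $ j) / \<Delta>" for r
    proof -
      have "(\<Sum>k\<in>UNIV. e $ k * r $ k) = (\<Sum>k\<in>{i, j}. e $ k * r $ k)"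
        by (intro sum.mono_neutral_right) (auto simp: e_def)
      then show ?thesis using \<open>i \<noteq> j\<close> by (simp add: e_def diff_divide_distrib)
    qed
    define c where "c = (\<chi> i k. (y - x) $ i * e $ k)"
    have "(\<Sum>k\<in>UNIV. e $ k * q $ k) = 1" using \<open>\<Delta> \<noteq> 0\<close> unfolding e by (simp add: \<Delta>_def mult.commute)
    then have cq: "c *v q = y - x" unfolding c_def rank_one_mult_vec by (simp add: vec_eq_iff)
    have "(\<Sum>k\<in>UNIV. e $ k * q' $ k) = 0" unfolding e by simp
    then have cq': "c *v q' = 0" unfolding c_def rank_one_mult_vec by (simp add: vec_eq_iff)
    have "corr q g f (x + c *v q) = corr q g f x"
    proof (rule corr_translate[OF _ _ q(1)])
      show "g (\<theta> + l) = g \<theta>" if "l \<in> mat_lat" for \<theta> l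
        unfolding g_def by (rule periodization_linear_form_periodic[OF q(2) that])
      show "g (\<theta> + c) = g \<theta>" for \<theta> by (simp add: g_def matrix_vector_mult_add_rdistrib cq')
    qed measurable
    then show ?thesis by (simp add: cq)
  qed
  from corr_eq[OF _ _ this] show ?thesis by (simp add: corr_def g_def)
qed

text \<open>As a function of the shift \<open>x\<close>, the correlation is invariant under \<open>N (\<O> + \<mu> \<O>)\<close>; enlarging
  the polydisc by the covering radius \<open>\<delta>\<close> of that lattice therefore absorbs any change of \<open>x\<close>.\<close>

lemma dependent_correlation:
  fixes f' :: "complex ^ 'm \<Rightarrow> ennreal" and q q' :: "complex ^ 'n" and r \<delta> :: real
  assumes [measurable]: "f' \<in> borel_measurable borel"
    and q: "q \<in> vec_set \<O>" "q' \<in> vec_set \<O>" "q' \<noteq> 0" and dep: "\<And>i. q $ i = \<mu> * q' $ i"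
    and cover: "\<And>z. \<exists>u\<in>\<O>. \<exists>v\<in>\<O>. cmod (z + u + \<mu> * v) \<le> \<delta>"
  shows "ennreal (\<kappa> ^ CARD('m)) * (\<integral>\<^sup>+\<theta>\<in>mat_cell. periodization lat (indicator (polydisc r)) (x + \<theta> *v q) *
      periodization lat f' (x' + \<theta> *v q') \<partial>lborel)
    \<le> emeasure lborel (polydisc (r + N * \<delta>) :: (complex ^ 'm) set) *
      (\<integral>\<^sup>+\<theta>\<in>(mat_cell :: (complex ^ 'n ^ 'm) set). periodization lat f' (x' + \<theta> *v q') \<partial>lborel)"
proof -
  interpret V: tiling lat "cell :: (complex ^ 'm) set" by (rule tiling_vec)
  interpret W: tiling mat_lat "mat_cell :: (complex ^ 'n ^ 'm) set" by (rule tiling_mat)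
  define g where "g \<theta> = periodization lat f' (x' + \<theta> *v q')" for \<theta> :: "complex ^ 'n ^ 'm"
  have [measurable]: "g \<in> borel_measurable borel" unfolding g_def by measurable
  let ?f = "\<lambda>r. indicator (polydisc r) :: complex ^ 'm \<Rightarrow> ennreal"
  obtain j where j: "q' $ j \<noteq> 0" using q(3) by (auto simp: vec_eq_iff)
  have "corr q g (?f r) x \<le> corr q g (?f (r + N * \<delta>)) y" for y
  proof -
    have "\<exists>uv. fst uv \<in> multiples N \<and> snd uv \<in> multiples N \<and>
        cmod (z + fst uv + \<mu> * snd uv) \<le> N * \<delta>" for z
    proof -
      obtain u v where uv: "u \<in> \<O>" "v \<in> \<O>" "cmod (z / N + u + \<mu> * v) \<le> \<delta>" using cover[of "z / N"] by (elim bexE)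
      have "z + N * u + \<mu> * (N * v) = N * (z / N + u + \<mu> * v)" using N_pos by (simp add: distrib_left mult_ac)
      then have "cmod (z + N * u + \<mu> * (N * v)) = N * cmod (z / N + u + \<mu> * v)" by (simp add: norm_mult)
      also have "\<dots> \<le> N * \<delta>" using uv(3) by (intro mult_left_mono) auto
      finally show ?thesis
        by (intro exI[of _ "(N * u, N * v)"]) (simp add: multiples_def imageI uv(1,2))
    qed
    then obtain h where h: "\<And>z. fst (h z) \<in> multiples N" "\<And>z. snd (h z) \<in> multiples N"
      "\<And>z. cmod (z + fst (h z) + \<mu> * snd (h z)) \<le> N * \<delta>" by metis
    define u v :: "complex ^ 'm" where "u = (\<chi> i. fst (h ((x - y) $ i)))" and "v = (\<chi> i. snd (h ((x - y) $ i)))"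
    have uv: "u \<in> lat" "v \<in> lat" using h by (simp_all add: u_def v_def vec_set_iff)
    define w where "w = (\<chi> i. \<mu> * v $ i)"
    have near: "sup_cmod (x - y + u + w) \<le> N * \<delta>"
      unfolding sup_cmod_le_iff using h(3) by (simp add: u_def v_def w_def)
    define e :: "complex ^ 'n" where "e = (\<chi> k. if k = j then 1 / q' $ j else 0)"
    \<comment> \<open>This matrix moves \<theta>q' by the lattice vector \<open>v\<close>, which the
      periodic \<open>g\<close> does not see, and \<theta>q by \<mu> v. Together with the lattice
      vector \<open>u\<close> this brings \<open>x\<close> within N \<delta> of
      \<open>y\<close>.\<close>
    define c where "c = (\<chi> i k. v $ i * e $ k)"
    have e: "(\<Sum>k\<in>UNIV. e $ k * r $ k) = r $ j / q' $ j" for r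
      unfolding e_def by (simp add: if_distrib if_distribR cong: if_cong)
    have cq: "c *v q = w" "c *v q' = v"
      using j unfolding c_def rank_one_mult_vec e w_def by (simp_all add: vec_eq_iff dep)
    have "corr q g (?f r) (x + u + c *v q) = corr q g (?f r) (x + u)"
    proof (rule corr_translate[OF _ _ q(1)])
      show "g (\<theta> + l) = g \<theta>" if "l \<in> mat_lat" for \<theta> l
        unfolding g_def by (rule periodization_linear_form_periodic[OF q(2) that])
      show "g (\<theta> + c) = g \<theta>" for \<theta>
        using V.periodization_periodic[OF uv(2), of f' "x' + \<theta> *v q'"]
        by (simp add: g_def matrix_vector_mult_add_rdistrib cq add.assoc)
    qed measurable
    moreover have "corr q g (?f r) (x + u) = corr q g (?f r) x"
    proof -
      have "periodization lat (?f r) (x + u + t) = periodization lat (?f r) (x + t)" for t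
        using V.periodization_periodic[OF uv(1), of "?f r" "x + t"] by (simp add: ac_simps)
      then show ?thesis by (simp add: corr_def)
    qed
    ultimately have "corr q g (?f r) x = corr q g (?f r) (x + u + w)" by (simp add: cq)
    also have "\<dots> \<le> corr q g (?f (r + N * \<delta>)) y"
    proof -
      have "?f r (x + u + w + t) \<le> ?f (r + N * \<delta>) (y + t)" for t
      proof -
        have "sup_cmod (y + t) \<le> r + N * \<delta>" if "sup_cmod (x + u + w + t) \<le> r"
        proof -
          have "y + t = (x + u + w + t) + - (x - y + u + w)" by simp
          then have "sup_cmod (y + t) \<le> sup_cmod (x + u + w + t) + sup_cmod (x - y + u + w)"
            by (metis sup_cmod_triangle sup_cmod_uminus)
          then show ?thesis using that near by simp
        qed
        then show ?thesis by (auto simp: indicator_def polydisc_def)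
      qed
      from this[of "t + l" for t l]
      have "periodization lat (?f r) (x + u + w + t) \<le> periodization lat (?f (r + N * \<delta>)) (y + t)" for t
        unfolding periodization_def by (intro nn_integral_mono) (simp add: add.assoc)
      then show ?thesis unfolding corr_def by (intro nn_integral_mono mult_right_mono) auto
    qed
    finally show ?thesis .
  qed
  from corr_le[OF _ _ this] show ?thesis by (simp add: corr_def g_def)
qed

end

section \<open>Sums of a decreasing function over lattice points\<close>

text \<open>The polydisc with \<open>sup_cmod y ^ (2 * CARD('n))\<close> below t has volume
  proportional to t, so the image of Lebesgue measure is a multiple of Lebesgue measure on the
  half-line. The sign is reversed because measures are compared on the rays \<open>{x<..}\<close>,
  which must have finite measure.\<close>

lemma distr_sup_cmod_power:
  "distr lborel borel (\<lambda>y :: complex ^ 'n. - (sup_cmod y ^ (2 * CARD('n))))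
    = density lborel (\<lambda>t. ennreal (polydisc_vol TYPE('n)) * indicator {..<0} t)"
proof (rule measure_eqI_lessThan)
  let ?c = "polydisc_vol TYPE('n)" and ?n = "2 * CARD('n)"
  have M: "emeasure (distr lborel borel (\<lambda>y :: complex ^ 'n. - (sup_cmod y ^ ?n))) {x<..}
      = ennreal (?c * max 0 (- x))" for x
  proof (cases "x < 0")
    case True
    have root: "root ?n (- x) ^ ?n = - x" using True by (intro real_root_pow_pos2) auto
    have "sup_cmod y ^ ?n < - x \<longleftrightarrow> sup_cmod y < root ?n (- x)" for y :: "complex ^ 'n"
    proof -
      have "root ?n (- x) ^ ?n \<le> sup_cmod y ^ ?n \<longleftrightarrow> root ?n (- x) \<le> sup_cmod y"
        using True by (intro power_mono_iff sup_cmod_nonneg) auto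
      then show ?thesis unfolding root by linarith
    qed
    then have "{y :: complex ^ 'n. x < - (sup_cmod y ^ ?n)} = {y. sup_cmod y < root ?n (- x)}"
      unfolding less_minus_iff[of x] by (rule Collect_cong)
    moreover have "root ?n (- x) \<ge> 0" using True by simp
    ultimately show ?thesis using True emeasure_open_polydisc[of "root ?n (- x)", where 'k = 'n]
      by (simp add: emeasure_distr vimage_def root)
  next
    case False
    moreover have "sup_cmod y ^ ?n \<ge> 0" for y :: "complex ^ 'n" using sup_cmod_nonneg by simp
    ultimately have "{y :: complex ^ 'n. x < - (sup_cmod y ^ ?n)} = {}"
      by (auto simp: not_less intro: order_trans[of _ 0])
    then show ?thesis using False by (simp add: emeasure_distr vimage_def)
  qed
  have N: "emeasure (density lborel (\<lambda>t. ennreal ?c * indicator {..<0} t)) {x<..} = ennreal (?c * max 0 (- x))" for x :: real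
  proof -
    have "emeasure (density lborel (\<lambda>t. ennreal ?c * indicator {..<0} t)) {x<..}
        = (\<integral>\<^sup>+t. ennreal ?c * indicator {x<..<0} t \<partial>lborel)"
      by (subst emeasure_density) (auto intro!: nn_integral_cong simp: indicator_def)
    also have "\<dots> = ennreal ?c * emeasure lborel {x<..<0}" by (simp add: nn_integral_cmult_indicator)
    also have "\<dots> = ennreal (?c * max 0 (- x))"
      using polydisc_vol_pos[where 'k = 'n] by (cases "x < 0") (simp_all add: max_def flip: ennreal_mult)
    finally show ?thesis .
  qed
  show "emeasure (distr lborel borel (\<lambda>y :: complex ^ 'n. - (sup_cmod y ^ ?n))) {x<..}
    = emeasure (density lborel (\<lambda>t. ennreal ?c * indicator {..<0} t)) {x<..}" for x
    unfolding M N ..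
  show "emeasure (distr lborel borel (\<lambda>y :: complex ^ 'n. - (sup_cmod y ^ ?n))) {x<..} < \<infinity>" for x
    unfolding M by simp
qed simp_all

lemma nn_integral_sup_cmod_power:
  assumes [measurable]: "\<phi> \<in> borel_measurable borel"
  shows "(\<integral>\<^sup>+y. \<phi> (sup_cmod (y :: complex ^ 'n) ^ (2 * CARD('n))) \<partial>lborel)
    = ennreal (polydisc_vol TYPE('n)) * (\<integral>\<^sup>+t\<in>{0<..}. \<phi> t \<partial>lborel)"
proof -
  let ?c = "ennreal (polydisc_vol TYPE('n))" and ?n = "2 * CARD('n)"
  have "(\<integral>\<^sup>+y. \<phi> (sup_cmod (y :: complex ^ 'n) ^ ?n) \<partial>lborel)
      = (\<integral>\<^sup>+t. \<phi> (- t) \<partial>distr lborel borel (\<lambda>y :: complex ^ 'n. - (sup_cmod y ^ ?n)))"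
    by (subst nn_integral_distr) simp_all
  also have "\<dots> = (\<integral>\<^sup>+t. ?c * (\<phi> (- t) * indicator {..<0} t) \<partial>lborel)"
    unfolding distr_sup_cmod_power by (subst nn_integral_density) (simp_all add: mult_ac)
  also have "\<dots> = ?c * (\<integral>\<^sup>+t. \<phi> (- t) * indicator {..<0} t \<partial>lborel)"
    by (rule nn_integral_cmult) simp
  also have "(\<integral>\<^sup>+t. \<phi> (- t) * indicator {..<0} t \<partial>lborel) = (\<integral>\<^sup>+t\<in>{0<..}. \<phi> t \<partial>lborel)"
    using nn_integral_real_affine[of "\<lambda>t. \<phi> (- t) * indicator {..<0} t" "- 1" 0]
    by (auto intro!: nn_integral_cong simp: indicator_def)
  finally show ?thesis .
qed

text \<open>Exponents and unit volumes are parameters tied down by equations. Constants such as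
  \<open>W\<close> that mention only them and \<psi> are therefore literally shared by the instances
  for different residue classes \<open>v\<close>.\<close>

locale khintchine_groshev = congruence_lattice D N for D N +
  fixes \<psi> :: "real \<Rightarrow> real" and v :: "(complex ^ 'm) \<times> (complex ^ 'n)"
    and mm nn :: nat and c\<^sub>m c\<^sub>n :: real
  assumes mm: "mm = 2 * CARD('m)" and nn: "nn = 2 * CARD('n)"
    and c\<^sub>m: "c\<^sub>m = polydisc_vol TYPE('m)" and c\<^sub>n: "c\<^sub>n = polydisc_vol TYPE('n)"
    and psi_pos: "\<And>t. t \<ge> 1 \<Longrightarrow> \<psi> t > 0"
    and psi_antimono: "antimono_on {1..} \<psi>"
    and psi_diverges: "(\<integral>\<^sup>+t\<in>{1..}. ennreal (\<psi> t) \<partial>lborel) = \<infinity>"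
    and v_integral: "fst v \<in> vec_set (quad_integers D)" "snd v \<in> vec_set (quad_integers D)"
begin

lemma nn_pos: "nn > 0" and mm_pos: "mm > 0"
  by (simp_all add: nn mm)

lemma card_n: "CARD('n) * 2 = nn"
  by (simp add: nn)

lemma c\<^sub>n_pos: "c\<^sub>n > 0" and c\<^sub>m_pos: "c\<^sub>m > 0"
  by (simp_all add: c\<^sub>n c\<^sub>m polydisc_vol_pos)

lemma emeasure_polydisc_n:
    "r \<ge> 0 \<Longrightarrow> emeasure lborel (polydisc r :: (complex ^ 'n) set) = ennreal (c\<^sub>n * r ^ nn)"
  and emeasure_polydisc_m:
    "r \<ge> 0 \<Longrightarrow> emeasure lborel (polydisc r :: (complex ^ 'm) set) = ennreal (c\<^sub>m * r ^ mm)"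
  by (simp_all add: emeasure_polydisc nn mm c\<^sub>n c\<^sub>m)

text \<open>\<psi> is cut off at T and continued by the value \<psi> 1 below 1, which keeps it
  decreasing on the whole line. The continuation adds only a bounded amount to integrals and
  sums.\<close>

definition rate :: "real \<Rightarrow> real \<Rightarrow> real" where
  "rate T t = (if t < T then \<psi> (max 1 t) else 0)"

lemma rate_nonneg: "rate T t \<ge> 0"
  using psi_pos[of "max 1 t"] by (simp add: rate_def)

lemma rate_antimono: "s \<le> t \<Longrightarrow> rate T t \<le> rate T s"
  using psi_pos[of "max 1 s"] monotone_onD[OF psi_antimono, of "max 1 s" "max 1 t"]
  by (auto simp: rate_def)

lemma psi_le: "\<psi> (max 1 t) \<le> \<psi> 1"
  using monotone_onD[OF psi_antimono, of 1 "max 1 t"] by auto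

lemma rate_le: "rate T t \<le> \<psi> 1"
  using psi_pos[of 1] psi_le by (auto simp: rate_def)

lemma rate_mono_T: "T \<le> T' \<Longrightarrow> rate T t \<le> rate T' t"
  using psi_pos[of "max 1 t"] by (auto simp: rate_def)

lemma rate_measurable [measurable]: "rate T \<in> borel_measurable borel"
proof -
  have "mono (\<lambda>t. - rate T t)" using rate_antimono by (auto simp: mono_def)
  then have "(\<lambda>t. - rate T t) \<in> borel_measurable borel" by (rule borel_measurable_mono)
  then show ?thesis by simp
qed

definition G :: "real \<Rightarrow> complex ^ 'n \<Rightarrow> real" where
  "G T y = rate T (sup_cmod y ^ nn)"

lemma G_nonneg: "G T y \<ge> 0" and G_le: "G T y \<le> \<psi> 1"
  by (simp_all add: G_def rate_nonneg rate_le)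

lemma G_measurable [measurable]: "G T \<in> borel_measurable borel"
  unfolding G_def by measurable

lemma G_antimono: "sup_cmod x \<le> sup_cmod y \<Longrightarrow> G T y \<le> G T x"
  unfolding G_def by (intro rate_antimono power_mono sup_cmod_nonneg)

text \<open>The integral of \<open>G T\<close>. Up to an additive constant it is the volume of the
  region divided by \<open>c\<^sub>m\<close>, and it serves as the scale of all estimates.\<close>

definition W :: "real \<Rightarrow> real" where
  "W T = c\<^sub>n * enn2real (\<integral>\<^sup>+t\<in>{0<..}. ennreal (rate T t) \<partial>lborel)"

lemma nn_integral_G_eq: "(\<integral>\<^sup>+y. ennreal (G T y) \<partial>lborel) = ennreal c\<^sub>n * (\<integral>\<^sup>+t\<in>{0<..}. ennreal (rate T t) \<partial>lborel)"
  using nn_integral_sup_cmod_power[where \<phi> = "\<lambda>t. ennreal (rate T t)" and 'n = 'n]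
  unfolding G_def nn[symmetric] c\<^sub>n[symmetric] by simp

lemma nn_integral_rate_finite: "(\<integral>\<^sup>+t\<in>{0<..}. ennreal (rate T t) \<partial>lborel) < \<infinity>"
proof -
  have "(\<integral>\<^sup>+t\<in>{0<..}. ennreal (rate T t) \<partial>lborel) \<le> (\<integral>\<^sup>+t. ennreal (\<psi> 1) * indicator {0..max 0 T} t \<partial>lborel)"
    by (intro nn_integral_mono) (auto simp: indicator_def rate_def psi_le intro!: ennreal_leI)
  also have "\<dots> = ennreal (\<psi> 1) * ennreal (max 0 T)" by (simp add: nn_integral_cmult_indicator)
  finally show ?thesis by (rule le_less_trans) (simp add: ennreal_mult_less_top)
qed

lemma W: "(\<integral>\<^sup>+y. ennreal (G T y) \<partial>lborel) = ennreal (W T)"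
  unfolding W_def nn_integral_G_eq using nn_integral_rate_finite[of T]
  using c\<^sub>n_pos by (simp add: ennreal_mult)

lemma W_nonneg: "W T \<ge> 0"
  using c\<^sub>n_pos by (simp add: W_def)

lemma W_mono: "T \<le> T' \<Longrightarrow> W T \<le> W T'"
proof -
  assume "T \<le> T'"
  then have "(\<integral>\<^sup>+y. ennreal (G T y) \<partial>lborel) \<le> (\<integral>\<^sup>+y. ennreal (G T' y) \<partial>lborel)"
    by (intro nn_integral_mono ennreal_leI) (simp add: G_def rate_mono_T)
  then show ?thesis by (simp add: W W_nonneg)
qed

text \<open>Continuity of \<open>W\<close> is the point, although \<psi> may jump: it lets
  \<open>W\<close> attain prescribed values.\<close>

lemma W_lipschitz:
  assumes "T \<le> T'" shows "W T' \<le> W T + c\<^sub>n * \<psi> 1 * (T' - T)"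
proof -
  have P: "\<psi> 1 > 0" "c\<^sub>n > 0" using psi_pos c\<^sub>n_pos by auto
  have "(\<integral>\<^sup>+t\<in>{0<..}. ennreal (rate T' t) \<partial>lborel)
      \<le> (\<integral>\<^sup>+t. ennreal (rate T t) * indicator {0<..} t + ennreal (\<psi> 1) * indicator {T..T'} t \<partial>lborel)"
    by (intro nn_integral_mono) (auto simp: indicator_def rate_def psi_le intro!: ennreal_leI)
  also have "\<dots> = (\<integral>\<^sup>+t\<in>{0<..}. ennreal (rate T t) \<partial>lborel) + (\<integral>\<^sup>+t. ennreal (\<psi> 1) * indicator {T..T'} t \<partial>lborel)"
    by (rule nn_integral_add) simp_all
  also have "(\<integral>\<^sup>+t. ennreal (\<psi> 1) * indicator {T..T'} t \<partial>lborel) = ennreal (\<psi> 1 * (T' - T))"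
    using assms P by (simp add: nn_integral_cmult_indicator ennreal_mult)
  finally have "ennreal c\<^sub>n * (\<integral>\<^sup>+t\<in>{0<..}. ennreal (rate T' t) \<partial>lborel)
      \<le> ennreal c\<^sub>n * (\<integral>\<^sup>+t\<in>{0<..}. ennreal (rate T t) \<partial>lborel) + ennreal c\<^sub>n * ennreal (\<psi> 1 * (T' - T))"
    unfolding distrib_left[symmetric] by (rule mult_left_mono) simp
  also have "ennreal c\<^sub>n * ennreal (\<psi> 1 * (T' - T)) = ennreal (c\<^sub>n * \<psi> 1 * (T' - T))"
    using P assms by (simp add: ennreal_mult mult.assoc)
  finally have "ennreal (W T') \<le> ennreal (W T + c\<^sub>n * \<psi> 1 * (T' - T))"
    unfolding nn_integral_G_eq[symmetric] W using P assms by (simp add: ennreal_plus W_nonneg)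
  then show ?thesis using P assms W_nonneg[of T] by (simp del: ennreal_plus)
qed

lemma W_unbounded: "\<exists>T. W T > B"
proof (rule ccontr)
  assume "\<nexists>T. W T > B"
  then have B: "W T \<le> B" for T by (simp add: not_less)
  note c = c\<^sub>n_pos
  have "\<infinity> = (\<integral>\<^sup>+t\<in>{1..}. ennreal (\<psi> t) \<partial>lborel)" by (simp add: psi_diverges)
  also have "\<dots> \<le> (\<integral>\<^sup>+t. (SUP k::nat. ennreal (rate (real k) t) * indicator {0<..} t) \<partial>lborel)"
  proof (rule nn_integral_mono)
    fix t :: real
    obtain k :: nat where "t < real k" using reals_Archimedean2 by blast
    then have "ennreal (\<psi> t) * indicator {1..} t \<le> ennreal (rate (real k) t) * indicator {0<..} t"
      by (auto simp: indicator_def rate_def max_def)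
    then show "ennreal (\<psi> t) * indicator {1..} t \<le> (SUP k::nat. ennreal (rate (real k) t) * indicator {0<..} t)"
      by (rule SUP_upper2[rotated]) simp
  qed
  also have "\<dots> = (SUP k::nat. \<integral>\<^sup>+t. ennreal (rate (real k) t) * indicator {0<..} t \<partial>lborel)"
    by (rule nn_integral_monotone_convergence_SUP)
      (auto simp: incseq_def le_fun_def intro!: mult_right_mono ennreal_leI rate_mono_T)
  also have "\<dots> \<le> ennreal (B / c\<^sub>n)"
  proof (rule SUP_least)
    fix k :: nat
    let ?I = "\<integral>\<^sup>+t. ennreal (rate (real k) t) * indicator {0<..} t \<partial>lborel"
    have "ennreal c\<^sub>n * ?I = ennreal (W k)" using nn_integral_G_eq[of k] by (simp add: W)
    also have "\<dots> \<le> ennreal (c\<^sub>n * (B / c\<^sub>n))" using B c by (intro ennreal_leI) simp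
    also have "\<dots> = ennreal c\<^sub>n * ennreal (B / c\<^sub>n)" by (rule ennreal_mult') (use c in simp)
    finally show "?I \<le> ennreal (B / c\<^sub>n)" using c by (subst (asm) ennreal_mult_le_mult_iff) auto
  qed
  finally show False by (simp add: top_unique)
qed

lemma W_at_top: "filterlim W at_top at_top"
  unfolding filterlim_at_top
proof
  fix Z
  obtain T where "W T > Z" using W_unbounded by blast
  then show "\<forall>\<^sub>F t in at_top. Z \<le> W t"
    using W_mono by (intro eventually_at_top_linorderI[of T]) (meson less_imp_le order_trans)
qed

lemma W_surj:
  assumes "w > W 1" obtains T where "T > 1" "W T = w"
proof -
  obtain T2 where T2: "W T2 > w" using W_unbounded by blast
  have "T2 > 1" using T2 assms W_mono[of T2 1] by (cases "T2 \<le> 1") auto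
  let ?K = "c\<^sub>n * \<psi> 1"
  have K: "?K \<ge> 0" using psi_pos[of 1] c\<^sub>n_pos by simp
  have "?K-lipschitz_on UNIV W"
  proof (rule lipschitz_onI)
    fix x y
    show "dist (W x) (W y) \<le> ?K * dist x y"
    proof (cases "x \<le> y")
      case True
      then show ?thesis using W_lipschitz[OF True] W_mono[OF True] by (simp add: dist_real_def)
    next
      case False
      then have "y \<le> x" by simp
      then show ?thesis using W_lipschitz[of y x] W_mono[of y x] by (simp add: dist_real_def)
    qed
  qed (rule K)
  then have "continuous_on {1..T2} W" using lipschitz_on_continuous_on continuous_on_subset by blast
  then obtain T where "1 \<le> T" "T \<le> T2" "W T = w"
    using IVT'[of W 1 w T2] assms T2 \<open>T2 > 1\<close> by auto
  moreover have "T \<noteq> 1" using calculation assms by auto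
  ultimately show ?thesis using that[of T] by simp
qed

text \<open>A decreasing profile is at least its value at modulus \<rho> on the whole polydisc of
  radius \<rho>. This bounds the approximation radius at \<open>q\<close> in terms of
  \<open>W\<close> and the size of \<open>q\<close>.\<close>

lemma rate_le_W:
  assumes "\<rho> \<ge> 0" shows "c\<^sub>n * \<rho> ^ nn * rate T (\<rho> ^ nn) \<le> W T"
proof -
  have "ennreal (c\<^sub>n * \<rho> ^ nn * rate T (\<rho> ^ nn))
      = (\<integral>\<^sup>+y. ennreal (rate T (\<rho> ^ nn)) * indicator (polydisc \<rho>) (y :: complex ^ 'n) \<partial>lborel)"
    using assms c\<^sub>n_pos
    by (subst nn_integral_cmult_indicator) (simp_all add: emeasure_polydisc_n rate_nonneg mult.commute flip: ennreal_mult)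
  also have "\<dots> \<le> (\<integral>\<^sup>+y. ennreal (G T y) \<partial>lborel)"
    by (intro nn_integral_mono)
      (auto simp: indicator_def polydisc_def G_def intro!: ennreal_leI rate_antimono power_mono sup_cmod_nonneg)
  finally show ?thesis unfolding W using W_nonneg[of T] by simp
qed

text \<open>Halving the points makes room for disjoint polydiscs on which \<open>G\<close> is at least as large as at
  the original point.\<close>

lemma sum_G_separated:
  assumes U: "finite U" and b: "b > 0" and large: "\<And>q. q \<in> U \<Longrightarrow> b \<le> sup_cmod q"
    and sep: "\<And>q q'. q \<in> U \<Longrightarrow> q' \<in> U \<Longrightarrow> q \<noteq> q' \<Longrightarrow> b \<le> sup_cmod (q - q')"
  shows "(\<Sum>q\<in>U. G T q) * (c\<^sub>n * (b / 5) ^ nn) \<le> W T"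
proof -
  \<comment> \<open>Halved points are b/2 apart, so polydiscs of radius b/5 about them are disjoint.
    Moreover |q|/2 + b/5 is at most |q|, since b is at most |q|.\<close>
  let ?B = "\<lambda>q y. indicator (polydisc (b / 5)) (y + - ((1 / 2) *\<^sub>R q)) :: ennreal"
  note c = c\<^sub>n_pos
  have pointwise: "(\<Sum>q\<in>U. ennreal (G T q) * ?B q y) \<le> ennreal (G T y)" for y
  proof (cases "\<exists>q\<in>U. sup_cmod (y - (1 / 2) *\<^sub>R q) \<le> b / 5")
    case True
    then obtain q where q: "q \<in> U" "sup_cmod (y - (1 / 2) *\<^sub>R q) \<le> b / 5" by blast
    have "?B q' y = 0" if q': "q' \<in> U - {q}" for q'
    proof -
      have "b \<le> sup_cmod (q - q')" using sep q' q(1) by blast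
      then have "b / 2 \<le> sup_cmod ((1 / 2) *\<^sub>R (q - q'))" by (simp add: sup_cmod_scaleR)
      also have "(1 / 2) *\<^sub>R (q - q') = (y - (1 / 2) *\<^sub>R q') + - (y - (1 / 2) *\<^sub>R q)"
        by (simp add: algebra_simps)
      also have "sup_cmod \<dots> \<le> sup_cmod (y - (1 / 2) *\<^sub>R q') + sup_cmod (y - (1 / 2) *\<^sub>R q)"
        by (metis sup_cmod_triangle sup_cmod_uminus)
      finally have "sup_cmod (y - (1 / 2) *\<^sub>R q') > b / 5" using q(2) b by simp
      then show ?thesis by (simp add: polydisc_def)
    qed
    then have "(\<Sum>q\<in>U. ennreal (G T q) * ?B q y) = ennreal (G T q) * ?B q y"
      using sum.remove[OF U q(1), of "\<lambda>q. ennreal (G T q) * ?B q y"] by simp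
    also have "\<dots> \<le> ennreal (G T q) * 1" by (intro mult_left_mono) (auto simp: indicator_def)
    also have "\<dots> \<le> ennreal (G T y)"
    proof -
      have "y = (y - (1 / 2) *\<^sub>R q) + (1 / 2) *\<^sub>R q" by simp
      then have "sup_cmod y \<le> sup_cmod (y - (1 / 2) *\<^sub>R q) + sup_cmod ((1 / 2) *\<^sub>R q)"
        by (metis sup_cmod_triangle)
      also have "\<dots> \<le> sup_cmod q" using q(2) large[OF q(1)] b by (simp add: sup_cmod_scaleR)
      finally show ?thesis by (simp add: G_antimono ennreal_leI)
    qed
    finally show ?thesis .
  next
    case False
    then have "(\<Sum>q\<in>U. ennreal (G T q) * ?B q y) = 0" by (simp add: polydisc_def indicator_def)
    then show ?thesis by simp
  qed
  have "ennreal ((\<Sum>q\<in>U. G T q) * (c\<^sub>n * (b / 5) ^ nn))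
      = (\<Sum>q\<in>U. ennreal (G T q) * emeasure lborel (polydisc (b / 5) :: (complex ^ 'n) set))"
    using b c by (simp add: emeasure_polydisc_n sum_distrib_right G_nonneg flip: ennreal_mult)
  also have "\<dots> = (\<Sum>q\<in>U. \<integral>\<^sup>+y. ennreal (G T q) * ?B q y \<partial>lborel)"
  proof (rule sum.cong[OF refl])
    fix q :: "complex ^ 'n"
    have "(\<integral>\<^sup>+y. ?B q y \<partial>lborel) = emeasure lborel (polydisc (b / 5) :: (complex ^ 'n) set)"
      by (subst nn_integral_lborel_shift) simp_all
    then show "ennreal (G T q) * emeasure lborel (polydisc (b / 5) :: (complex ^ 'n) set)
        = (\<integral>\<^sup>+y. ennreal (G T q) * ?B q y \<partial>lborel)"
      by (subst nn_integral_cmult) simp_all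
  qed
  also have "\<dots> = (\<integral>\<^sup>+y. (\<Sum>q\<in>U. ennreal (G T q) * ?B q y) \<partial>lborel)"
    by (rule nn_integral_sum[symmetric]) simp
  also have "\<dots> \<le> (\<integral>\<^sup>+y. ennreal (G T y) \<partial>lborel)" by (intro nn_integral_mono pointwise)
  finally show ?thesis unfolding W using W_nonneg[of T] by simp
qed

section \<open>Lattice points in the range of q, and their sum compared with an integral\<close>

definition points :: "real \<Rightarrow> (complex ^ 'n) set" where
  "points T = {q. q - snd v \<in> lat \<and> 1 \<le> sup_cmod q ^ nn \<and> sup_cmod q ^ nn < T}"

lemma coset_integral:
  assumes "q - snd v \<in> lat" shows "q \<in> vec_set \<O>"
proof -
  have "q $ i \<in> \<O>" for i
  proof -
    have "q $ i - snd v $ i \<in> \<O>" "snd v $ i \<in> \<O>"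
      using assms v_integral(2) by (auto simp: vec_set_iff dest: subsetD[OF multiples_subset])
    from add_mem[OF this] show ?thesis by simp
  qed
  then show ?thesis by (simp add: vec_set_iff)
qed

lemma sup_cmod_ge_1:
  assumes "q \<in> vec_set \<O>" "q \<noteq> 0" shows "sup_cmod q \<ge> 1"
proof -
  obtain i where "q $ i \<noteq> 0" using assms(2) by (auto simp: vec_eq_iff)
  then show ?thesis using cmod_ge_1[of "q $ i"] cmod_le_sup_cmod[of q i] assms(1) by (simp add: vec_set_iff)
qed

lemma power_nn_less: "0 \<le> (x :: real) \<Longrightarrow> x ^ nn < T \<Longrightarrow> x \<le> max 1 T"
  using self_le_power[of x nn] nn_pos by (cases "x \<le> 1") auto

lemma finite_coset: "finite {q. q - snd v \<in> lat \<and> sup_cmod q ^ nn < T}"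
proof (rule finite_subset)
  show "finite (vec_set {z \<in> \<O>. cmod z \<le> max 1 T} :: (complex ^ 'n) set)"
    by (intro finite_vec_set finite_quad_integers_le)
  show "{q. q - snd v \<in> lat \<and> sup_cmod q ^ nn < T} \<subseteq> vec_set {z \<in> \<O>. cmod z \<le> max 1 T}"
  proof
    fix q assume q: "q \<in> {q. q - snd v \<in> lat \<and> sup_cmod q ^ nn < T}"
    then have "sup_cmod q \<le> max 1 T" using power_nn_less[OF sup_cmod_nonneg] by blast
    then show "q \<in> vec_set {z \<in> \<O>. cmod z \<le> max 1 T}"
      using q coset_integral[of q] by (auto simp: vec_set_iff intro: order_trans[OF cmod_le_sup_cmod])
  qed
qed

lemma finite_points: "finite (points T)"
  using finite_coset[of T] by (rule finite_subset[rotated]) (auto simp: points_def)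

lemma points_integral: "q \<in> points T \<Longrightarrow> q \<in> vec_set \<O> \<and> q \<noteq> 0"
  using coset_integral[of q] nn_pos by (auto simp: points_def zero_power)

lemma G_points: "q \<in> points T \<Longrightarrow> G T q = \<psi> (sup_cmod q ^ nn)"
  by (simp add: points_def G_def rate_def)

text \<open>Non-zero integral vectors have sup modulus at least 1, so the full coset sum and the sum
  over \<open>points\<close> differ at most by the term at 0, which is at most \<psi> 1.\<close>

lemma rate_sum_bounds:
  "(\<Sum>q\<in>points T. G T q) \<le> enn2real (periodization lat (\<lambda>y. ennreal (G T y)) (snd v))"
  "enn2real (periodization lat (\<lambda>y. ennreal (G T y)) (snd v)) \<le> (\<Sum>q\<in>points T. G T q) + \<psi> 1"
  "periodization lat (\<lambda>y. ennreal (G T y)) (snd v) < \<infinity>"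
proof -
  let ?A = "{q. q - snd v \<in> lat \<and> sup_cmod q ^ nn < T}"
  have bij: "bij_betw (\<lambda>l. snd v + l) lat {q. q - snd v \<in> lat}"
    by (rule bij_betw_byWitness[of _ "\<lambda>q. q - snd v"]) auto
  have "periodization lat (\<lambda>y. ennreal (G T y)) (snd v) = (\<integral>\<^sup>+q. ennreal (G T q) \<partial>count_space {q. q - snd v \<in> lat})"
    unfolding periodization_def by (rule nn_integral_bij_count_space[OF bij])
  also have "\<dots> = (\<Sum>q\<in>?A. ennreal (G T q))"
    by (rule nn_integral_count_space') (use finite_coset in \<open>auto simp: G_def rate_def\<close>)
  finally have eq: "periodization lat (\<lambda>y. ennreal (G T y)) (snd v) = ennreal (\<Sum>q\<in>?A. G T q)"
    by (simp add: sum_ennreal G_nonneg)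
  have sub: "?A \<subseteq> insert 0 (points T)"
  proof
    fix q assume q: "q \<in> ?A"
    show "q \<in> insert 0 (points T)"
    proof (cases "q = 0")
      case False
      then have "1 \<le> sup_cmod q ^ nn" using sup_cmod_ge_1[of q] coset_integral[of q] q one_le_power by auto
      then show ?thesis using q by (simp add: points_def)
    qed simp
  qed
  have e: "enn2real (periodization lat (\<lambda>y. ennreal (G T y)) (snd v)) = (\<Sum>q\<in>?A. G T q)"
    unfolding eq by (simp add: sum_nonneg G_nonneg)
  show "(\<Sum>q\<in>points T. G T q) \<le> enn2real (periodization lat (\<lambda>y. ennreal (G T y)) (snd v))"
    unfolding e by (rule sum_mono2) (use finite_coset in \<open>auto simp: points_def G_nonneg\<close>)
  have "(\<Sum>q\<in>?A. G T q) \<le> (\<Sum>q\<in>insert 0 (points T). G T q)"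
    by (rule sum_mono2) (use sub finite_points G_nonneg in auto)
  also have "\<dots> = (\<Sum>q\<in>points T. G T q) + G T 0"
    using finite_points points_integral[of 0 T] by (subst sum.insert) auto
  finally show "enn2real (periodization lat (\<lambda>y. ennreal (G T y)) (snd v)) \<le> (\<Sum>q\<in>points T. G T q) + \<psi> 1"
    unfolding e using G_le[of T 0] by simp
  show "periodization lat (\<lambda>y. ennreal (G T y)) (snd v) < \<infinity>" unfolding eq by simp
qed

text \<open>Moving a lattice point through its cell changes the sup modulus by at most d.
  Integrating over the cell turns the lattice sum into integrals of the profile with shifted
  argument.\<close>

lemma cell_periodization_bounds:
  obtains d where "d > 0"
    "\<And>T. ennreal (\<kappa> ^ CARD('n)) * periodization lat (\<lambda>y. ennreal (G T y)) (snd v)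
      \<le> (\<integral>\<^sup>+y. ennreal (rate T (max 0 (sup_cmod (y :: complex ^ 'n) - d) ^ nn)) \<partial>lborel)"
    "\<And>T. (\<integral>\<^sup>+y. ennreal (rate T ((sup_cmod (y :: complex ^ 'n) + d) ^ nn)) \<partial>lborel)
      \<le> ennreal (\<kappa> ^ CARD('n)) * periodization lat (\<lambda>y. ennreal (G T y)) (snd v)"
proof -
  interpret V: tiling lat "cell :: (complex ^ 'n) set" by (rule tiling_vec)
  obtain d where d: "d > 0" "\<And>x :: complex ^ 'n. x \<in> cell \<Longrightarrow> sup_cmod x \<le> d"
  proof -
    obtain d where "d > 0" "\<And>x. x \<in> (cell :: (complex ^ 'n) set) \<Longrightarrow> norm x \<le> d"
      using V.F_bounded by (auto simp: bounded_pos)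
    moreover have "sup_cmod x \<le> norm x" for x :: "complex ^ 'n"
      using Finite_Cartesian_Product.norm_nth_le by (auto simp: sup_cmod_le_iff)
    ultimately show ?thesis by (intro that[of d]) (auto intro: order_trans)
  qed
  have const: "(\<integral>\<^sup>+x\<in>(cell :: (complex ^ 'n) set). c \<partial>lborel) = ennreal (\<kappa> ^ CARD('n)) * c" for c
    by (subst nn_integral_cmult_indicator) (simp_all add: emeasure_cell mult.commute)
  have up: "ennreal (\<kappa> ^ CARD('n)) * periodization lat (\<lambda>y. ennreal (G T y)) (snd v)
      \<le> (\<integral>\<^sup>+y. ennreal (rate T (max 0 (sup_cmod (y :: complex ^ 'n) - d) ^ nn)) \<partial>lborel)" for T
  proof -
    let ?h = "\<lambda>y :: complex ^ 'n. ennreal (rate T (max 0 (sup_cmod y - d) ^ nn))"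
    have "(\<integral>\<^sup>+x\<in>(cell :: (complex ^ 'n) set). periodization lat (\<lambda>y. ennreal (G T y)) (snd v) \<partial>lborel)
        \<le> (\<integral>\<^sup>+x\<in>cell. periodization lat ?h (x + snd v) \<partial>lborel)"
    proof (rule nn_integral_mono)
      fix x :: "complex ^ 'n"
      have "periodization lat (\<lambda>y. ennreal (G T y)) (snd v) \<le> periodization lat ?h (x + snd v)" if x: "x \<in> cell"
        unfolding periodization_def G_def
      proof (intro nn_integral_mono ennreal_leI rate_antimono power_mono)
        fix l
        have "sup_cmod (x + snd v + l) \<le> sup_cmod x + sup_cmod (snd v + l)"
          using sup_cmod_triangle[of x "snd v + l"] by (simp add: add.assoc)
        then show "max 0 (sup_cmod (x + snd v + l) - d) \<le> sup_cmod (snd v + l)"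
          using d(2)[OF x] sup_cmod_nonneg[of "snd v + l"] by simp
      qed simp
      then show "periodization lat (\<lambda>y. ennreal (G T y)) (snd v) * indicator cell x
          \<le> periodization lat ?h (x + snd v) * indicator cell x" by (simp add: indicator_def)
    qed
    also have "\<dots> = (\<integral>\<^sup>+y. ?h y \<partial>lborel)" by (rule V.nn_integral_periodization_shift) simp
    finally show ?thesis by (simp only: const)
  qed
  have lo: "(\<integral>\<^sup>+y. ennreal (rate T ((sup_cmod (y :: complex ^ 'n) + d) ^ nn)) \<partial>lborel)
      \<le> ennreal (\<kappa> ^ CARD('n)) * periodization lat (\<lambda>y. ennreal (G T y)) (snd v)" for T
  proof -
    let ?h = "\<lambda>y :: complex ^ 'n. ennreal (rate T ((sup_cmod y + d) ^ nn))"
    have "(\<integral>\<^sup>+y. ?h y \<partial>lborel) = (\<integral>\<^sup>+x\<in>cell. periodization lat ?h (x + snd v) \<partial>lborel)"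
      by (rule V.nn_integral_periodization_shift[symmetric]) simp
    also have "\<dots> \<le> (\<integral>\<^sup>+x\<in>(cell :: (complex ^ 'n) set). periodization lat (\<lambda>y. ennreal (G T y)) (snd v) \<partial>lborel)"
    proof (rule nn_integral_mono)
      fix x :: "complex ^ 'n"
      have "periodization lat ?h (x + snd v) \<le> periodization lat (\<lambda>y. ennreal (G T y)) (snd v)" if x: "x \<in> cell"
        unfolding periodization_def G_def
      proof (intro nn_integral_mono ennreal_leI rate_antimono power_mono)
        fix l
        have "sup_cmod (snd v + l) \<le> sup_cmod (x + snd v + l) + sup_cmod x"
          using sup_cmod_triangle[of "x + snd v + l" "- x"] by simp
        then show "sup_cmod (snd v + l) \<le> sup_cmod (x + snd v + l) + d" using d(2)[OF x] by simp
      qed (rule sup_cmod_nonneg)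
      then show "periodization lat ?h (x + snd v) * indicator cell x
          \<le> periodization lat (\<lambda>y. ennreal (G T y)) (snd v) * indicator cell x" by (simp add: indicator_def)
    qed
    finally show ?thesis by (simp only: const)
  qed
  show ?thesis by (rule that[OF d(1) up lo])
qed

text \<open>Outside a fixed polydisc the additive shift by d is dominated by the dilation 1 + e. The
  dilation costs the factor (1 + e)^nn, the polydisc the constant C, both uniformly in T.\<close>

lemma shifted_integral_bounds:
  assumes d: "d > 0" and e: "e > 0"
  obtains C where "C \<ge> 0"
    "\<And>T. (\<integral>\<^sup>+y. ennreal (rate T (max 0 (sup_cmod (y :: complex ^ 'n) - d) ^ nn)) \<partial>lborel)
      \<le> ennreal (C + (1 + e) ^ nn * W T)"
    "\<And>T. ennreal (W T) \<le> ennreal ((1 + e) ^ nn) *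
      ((\<integral>\<^sup>+y. ennreal (rate T ((sup_cmod (y :: complex ^ 'n) + d) ^ nn)) \<partial>lborel) + ennreal C)"
proof -
  \<comment> \<open>The solution of \<rho> - d = \<rho> / (1 + e); beyond it the shift is smaller
    than the dilation.\<close>
  define \<rho> where "\<rho> = (1 + e) * d / e"
  have \<rho>: "\<rho> > 0" using d e by (simp add: \<rho>_def)
  define C where "C = \<psi> 1 * (c\<^sub>n * \<rho> ^ nn)"
  have psi1: "\<psi> 1 > 0" using psi_pos by simp
  have C: "C \<ge> 0" using psi1 c\<^sub>n_pos \<rho> by (simp add: C_def)
  have pd: "(\<integral>\<^sup>+y. ennreal (\<psi> 1) * indicator (polydisc \<rho> :: (complex ^ 'n) set) y \<partial>lborel) = ennreal C"
    using \<rho> psi1 c\<^sub>n_pos by (subst nn_integral_cmult_indicator) (simp_all add: emeasure_polydisc_n C_def ennreal_mult)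
  have up: "(\<integral>\<^sup>+y. ennreal (rate T (max 0 (sup_cmod (y :: complex ^ 'n) - d) ^ nn)) \<partial>lborel)
      \<le> ennreal (C + (1 + e) ^ nn * W T)" for T
  proof -
    have "(\<integral>\<^sup>+y. ennreal (rate T (max 0 (sup_cmod (y :: complex ^ 'n) - d) ^ nn)) \<partial>lborel)
      \<le> (\<integral>\<^sup>+y. ennreal (\<psi> 1) * indicator (polydisc \<rho>) y + ennreal (G T ((1 / (1 + e)) *\<^sub>R y)) \<partial>lborel)"
    proof (rule nn_integral_mono)
      fix y :: "complex ^ 'n"
      show "ennreal (rate T (max 0 (sup_cmod y - d) ^ nn))
        \<le> ennreal (\<psi> 1) * indicator (polydisc \<rho>) y + ennreal (G T ((1 / (1 + e)) *\<^sub>R y))"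
      proof (cases "sup_cmod y \<le> \<rho>")
        case True
        then have "ennreal (rate T (max 0 (sup_cmod y - d) ^ nn)) \<le> ennreal (\<psi> 1) * indicator (polydisc \<rho>) y"
          by (simp add: polydisc_def ennreal_leI rate_le)
        then show ?thesis by (rule add_increasing2[rotated]) simp
      next
        case False
        then have "(1 + e) * d < sup_cmod y * e" unfolding not_le \<rho>_def pos_divide_less_eq[OF e] .
        then have "sup_cmod y \<le> (sup_cmod y - d) * (1 + e)" by (simp add: algebra_simps)
        then have "1 / (1 + e) * sup_cmod y \<le> sup_cmod y - d" using e by (simp add: pos_divide_le_eq)
        then have "rate T (max 0 (sup_cmod y - d) ^ nn) \<le> G T ((1 / (1 + e)) *\<^sub>R y)"
          unfolding G_def sup_cmod_scaleR using e sup_cmod_nonneg[of y]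
          by (intro rate_antimono power_mono) auto
        then show ?thesis using False by (simp add: polydisc_def ennreal_leI)
      qed
    qed
    also have "\<dots> = ennreal C + (\<integral>\<^sup>+y. ennreal (G T ((1 / (1 + e)) *\<^sub>R y)) \<partial>lborel)"
      by (subst nn_integral_add) (simp_all add: pd)
    also have "(\<integral>\<^sup>+y. ennreal (G T ((1 / (1 + e)) *\<^sub>R y)) \<partial>lborel) = ennreal ((1 + e) ^ nn) * ennreal (W T)"
      using e nn_integral_lborel_scale[of "1 + e" "\<lambda>y :: complex ^ 'n. ennreal (G T ((1 / (1 + e)) *\<^sub>R y))"]
      by (simp add: card_n W)
    finally show ?thesis using C e W_nonneg[of T] by (simp add: ennreal_mult)
  qed
  have lo: "ennreal (W T) \<le> ennreal ((1 + e) ^ nn) *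
      ((\<integral>\<^sup>+y. ennreal (rate T ((sup_cmod (y :: complex ^ 'n) + d) ^ nn)) \<partial>lborel) + ennreal C)" for T
  proof -
    have "ennreal (W T) = ennreal ((1 + e) ^ nn) * (\<integral>\<^sup>+y. ennreal (G T ((1 + e) *\<^sub>R y)) \<partial>lborel)"
      using e nn_integral_lborel_scale[of "1 + e" "\<lambda>y :: complex ^ 'n. ennreal (G T y)"]
      by (simp add: card_n W)
    also have "(\<integral>\<^sup>+y. ennreal (G T ((1 + e) *\<^sub>R y)) \<partial>lborel)
        \<le> (\<integral>\<^sup>+y. ennreal (rate T ((sup_cmod (y :: complex ^ 'n) + d) ^ nn)) + ennreal (\<psi> 1) * indicator (polydisc \<rho>) y \<partial>lborel)"
    proof (rule nn_integral_mono)
      fix y :: "complex ^ 'n"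
      show "ennreal (G T ((1 + e) *\<^sub>R y))
        \<le> ennreal (rate T ((sup_cmod y + d) ^ nn)) + ennreal (\<psi> 1) * indicator (polydisc \<rho>) y"
      proof (cases "sup_cmod y \<le> \<rho>")
        case True
        then have "ennreal (G T ((1 + e) *\<^sub>R y)) \<le> ennreal (\<psi> 1) * indicator (polydisc \<rho>) y"
          by (simp add: polydisc_def ennreal_leI G_le)
        then show ?thesis by (rule add_increasing[rotated]) simp
      next
        case False
        then have "(1 + e) * d < sup_cmod y * e" unfolding not_le \<rho>_def pos_divide_less_eq[OF e] .
        moreover have "d \<le> (1 + e) * d" using d e by (simp add: algebra_simps)
        ultimately have "sup_cmod y + d \<le> (1 + e) * sup_cmod y" by (simp add: algebra_simps)
        then have "G T ((1 + e) *\<^sub>R y) \<le> rate T ((sup_cmod y + d) ^ nn)"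
          unfolding G_def sup_cmod_scaleR using e d sup_cmod_nonneg[of y]
          by (intro rate_antimono power_mono) auto
        then show ?thesis using False by (simp add: polydisc_def ennreal_leI)
      qed
    qed
    also have "\<dots> = (\<integral>\<^sup>+y. ennreal (rate T ((sup_cmod (y :: complex ^ 'n) + d) ^ nn)) \<partial>lborel) + ennreal C"
      by (subst nn_integral_add) (simp_all add: pd)
    finally show ?thesis by (simp add: mult_left_mono)
  qed
  show ?thesis by (rule that[OF C up lo])
qed

definition S :: "real \<Rightarrow> real" where
  "S T = (\<Sum>q\<in>points T. G T q)"

text \<open>The sum over \<open>points\<close> and \<open>W\<close> agree up to the factor (1 +
  e)^nn and a constant; divergence of the integral of \<psi> makes the constant negligible, and e is
  arbitrary.\<close>

lemma S_asymptotic: "((\<lambda>T. \<kappa> ^ CARD('n) * S T / W T) \<longlongrightarrow> 1) at_top"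
proof -
  obtain d where d: "d > 0"
    "\<And>T. ennreal (\<kappa> ^ CARD('n)) * periodization lat (\<lambda>y. ennreal (G T y)) (snd v)
      \<le> (\<integral>\<^sup>+y. ennreal (rate T (max 0 (sup_cmod (y :: complex ^ 'n) - d) ^ nn)) \<partial>lborel)"
    "\<And>T. (\<integral>\<^sup>+y. ennreal (rate T ((sup_cmod (y :: complex ^ 'n) + d) ^ nn)) \<partial>lborel)
      \<le> ennreal (\<kappa> ^ CARD('n)) * periodization lat (\<lambda>y. ennreal (G T y)) (snd v)"
    by (rule cell_periodization_bounds[OF that])
  define P where "P T = enn2real (periodization lat (\<lambda>y. ennreal (G T y)) (snd v))" for T
  have P: "periodization lat (\<lambda>y. ennreal (G T y)) (snd v) = ennreal (P T)" for T
    using rate_sum_bounds(3)[of T] by (simp add: P_def)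
  have P0: "P T \<ge> 0" for T by (simp add: P_def)
  have k: "\<kappa> ^ CARD('n) > 0" using \<kappa>_pos by simp
  define Q where "Q = \<kappa> ^ CARD('n) * \<psi> 1"
  have Q: "Q \<ge> 0" using k psi_pos[of 1] by (simp add: Q_def)
  have S_P: "\<kappa> ^ CARD('n) * S T \<le> \<kappa> ^ CARD('n) * P T" "\<kappa> ^ CARD('n) * P T \<le> \<kappa> ^ CARD('n) * S T + Q" for T
    using rate_sum_bounds(1,2)[of T] k unfolding P_def S_def Q_def distrib_left[symmetric]
    by (auto intro!: mult_left_mono)
  have bounds: "\<exists>C\<ge>0. \<forall>T. \<kappa> ^ CARD('n) * S T \<le> C + (1 + e) ^ nn * W T \<and>
      W T \<le> (1 + e) ^ nn * (\<kappa> ^ CARD('n) * S T + C)" if e: "e > 0" for e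
  proof -
    obtain C where C: "C \<ge> 0"
      "\<And>T. (\<integral>\<^sup>+y. ennreal (rate T (max 0 (sup_cmod (y :: complex ^ 'n) - d) ^ nn)) \<partial>lborel)
        \<le> ennreal (C + (1 + e) ^ nn * W T)"
      "\<And>T. ennreal (W T) \<le> ennreal ((1 + e) ^ nn) *
        ((\<integral>\<^sup>+y. ennreal (rate T ((sup_cmod (y :: complex ^ 'n) + d) ^ nn)) \<partial>lborel) + ennreal C)"
      by (rule shifted_integral_bounds[OF d(1) e that])
    have "\<kappa> ^ CARD('n) * S T \<le> C + Q + (1 + e) ^ nn * W T \<and>
      W T \<le> (1 + e) ^ nn * (\<kappa> ^ CARD('n) * S T + (C + Q))" for T
    proof -
      have "ennreal (\<kappa> ^ CARD('n) * P T) \<le> ennreal (C + (1 + e) ^ nn * W T)"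
        using order_trans[OF d(2) C(2)] k P0[of T] by (simp add: P ennreal_mult)
      moreover have nneg: "C + (1 + e) ^ nn * W T \<ge> 0" using C(1) e W_nonneg[of T] by simp
      ultimately have 1: "\<kappa> ^ CARD('n) * P T \<le> C + (1 + e) ^ nn * W T" by (simp del: ennreal_plus)
      have "ennreal (W T) \<le> ennreal ((1 + e) ^ nn) * (ennreal (\<kappa> ^ CARD('n)) * ennreal (P T) + ennreal C)"
        using C(3)[of T] d(3)[of T] unfolding P by (meson add_right_mono mult_left_mono order_trans zero_le)
      also have "\<dots> = ennreal ((1 + e) ^ nn * (\<kappa> ^ CARD('n) * P T + C))"
        using k P0[of T] C(1) e by (simp add: ennreal_mult)
      finally have 2: "W T \<le> (1 + e) ^ nn * (\<kappa> ^ CARD('n) * P T + C)"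
        using k P0[of T] C(1) e W_nonneg[of T] by (simp del: ennreal_plus)
      have "(1 + e) ^ nn * (\<kappa> ^ CARD('n) * P T + C) \<le> (1 + e) ^ nn * (\<kappa> ^ CARD('n) * S T + (C + Q))"
        using S_P(2)[of T] e by (intro mult_left_mono) auto
      then show ?thesis using 1 2 S_P(1)[of T] Q by linarith
    qed
    then show ?thesis using C(1) Q by (intro exI[of _ "C + Q"]) auto
  qed
  show ?thesis
    unfolding tendsto_iff
  proof (intro allI impI)
    fix \<epsilon> :: real assume \<epsilon>: "\<epsilon> > 0"
    have lim: "((\<lambda>e :: real. (1 + e) ^ nn) \<longlongrightarrow> 1) (at_right 0)" "((\<lambda>e :: real. 1 / (1 + e) ^ nn) \<longlongrightarrow> 1) (at_right 0)"
      by (auto intro!: tendsto_eq_intros)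
    have "\<forall>\<^sub>F e in at_right (0 :: real). e > 0 \<and> (1 + e) ^ nn < 1 + \<epsilon> / 2 \<and> 1 / (1 + e) ^ nn > 1 - \<epsilon> / 2"
      using order_tendstoD(2)[OF lim(1), of "1 + \<epsilon> / 2"] order_tendstoD(1)[OF lim(2), of "1 - \<epsilon> / 2"] \<epsilon>
      by (intro eventually_conj eventually_at_right_less) auto
    then obtain e where e: "e > 0" "(1 + e) ^ nn < 1 + \<epsilon> / 2" "1 / (1 + e) ^ nn > 1 - \<epsilon> / 2"
      using eventually_happens by force
    \<comment> \<open>The constant depends on e, which the tolerance has already fixed, so large
      values of \<open>W\<close> absorb it.\<close>
    obtain C where C: "C \<ge> 0" "\<And>T. \<kappa> ^ CARD('n) * S T \<le> C + (1 + e) ^ nn * W T"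
      "\<And>T. W T \<le> (1 + e) ^ nn * (\<kappa> ^ CARD('n) * S T + C)" using bounds[OF e(1)] by blast
    have "\<forall>\<^sub>F T in at_top. W T > 2 * C / \<epsilon> + 1"
      using W_at_top filterlim_at_top_dense by blast
    then show "\<forall>\<^sub>F T in at_top. dist (\<kappa> ^ CARD('n) * S T / W T) 1 < \<epsilon>"
    proof eventually_elim
      fix T assume T: "W T > 2 * C / \<epsilon> + 1"
      then have W0: "W T > 0" using C(1) \<epsilon> by (smt (verit) divide_nonneg_pos)
      have "2 * C < \<epsilon> * W T" using T \<epsilon> by (simp add: field_simps)
      then have CW: "C / W T < \<epsilon> / 2" using W0 by (simp add: field_simps)
      have "\<kappa> ^ CARD('n) * S T / W T \<le> (C + (1 + e) ^ nn * W T) / W T"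
        using C(2)[of T] W0 by (intro divide_right_mono) auto
      also have "\<dots> = C / W T + (1 + e) ^ nn" using W0 by (simp add: add_divide_distrib)
      finally have 1: "\<kappa> ^ CARD('n) * S T / W T < 1 + \<epsilon>" using CW e(2) by linarith
      have "W T / (1 + e) ^ nn \<le> \<kappa> ^ CARD('n) * S T + C"
        using C(3)[of T] e(1) by (simp add: field_simps)
      then have "W T / (1 + e) ^ nn / W T \<le> (\<kappa> ^ CARD('n) * S T + C) / W T"
        using W0 by (intro divide_right_mono) auto
      then have "1 / (1 + e) ^ nn \<le> \<kappa> ^ CARD('n) * S T / W T + C / W T"
        using W0 by (simp add: add_divide_distrib)
      then have 2: "\<kappa> ^ CARD('n) * S T / W T > 1 - \<epsilon>" using CW e(3) by linarith
      show "dist (\<kappa> ^ CARD('n) * S T / W T) 1 < \<epsilon>" using 1 2 by (simp add: dist_real_def abs_less_iff)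
    qed
  qed
qed

end

section \<open>The second moment\<close>

lemma power_diff_le:
  fixes x y :: real
  assumes "0 \<le> y" "y \<le> x" shows "x ^ k - y ^ k \<le> k * (x - y) * x ^ (k - 1)"
proof (cases k)
  case (Suc j)
  have "x ^ Suc j - y ^ Suc j = (x - y) * (\<Sum>i<Suc j. x ^ i * y ^ (j - i))"
    by (rule diff_power_eq_sum[unfolded lessThan_atLeast0[symmetric]])
  also have "\<dots> \<le> (x - y) * (\<Sum>i<Suc j. x ^ j)"
  proof (intro mult_left_mono sum_mono)
    fix i assume "i \<in> {..<Suc j}"
    then have "x ^ i * y ^ (j - i) \<le> x ^ i * x ^ (j - i)" using assms by (intro mult_left_mono power_mono) auto
    also have "\<dots> = x ^ j" using \<open>i \<in> _\<close> by (simp flip: power_add)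
    finally show "x ^ i * y ^ (j - i) \<le> x ^ j" .
  qed (use assms in auto)
  finally show ?thesis using Suc by (simp add: mult_ac)
qed simp

text \<open>In doubled exponents, \<open>dim\<close> says m + n \<ge> 3. It enters through
  \<open>exponent_bound\<close>.\<close>

locale khintchine_groshev_dim = khintchine_groshev D N \<psi> v mm nn c\<^sub>m c\<^sub>n
  for D N \<psi> and v :: "(complex ^ 'm) \<times> (complex ^ 'n)" and mm nn c\<^sub>m c\<^sub>n +
  fixes M :: real
  assumes M: "M = measure lborel (mat_cell :: (complex ^ 'n ^ 'm) set)" and dim: "mm + nn \<ge> 6"
begin

sublocale mat: tiling "mat_lat :: (complex ^ 'n ^ 'm) set" "mat_cell :: (complex ^ 'n ^ 'm) set"
  rewrites "mat.vol = M"
proof -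
  show "tiling mat_lat (mat_cell :: (complex ^ 'n ^ 'm) set)" by (rule tiling_mat)
  then show "tiling.vol (mat_cell :: (complex ^ 'n ^ 'm) set) = M" by (simp add: tiling.vol_def M)
qed

definition radius :: "complex ^ 'n \<Rightarrow> real" where
  "radius q = root mm (\<psi> (sup_cmod q ^ nn))"

text \<open>The number of admissible p for given q, parametrised by the lattice vector p -
  \<open>fst v\<close>.\<close>

definition hit :: "complex ^ 'n \<Rightarrow> complex ^ 'n ^ 'm \<Rightarrow> real" where
  "hit q \<theta> = real (card {l \<in> lat. sup_cmod (fst v + \<theta> *v q + l) \<le> radius q})"

text \<open>Volume over covolume: the mean number of points of a shifted \<open>lat\<close> in the
  polydisc of radius 1. Hence \<open>dens * G T q\<close> is the mean of
  \<open>hit q\<close>.\<close>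

definition dens :: real where
  "dens = c\<^sub>m / \<kappa> ^ (mm div 2)"

lemma dens_pos: "dens > 0"
  using c\<^sub>m_pos \<kappa>_pos by (simp add: dens_def)

lemma dens_eq: "dens = c\<^sub>m / \<kappa> ^ CARD('m)"
proof -
  have "mm div 2 = CARD('m)" by (simp add: mm)
  then show ?thesis by (simp only: dens_def)
qed

lemma finite_lat_le: "finite {l \<in> (lat :: (complex ^ 'm) set). sup_cmod (x + l) \<le> r}"
proof (rule finite_subset)
  show "finite (vec_set {z \<in> \<O>. cmod z \<le> r + sup_cmod x} :: (complex ^ 'm) set)"
    by (intro finite_vec_set finite_quad_integers_le)
  show "{l \<in> lat. sup_cmod (x + l) \<le> r} \<subseteq> vec_set {z \<in> \<O>. cmod z \<le> r + sup_cmod x}"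
  proof
    fix l assume l: "l \<in> {l \<in> lat. sup_cmod (x + l) \<le> r}"
    have "sup_cmod l \<le> r + sup_cmod x" using sup_cmod_triangle[of "x + l" "- x"] l by simp
    then show "l \<in> vec_set {z \<in> \<O>. cmod z \<le> r + sup_cmod x}"
      using l by (auto simp: vec_set_iff dest: subsetD[OF multiples_subset] intro: order_trans[OF cmod_le_sup_cmod])
  qed
qed

lemma ennreal_hit: "ennreal (hit q \<theta>) = periodization lat (indicator (polydisc (radius q))) (fst v + \<theta> *v q)"
proof -
  let ?A = "{l \<in> (lat :: (complex ^ 'm) set). sup_cmod (fst v + \<theta> *v q + l) \<le> radius q}"
  have "periodization lat (indicator (polydisc (radius q))) (fst v + \<theta> *v q)
      = (\<integral>\<^sup>+l. indicator ?A l \<partial>count_space lat)"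
    unfolding periodization_def by (intro nn_integral_cong) (auto simp: indicator_def polydisc_def)
  also have "\<dots> = emeasure (count_space lat) ?A" by (rule nn_integral_indicator) auto
  also have "\<dots> = ennreal (hit q \<theta>)"
    using finite_lat_le[of "fst v + \<theta> *v q" "radius q"] by (subst emeasure_count_space_finite) (auto simp: hit_def ennreal_of_nat_eq_real_of_nat)
  finally show ?thesis by simp
qed

lemma hit_nonneg: "hit q \<theta> \<ge> 0"
  by (simp add: hit_def)

lemma hit_eq: "hit q = (\<lambda>\<theta>. enn2real (periodization lat (indicator (polydisc (radius q))) (fst v + \<theta> *v q)))"
  by (simp add: hit_nonneg flip: ennreal_hit)

lemma hit_measurable [measurable]: "hit q \<in> borel_measurable borel"
proof -
  interpret V: tiling lat "cell :: (complex ^ 'm) set" by (rule tiling_vec)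
  show ?thesis unfolding hit_eq by measurable
qed

lemma radius_pow:
  assumes "q \<in> points T" shows "radius q ^ mm = G T q" "radius q \<ge> 0"
proof -
  have "\<psi> (sup_cmod q ^ nn) > 0" using assms psi_pos by (simp add: points_def)
  then show "radius q ^ mm = G T q" "radius q \<ge> 0"
    using mm_pos by (simp_all add: radius_def G_points[OF assms])
qed

lemma polydisc_radius:
  "q \<in> points T \<Longrightarrow> emeasure lborel (polydisc (radius q) :: (complex ^ 'm) set) = ennreal (c\<^sub>m * G T q)"
  using radius_pow[of q T] by (simp add: emeasure_polydisc_m)

lemma cancel_\<kappa>:
  assumes "ennreal (\<kappa> ^ CARD('m)) * I \<le> ennreal (c\<^sub>m * a) * ennreal b" "a \<ge> 0" "b \<ge> 0"
  shows "I \<le> ennreal (dens * a * b)"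
proof -
  have k: "\<kappa> ^ CARD('m) > 0" using \<kappa>_pos by simp
  have "ennreal (c\<^sub>m * a) * ennreal b = ennreal (\<kappa> ^ CARD('m)) * ennreal (dens * a * b)"
    using k \<kappa>_pos assms(2,3) c\<^sub>m_pos dens_pos by (simp add: dens_eq flip: ennreal_mult)
  then have "ennreal (\<kappa> ^ CARD('m)) * I \<le> ennreal (\<kappa> ^ CARD('m)) * ennreal (dens * a * b)"
    using assms(1) by simp
  then show ?thesis using k \<kappa>_pos by (subst (asm) ennreal_mult_le_mult_iff) auto
qed

lemma hit_mean:
  assumes "q \<in> points T"
  shows "(\<integral>\<^sup>+\<theta>\<in>mat_cell. ennreal (hit q \<theta>) \<partial>lborel) = ennreal (dens * G T q * M)"
proof -
  have k: "\<kappa> ^ CARD('m) > 0" using \<kappa>_pos by simp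
  have "ennreal (\<kappa> ^ CARD('m)) * (\<integral>\<^sup>+\<theta>\<in>mat_cell. ennreal (hit q \<theta>) \<partial>lborel)
      = ennreal (c\<^sub>m * G T q) * ennreal M"
    unfolding ennreal_hit using points_integral[OF assms]
    by (subst first_moment) (simp_all add: polydisc_radius[OF assms] mat.emeasure_F)
  also have "\<dots> = ennreal (\<kappa> ^ CARD('m)) * ennreal (dens * G T q * M)"
    using k \<kappa>_pos G_nonneg c\<^sub>m_pos dens_pos mat.vol_pos by (simp add: dens_eq flip: ennreal_mult)
  finally show ?thesis using k \<kappa>_pos by (simp add: ennreal_mult_cancel_left)
qed

lemma hit_independent:
  fixes q q' :: "complex ^ 'n"
  assumes q: "q \<in> points T" "q' \<in> points T" and ind: "q $ i * q' $ j \<noteq> q $ j * q' $ i"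
  shows "(\<integral>\<^sup>+\<theta>\<in>mat_cell. ennreal (hit q \<theta>) * ennreal (hit q' \<theta>) \<partial>lborel)
    \<le> ennreal (dens\<^sup>2 * G T q * G T q' * M)"
proof -
  have "ennreal (\<kappa> ^ CARD('m)) * (\<integral>\<^sup>+\<theta>\<in>mat_cell. ennreal (hit q \<theta>) * ennreal (hit q' \<theta>) \<partial>lborel)
      = ennreal (c\<^sub>m * G T q) * (\<integral>\<^sup>+\<theta>\<in>mat_cell. ennreal (hit q' \<theta>) \<partial>lborel)"
    unfolding ennreal_hit using points_integral[OF q(1)] points_integral[OF q(2)] ind
    by (subst independent_correlation) (simp_all add: polydisc_radius[OF q(1)])
  then have "(\<integral>\<^sup>+\<theta>\<in>mat_cell. ennreal (hit q \<theta>) * ennreal (hit q' \<theta>) \<partial>lborel)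
      \<le> ennreal (dens * G T q * (dens * G T q' * M))"
    unfolding hit_mean[OF q(2)]
    by (intro cancel_\<kappa>) (use G_nonneg dens_pos mat.vol_pos in auto)
  then show ?thesis by (simp add: power2_eq_square mult_ac)
qed

lemma hit_dependent:
  fixes q q' :: "complex ^ 'n" and \<mu> :: complex and \<delta> :: real
  assumes q: "q \<in> points T" "q' \<in> points T" and dep: "\<And>i. q $ i = \<mu> * q' $ i"
    and cover: "\<And>z. \<exists>u\<in>\<O>. \<exists>w\<in>\<O>. cmod (z + u + \<mu> * w) \<le> \<delta>" and \<delta>: "\<delta> \<ge> 0"
  shows "(\<integral>\<^sup>+\<theta>\<in>mat_cell. ennreal (hit q \<theta>) * ennreal (hit q' \<theta>) \<partial>lborel)
    \<le> ennreal (dens\<^sup>2 * (radius q + N * \<delta>) ^ mm * G T q' * M)"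
proof -
  have r: "radius q + N * \<delta> \<ge> 0" using radius_pow(2)[OF q(1)] \<delta> by simp
  have "ennreal (\<kappa> ^ CARD('m)) * (\<integral>\<^sup>+\<theta>\<in>mat_cell. ennreal (hit q \<theta>) * ennreal (hit q' \<theta>) \<partial>lborel)
      \<le> ennreal (c\<^sub>m * (radius q + N * \<delta>) ^ mm) * (\<integral>\<^sup>+\<theta>\<in>mat_cell. ennreal (hit q' \<theta>) \<partial>lborel)"
    unfolding ennreal_hit using points_integral[OF q(1)] points_integral[OF q(2)]
    by (intro order_trans[OF dependent_correlation[where \<mu> = \<mu> and \<delta> = \<delta>]] dep cover)
      (simp_all add: emeasure_polydisc_m[OF r])
  then have "(\<integral>\<^sup>+\<theta>\<in>mat_cell. ennreal (hit q \<theta>) * ennreal (hit q' \<theta>) \<partial>lborel)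
      \<le> ennreal (dens * (radius q + N * \<delta>) ^ mm * (dens * G T q' * M))"
    unfolding hit_mean[OF q(2)]
    by (intro cancel_\<kappa>) (use G_nonneg dens_pos mat.vol_pos r in auto)
  then show ?thesis by (simp add: power2_eq_square mult_ac)
qed

section \<open>Proportional pairs of points, sorted by their ratio\<close>

text \<open>The last clause takes the place of lowest terms, and the condition on moduli makes
  \<open>q\<close> the smaller vector of the pair.\<close>

definition slope_of :: "complex \<Rightarrow> complex \<Rightarrow> complex ^ 'n \<Rightarrow> complex ^ 'n \<Rightarrow> bool" where
  "slope_of a b q q' \<longleftrightarrow> a \<in> \<O> - {0} \<and> b \<in> \<O> - {0} \<and> cmod a \<le> cmod b \<and> (\<forall>i. q $ i = a / b * q' $ i) \<and>
    (\<forall>x\<in>\<O> - {0}. a / b * x \<in> \<O> \<longrightarrow> cmod b \<le> cmod x)"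

text \<open>Every non-zero entry of \<open>q'\<close> is itself a denominator of a/b, hence of
  modulus at least |b|; scaling by |a/b| gives the bound for \<open>q\<close>.\<close>

lemma slope_of_large:
  assumes "slope_of a b q q'" "q \<in> vec_set \<O>" "q' \<in> vec_set \<O>" "q' \<noteq> 0"
  shows "cmod b \<le> sup_cmod q'" "cmod a \<le> sup_cmod q"
proof -
  obtain i where i: "q' $ i \<noteq> 0" using assms(4) by (auto simp: vec_eq_iff)
  have "q' $ i \<in> \<O> - {0}" "a / b * q' $ i \<in> \<O>"
    using assms i by (auto simp: slope_of_def vec_set_iff)
  then have "cmod b \<le> cmod (q' $ i)" using assms(1) by (simp add: slope_of_def)
  then show b: "cmod b \<le> sup_cmod q'" using cmod_le_sup_cmod[of q' i] by simp
  have b0: "cmod b > 0" using assms(1) by (simp add: slope_of_def)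
  have "sup_cmod q = cmod (a / b) * sup_cmod q'"
    by (rule sup_cmod_mult) (use assms(1) in \<open>simp add: slope_of_def\<close>)
  also have "\<dots> \<ge> cmod (a / b) * cmod b" by (intro mult_left_mono b) simp
  finally show "cmod a \<le> sup_cmod q" using b0 by (simp add: norm_divide)
qed

text \<open>Entries of differences of such \<open>q'\<close> are again denominators of a/b, so
  distinct vectors are at least |b| apart and \<open>sum_G_separated\<close> applies with that
  spacing.\<close>

lemma sum_slope:
  fixes U :: "(complex ^ 'n) set"
  assumes U: "U \<subseteq> points T" and ab: "\<And>q'. q' \<in> U \<Longrightarrow> \<exists>q\<in>points T. slope_of a b q q'" and ne: "U \<noteq> {}"
  shows "(\<Sum>q'\<in>U. G T q') \<le> W T * 5 ^ nn / (c\<^sub>n * cmod b ^ nn)"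
proof -
  obtain q0 where "q0 \<in> U" using ne by blast
  then have b: "cmod b > 0" "b \<noteq> 0" using ab by (auto simp: slope_of_def)
  have lam: "q' $ i \<in> \<O>" "a / b * q' $ i \<in> \<O>" if q': "q' \<in> U" for q' :: "complex ^ 'n" and i
  proof -
    obtain q where q: "q \<in> points T" "slope_of a b q q'" using ab[OF q'] by blast
    then show "a / b * q' $ i \<in> \<O>" using points_integral[OF q(1)] by (simp add: slope_of_def vec_set_iff)
    show "q' $ i \<in> \<O>" using points_integral[of q' T] U q' by (auto simp: vec_set_iff)
  qed
  have min: "cmod b \<le> cmod x" if "x \<in> \<O>" "x \<noteq> 0" "a / b * x \<in> \<O>" for x
    using ab[OF \<open>q0 \<in> U\<close>] that by (auto simp: slope_of_def)
  have "(\<Sum>q\<in>U. G T q) * (c\<^sub>n * (cmod b / 5) ^ nn) \<le> W T"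
  proof (rule sum_G_separated)
    show "finite U" using U finite_points finite_subset by blast
    show "cmod b \<le> sup_cmod q'" if q': "q' \<in> U" for q'
    proof -
      obtain q where "q \<in> points T" "slope_of a b q q'" using ab[OF q'] by blast
      then show ?thesis using slope_of_large(1) points_integral U q' by blast
    qed
    show "cmod b \<le> sup_cmod (q - q')" if qq: "q \<in> U" "q' \<in> U" "q \<noteq> q'" for q q'
    proof -
      obtain i where i: "q $ i \<noteq> q' $ i" using qq(3) by (auto simp: vec_eq_iff)
      have "a / b * (q $ i - q' $ i) \<in> \<O>"
        unfolding right_diff_distrib using qq by (intro diff_mem lam)
      then have "cmod b \<le> cmod (q $ i - q' $ i)" using i qq by (intro min diff_mem lam) auto
      also have "\<dots> \<le> sup_cmod (q - q')" using cmod_le_sup_cmod[of "q - q'" i] by simp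
      finally show ?thesis .
    qed
  qed (rule b)
  moreover have "c\<^sub>n * (cmod b / 5) ^ nn > 0" using c\<^sub>n_pos b by simp
  ultimately have "(\<Sum>q\<in>U. G T q) \<le> W T / (c\<^sub>n * (cmod b / 5) ^ nn)" by (simp only: pos_le_divide_eq)
  also have "\<dots> = W T * 5 ^ nn / (c\<^sub>n * cmod b ^ nn)" by (simp add: power_divide)
  finally show ?thesis .
qed

text \<open>The exponents balance precisely because \<open>m + n \<ge> 3\<close>.\<close>

lemma exponent_bound:
  assumes "1 \<le> s" "s \<le> t"
  shows "s powr - (2 * (real mm - 1) / real mm) * t powr - (real nn + 1) \<le> s powr - (9 / 4) * t powr - (9 / 4)"
proof -
  have even: "even mm" "even nn" "mm > 0" "nn > 0" by (simp_all add: mm nn)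
  \<comment> \<open>Equivalent to the total exponent 2 - 2/mm + nn + 1 being at least 9/2. Equality
    holds for m = 2, n = 1; this case is where 9/4 comes from.\<close>
  have x: "real nn \<ge> 3 / 2 + 2 / real mm"
  proof (cases "mm = 2")
    case True
    then have "nn \<ge> 4" using dim by simp
    then have "real nn \<ge> 4" by simp
    then show ?thesis using True by simp
  next
    case False
    then have "mm \<ge> 4" using even by presburger
    then have "real mm \<ge> 4" by simp
    then have "2 / real mm \<le> 1 / 2" by (simp add: field_simps)
    moreover have "nn \<ge> 2" using even by presburger
    then have "real nn \<ge> 2" by simp
    ultimately show ?thesis by linarith
  qed
  have "2 / real mm \<ge> 0" by simp
  then have z: "real nn \<ge> 3 / 2" using x by linarith
  have m: "2 * (real mm - 1) / real mm = 2 - 2 / real mm" using even by (simp add: field_simps)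
  \<comment> \<open>The surplus over 9/4 in the exponent of \<open>t\<close> is handed to
    \<open>s\<close>, which is allowed because s \<le> t.\<close>
  have "t powr - (real nn + 1) = t powr - (real nn + 1 - 9 / 4) * t powr - (9 / 4)"
    by (subst powr_add[symmetric], rule arg_cong[where f = "(powr) t"]) simp
  also have "t powr - (real nn + 1 - 9 / 4) \<le> s powr - (real nn + 1 - 9 / 4)"
    using assms z by (intro powr_mono2') auto
  finally have "s powr - (2 - 2 / real mm) * t powr - (real nn + 1)
      \<le> s powr - (2 - 2 / real mm) * (s powr - (real nn + 1 - 9 / 4) * t powr - (9 / 4))"
    by (simp add: mult_left_mono mult_right_mono)
  also have "\<dots> = s powr (- (2 - 2 / real mm) - (real nn + 1 - 9 / 4)) * t powr - (9 / 4)"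
    using assms by (simp add: powr_add[symmetric] mult.assoc[symmetric])
  also have "\<dots> \<le> s powr - (9 / 4) * t powr - (9 / 4)"
    using assms x by (intro mult_right_mono powr_mono) auto
  finally show ?thesis unfolding m .
qed

lemma slope_exists:
  "\<exists>C>0. \<forall>q\<in>vec_set \<O> - {0}. \<forall>q'\<in>vec_set \<O> - {0}. sup_cmod q \<le> sup_cmod q' \<longrightarrow>
    (\<forall>i j. q $ i * q' $ j = q $ j * q' $ i) \<longrightarrow>
    (\<exists>a b. slope_of a b q q' \<and> (\<forall>z. \<exists>u\<in>\<O>. \<exists>w\<in>\<O>. cmod (z + u + a / b * w) \<le> C / cmod b))"
proof -
  obtain C where C: "C > 0" "\<And>\<alpha> \<beta>. \<alpha> \<in> \<O> \<Longrightarrow> \<beta> \<in> \<O> \<Longrightarrow> \<alpha> \<noteq> 0 \<Longrightarrow> \<beta> \<noteq> 0 \<Longrightarrow>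
    \<exists>a b. a \<in> \<O> - {0} \<and> b \<in> \<O> - {0} \<and> a * \<beta> = \<alpha> * b \<and>
      (\<forall>x\<in>\<O> - {0}. \<alpha> / \<beta> * x \<in> \<O> \<longrightarrow> cmod b \<le> cmod x) \<and>
      (\<forall>z. \<exists>u\<in>\<O>. \<exists>v\<in>\<O>. cmod (z + u + \<alpha> / \<beta> * v) \<le> C / cmod b)"
    by (rule least_denominator[OF that])
  show ?thesis
  proof (intro exI[of _ C] conjI C(1) ballI impI)
    fix q q' :: "complex ^ 'n"
    assume q': "q \<in> vec_set \<O> - {0}" "q' \<in> vec_set \<O> - {0}"
      and dep: "\<forall>i j. q $ i * q' $ j = q $ j * q' $ i" and le: "sup_cmod q \<le> sup_cmod q'"
    then have q: "q \<in> vec_set \<O>" "q' \<in> vec_set \<O>" "q \<noteq> 0" "q' \<noteq> 0" by auto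
    obtain j where j: "q' $ j \<noteq> 0" using q(4) by (auto simp: vec_eq_iff)
    define \<mu> where "\<mu> = q $ j / q' $ j"
    have \<mu>: "q $ i = \<mu> * q' $ i" for i using dep[rule_format, of i j] j unfolding \<mu>_def by (simp add: nonzero_eq_divide_eq)
    have "q $ j \<noteq> 0"
    proof
      assume "q $ j = 0"
      then have "\<mu> = 0" by (simp add: \<mu>_def)
      then have "q $ i = 0" for i using \<mu>[of i] by simp
      then have "q = 0" by (simp add: vec_eq_iff)
      then show False using q(3) by simp
    qed
    moreover have "q $ j \<in> \<O>" "q' $ j \<in> \<O>" using q by (simp_all add: vec_set_iff)
    ultimately obtain a b where ab: "a \<in> \<O> - {0}" "b \<in> \<O> - {0}" "a * q' $ j = q $ j * b"
      "\<forall>x\<in>\<O> - {0}. \<mu> * x \<in> \<O> \<longrightarrow> cmod b \<le> cmod x"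
      "\<forall>z. \<exists>u\<in>\<O>. \<exists>v\<in>\<O>. cmod (z + u + \<mu> * v) \<le> C / cmod b"
      using C(2)[of "q $ j" "q' $ j"] j unfolding \<mu>_def by blast
    have \<mu>_ab: "\<mu> = a / b" using ab(2,3) j by (simp add: \<mu>_def field_simps)
    have "sup_cmod q = cmod \<mu> * sup_cmod q'" by (rule sup_cmod_mult) (rule \<mu>)
    moreover have "sup_cmod q' > 0" using q(4) sup_cmod_eq_0_iff[of q'] sup_cmod_nonneg[of q'] by linarith
    ultimately have "cmod \<mu> \<le> 1" using le by simp
    then have "cmod a \<le> cmod b" using ab(2) by (simp add: \<mu>_ab norm_divide)
    then have "slope_of a b q q'" unfolding slope_of_def using ab(1,2,4) \<mu> unfolding \<mu>_ab by blast
    then show "\<exists>a b. slope_of a b q q' \<and> (\<forall>z. \<exists>u\<in>\<O>. \<exists>w\<in>\<O>. cmod (z + u + a / b * w) \<le> C / cmod b)"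
      using ab(5) unfolding \<mu>_ab by blast
  qed
qed

text \<open>How the excess depends on the ratio a/b: the bound |a|^(-2/mm) for the radius to the
  power mm - 1, times the covering radius of order 1/|b|.\<close>

definition weight :: "complex \<times> complex \<Rightarrow> real" where
  "weight = (\<lambda>(a, b). cmod a powr - (2 * (real mm - 1) / real mm) * cmod b powr - 1)"

text \<open>By \<open>rate_le_W\<close>, G at q is at most \<Omega>^mm divided by
  \<open>sup_cmod q ^ nn\<close>; that divisor is at least |a|^2 because q is at least as large as a
  and nn \<ge> 2.\<close>

lemma radius_bound:
  fixes q q' :: "complex ^ 'n" and \<Omega> :: real
  assumes q: "q \<in> points T" "q' \<in> points T" and slope: "slope_of a b q q'"
    and \<Omega>: "\<Omega> \<ge> 1" "W T = c\<^sub>n * \<Omega> ^ mm"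
  shows "radius q \<le> \<Omega> * cmod a powr - (2 / real mm)"
proof -
  let ?A = "cmod a powr - (2 / real mm)"
  have a: "cmod a \<ge> 1" using slope cmod_ge_1 by (auto simp: slope_of_def)
  have "?A ^ mm = cmod a powr (- (2 / real mm) * real mm)" using a by (subst powr_power) auto
  also have "- (2 / real mm) * real mm = - 2" using mm_pos by simp
  also have "cmod a powr - 2 = 1 / (cmod a)\<^sup>2" using a by (simp add: powr_minus_divide)
  finally have A: "?A ^ mm = 1 / (cmod a)\<^sup>2" .
  have aq: "cmod a \<le> sup_cmod q" using slope_of_large(2)[OF slope] points_integral q by blast
  have "(cmod a)\<^sup>2 \<le> cmod a ^ nn" using a by (intro power_increasing) (simp_all add: nn)
  also have "\<dots> \<le> sup_cmod q ^ nn" using aq by (intro power_mono) auto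
  finally have aq2: "(cmod a)\<^sup>2 \<le> sup_cmod q ^ nn" .
  have "c\<^sub>n * (sup_cmod q ^ nn * G T q) \<le> c\<^sub>n * \<Omega> ^ mm"
    using rate_le_W[OF sup_cmod_nonneg, of q T] \<Omega>(2) by (simp add: G_def mult.assoc)
  then have "sup_cmod q ^ nn * G T q \<le> \<Omega> ^ mm" using c\<^sub>n_pos by simp
  moreover have "(cmod a)\<^sup>2 * G T q \<le> sup_cmod q ^ nn * G T q"
    using aq2 G_nonneg by (intro mult_right_mono) auto
  ultimately have "G T q * (cmod a)\<^sup>2 \<le> \<Omega> ^ mm" by (simp add: mult.commute)
  then have "G T q \<le> \<Omega> ^ mm / (cmod a)\<^sup>2" using a by (subst pos_le_divide_eq) auto
  then have "radius q ^ mm \<le> (\<Omega> * ?A) ^ mm" by (simp add: radius_pow(1)[OF q(1)] power_mult_distrib A)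
  then show ?thesis using radius_pow(2)[OF q(1)] \<Omega>(1) mm_pos by (subst (asm) power_mono_iff) auto
qed

text \<open>The difference of mm-th powers is linear in the increment of the radius. In the
  remaining factor the increment is of no larger order than the radius bound, since 1/|b| \<le>
  1/|a| \<le> |a|^(-2/mm).\<close>

lemma excess_bound:
  fixes q q' :: "complex ^ 'n" and \<Omega> C :: real
  assumes q: "q \<in> points T" "q' \<in> points T" and slope: "slope_of a b q q'"
    and \<Omega>: "\<Omega> \<ge> 1" "W T = c\<^sub>n * \<Omega> ^ mm" and C: "C > 0"
  shows "(radius q + N * (C / cmod b)) ^ mm
    \<le> G T q + mm * (N * C) * (1 + N * C) ^ (mm - 1) * \<Omega> ^ (mm - 1) * weight (a, b)"
proof -
  let ?A = "cmod a powr - (2 / real mm)" and ?x = "radius q + N * (C / cmod b)"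
  have a: "cmod a \<ge> 1" and ab: "cmod a \<le> cmod b" using slope cmod_ge_1 by (auto simp: slope_of_def)
  have b: "cmod b \<ge> 1" using a ab by simp
  have r: "radius q \<ge> 0" by (rule radius_pow(2)[OF q(1)])
  have "2 / real mm \<le> 1" using mm_pos by (simp add: mm)
  then have "cmod a powr - 1 \<le> ?A" using a by (intro powr_mono) auto
  then have "1 / cmod a \<le> 1 * ?A" using a by (simp add: powr_minus_divide)
  also have "\<dots> \<le> \<Omega> * ?A" using \<Omega>(1) by (intro mult_right_mono) auto
  finally have "1 / cmod a \<le> \<Omega> * ?A" .
  moreover have "1 / cmod b \<le> 1 / cmod a" using a ab b by (intro divide_left_mono mult_pos_pos) auto
  ultimately have "N * C * (1 / cmod b) \<le> N * C * (\<Omega> * ?A)"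
    using C by (intro mult_left_mono) auto
  then have x: "?x \<le> (1 + N * C) * \<Omega> * ?A"
    using radius_bound[OF q slope \<Omega>] by (simp add: algebra_simps)
  have x0: "radius q \<le> ?x" "?x \<ge> 0" using r C by (simp_all add: add_nonneg_nonneg)
  have pw: "?A ^ (mm - 1) = cmod a powr - (2 * (real mm - 1) / real mm)"
  proof -
    have "?A ^ (mm - 1) = cmod a powr (real (mm - 1) * - (2 / real mm))" using a by (subst powr_power) auto
    also have "real (mm - 1) = real mm - 1" using mm_pos by (simp add: of_nat_diff)
    also have "(real mm - 1) * - (2 / real mm) = - (2 * (real mm - 1) / real mm)" by simp
    finally show ?thesis .
  qed
  have "?x ^ mm - radius q ^ mm \<le> mm * (?x - radius q) * ?x ^ (mm - 1)"
    using r x0 by (intro power_diff_le) auto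
  also have "\<dots> \<le> mm * (N * C * (1 / cmod b)) * ((1 + N * C) * \<Omega> * ?A) ^ (mm - 1)"
    using x x0 C by (intro mult_mono power_mono) auto
  also have "\<dots> = mm * (N * C) * (1 + N * C) ^ (mm - 1) * \<Omega> ^ (mm - 1) * weight (a, b)"
  proof -
    have "weight (a, b) = ?A ^ (mm - 1) * (1 / cmod b)"
      unfolding pw weight_def using b by (simp add: powr_minus_divide)
    then show ?thesis by (simp only: power_mult_distrib mult_ac)
  qed
  finally show ?thesis by (simp add: radius_pow(1)[OF q(1)])
qed

text \<open>Group the pairs by ratio. Spacing saves |b|^nn within a group, after which
  \<open>exponent_bound\<close> dominates the weights by a product of two convergent sums over
  non-zero integers.\<close>

lemma sum_weight:
  obtains K where "K > 0" "\<And>T P ab. finite P \<Longrightarrow> P \<subseteq> points T \<times> points T \<Longrightarrow>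
    \<forall>x\<in>P. slope_of (fst (ab x)) (snd (ab x)) (fst x) (snd x) \<Longrightarrow>
    (\<Sum>x\<in>P. G T (snd x) * weight (ab x)) \<le> K * W T"
proof -
  obtain Z where Z: "Z > 0" "\<And>A. finite A \<Longrightarrow> A \<subseteq> \<O> - {0} \<Longrightarrow> (\<Sum>a\<in>A. cmod a powr - (9 / 4)) \<le> Z"
    by (rule sum_cmod_powr_bounded[OF that])
  define K where "K = 5 ^ nn / c\<^sub>n * Z\<^sup>2"
  show ?thesis
  proof (rule that[of K])
    show "K > 0" using Z c\<^sub>n_pos by (simp add: K_def)
    fix T and P :: "((complex ^ 'n) \<times> (complex ^ 'n)) set" and ab
    assume fin: "finite P" and P: "P \<subseteq> points T \<times> points T"
      and slope: "\<forall>x\<in>P. slope_of (fst (ab x)) (snd (ab x)) (fst x) (snd x)"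
    let ?h = "\<lambda>c :: complex \<times> complex. cmod (fst c) powr - (9 / 4) * cmod (snd c) powr - (9 / 4)"
    have inner: "(\<Sum>x\<in>{x \<in> P. ab x = c}. G T (snd x) * weight (ab x)) \<le> W T * 5 ^ nn / c\<^sub>n * ?h c"
      if c: "c \<in> ab ` P" for c
    proof -
      obtain a b where ab_c: "c = (a, b)" by (cases c)
      let ?Q = "{x \<in> P. ab x = c}"
      have sl: "slope_of a b (fst x) (snd x)" if "x \<in> ?Q" for x
        using slope that by (auto simp: ab_c)
      \<comment> \<open>For a fixed ratio the second vector determines the first, so a double sum
        becomes a single one.\<close>
      have inj: "inj_on snd ?Q"
      proof (rule inj_onI)
        fix x y assume xy: "x \<in> ?Q" "y \<in> ?Q" "snd x = snd y"
        then have "fst x = fst y" using sl[OF xy(1)] sl[OF xy(2)] by (simp add: slope_of_def vec_eq_iff)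
        then show "x = y" using xy(3) by (simp add: prod_eq_iff)
      qed
      obtain x0 where x0: "x0 \<in> ?Q" using c by blast
      have "cmod a \<ge> 1" "cmod b \<ge> 1" "cmod a \<le> cmod b"
        using sl[OF x0] cmod_ge_1 by (auto simp: slope_of_def)
      have "(\<Sum>x\<in>?Q. G T (snd x) * weight (ab x)) = (\<Sum>x\<in>?Q. G T (snd x)) * weight c"
        by (simp add: sum_distrib_right)
      also have "(\<Sum>x\<in>?Q. G T (snd x)) = (\<Sum>q'\<in>snd ` ?Q. G T q')"
        by (simp add: sum.reindex[OF inj])
      also have "\<dots> * weight c \<le> W T * 5 ^ nn / (c\<^sub>n * cmod b ^ nn) * weight c"
      proof (intro mult_right_mono sum_slope)
        show "snd ` ?Q \<subseteq> points T" using P by auto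
        show "\<exists>q\<in>points T. slope_of a b q q'" if q': "q' \<in> snd ` ?Q" for q'
        proof -
          obtain x where x: "x \<in> ?Q" "q' = snd x" using q' by blast
          then have "fst x \<in> points T" using P by auto
          then show ?thesis using sl[OF x(1)] x(2) by blast
        qed
        show "snd ` ?Q \<noteq> {}" using x0 by blast
        show "weight c \<ge> 0" by (simp add: weight_def ab_c)
      qed
      also have "\<dots> = W T * 5 ^ nn / c\<^sub>n * (cmod a powr - (2 * (real mm - 1) / real mm) * cmod b powr - (real nn + 1))"
      proof -
        have "cmod b powr - (real nn + 1) = cmod b powr - real nn * cmod b powr - 1"
          by (subst powr_add[symmetric], rule arg_cong[where f = "(powr) (cmod b)"]) simp
        also have "cmod b powr - real nn = 1 / cmod b ^ nn"
          using powr_realpow[OF less_le_trans[OF zero_less_one \<open>cmod b \<ge> 1\<close>]] by (simp add: powr_minus_divide)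
        finally show ?thesis by (simp add: weight_def ab_c)
      qed
      also have "\<dots> \<le> W T * 5 ^ nn / c\<^sub>n * ?h c"
        using exponent_bound[OF \<open>cmod a \<ge> 1\<close> \<open>cmod a \<le> cmod b\<close>] W_nonneg[of T] c\<^sub>n_pos
        by (intro mult_left_mono) (auto simp: ab_c)
      finally show ?thesis .
    qed
    have sub: "fst ` ab ` P \<subseteq> \<O> - {0}" "snd ` ab ` P \<subseteq> \<O> - {0}"
      using slope by (auto simp: slope_of_def)
    have "(\<Sum>c\<in>ab ` P. ?h c) \<le> (\<Sum>c\<in>fst ` ab ` P \<times> snd ` ab ` P. ?h c)"
      by (rule sum_mono2) (use fin subset_fst_snd[of "ab ` P"] in auto)
    also have "\<dots> = (\<Sum>a\<in>fst ` ab ` P. cmod a powr - (9 / 4)) * (\<Sum>b\<in>snd ` ab ` P. cmod b powr - (9 / 4))"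
      by (simp add: sum_product sum.cartesian_product case_prod_beta)
    also have "\<dots> \<le> Z * Z"
      by (intro mult_mono Z(2) sub sum_nonneg) (use fin Z(1) in auto)
    finally have h: "(\<Sum>c\<in>ab ` P. ?h c) \<le> Z * Z" .
    have "(\<Sum>x\<in>P. G T (snd x) * weight (ab x)) = (\<Sum>c\<in>ab ` P. \<Sum>x\<in>{x \<in> P. ab x = c}. G T (snd x) * weight (ab x))"
      by (rule sum.image_gen[OF fin])
    also have "\<dots> \<le> (\<Sum>c\<in>ab ` P. W T * 5 ^ nn / c\<^sub>n * ?h c)" by (intro sum_mono inner)
    also have "\<dots> = W T * 5 ^ nn / c\<^sub>n * (\<Sum>c\<in>ab ` P. ?h c)" by (simp add: sum_distrib_left)
    also have "\<dots> \<le> W T * 5 ^ nn / c\<^sub>n * (Z * Z)"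
      using h W_nonneg[of T] c\<^sub>n_pos by (intro mult_left_mono) auto
    finally show "(\<Sum>x\<in>P. G T (snd x) * weight (ab x)) \<le> K * W T"
      by (simp add: K_def power2_eq_square mult_ac)
  qed
qed

section \<open>Moments of the counting function\<close>

definition cnt :: "real \<Rightarrow> complex ^ 'n ^ 'm \<Rightarrow> real" where
  "cnt T \<theta> = (\<Sum>q\<in>points T. hit q \<theta>)"

lemma cnt_nonneg: "cnt T \<theta> \<ge> 0"
  by (simp add: cnt_def sum_nonneg hit_nonneg)

lemma cnt_measurable [measurable]: "cnt T \<in> borel_measurable borel"
  unfolding cnt_def by measurable

lemma S_nonneg: "S T \<ge> 0"
  by (simp add: S_def sum_nonneg G_nonneg)

lemma cnt_mean: "(\<integral>\<^sup>+\<theta>\<in>mat_cell. ennreal (cnt T \<theta>) \<partial>lborel) = ennreal (dens * S T * M)"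
proof -
  have "(\<integral>\<^sup>+\<theta>\<in>mat_cell. ennreal (cnt T \<theta>) \<partial>lborel)
      = (\<integral>\<^sup>+\<theta>. (\<Sum>q\<in>points T. ennreal (hit q \<theta>) * indicator mat_cell \<theta>) \<partial>lborel)"
    unfolding cnt_def by (intro nn_integral_cong) (simp add: hit_nonneg sum_distrib_right flip: sum_ennreal)
  also have "\<dots> = (\<Sum>q\<in>points T. \<integral>\<^sup>+\<theta>\<in>mat_cell. ennreal (hit q \<theta>) \<partial>lborel)"
    by (rule nn_integral_sum) measurable
  also have "\<dots> = (\<Sum>q\<in>points T. ennreal (dens * G T q * M))"
    by (intro sum.cong refl hit_mean)
  also have "\<dots> = ennreal (\<Sum>q\<in>points T. dens * G T q * M)"
    using dens_pos G_nonneg mat.vol_pos by (intro sum_ennreal) simp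
  finally show ?thesis by (simp add: S_def sum_distrib_left sum_distrib_right)
qed

text \<open>In the expanded square, independent pairs contribute the product of their means, which
  add up to the leading term. Proportional pairs contribute in addition their excess, estimated with
  the smaller vector in first position.\<close>

lemma second_moment:
  obtains K where "K > 0" "\<And>T \<Omega>. \<Omega> \<ge> 1 \<Longrightarrow> W T = c\<^sub>n * \<Omega> ^ mm \<Longrightarrow>
    (\<integral>\<^sup>+\<theta>\<in>mat_cell. ennreal ((cnt T \<theta>)\<^sup>2) \<partial>lborel)
      \<le> ennreal ((dens * S T)\<^sup>2 * M + K * \<Omega> ^ (2 * mm - 1))"
proof -
  obtain C where C: "C > 0" "\<And>q q' :: complex ^ 'n. q \<in> vec_set \<O> - {0} \<Longrightarrow> q' \<in> vec_set \<O> - {0} \<Longrightarrow>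
    sup_cmod q \<le> sup_cmod q' \<Longrightarrow> \<forall>i j. q $ i * q' $ j = q $ j * q' $ i \<Longrightarrow>
    \<exists>a b. slope_of a b q q' \<and> (\<forall>z. \<exists>u\<in>\<O>. \<exists>w\<in>\<O>. cmod (z + u + a / b * w) \<le> C / cmod b)"
    using slope_exists by meson
  obtain Z where Z: "Z > 0" "\<And>T P ab. finite P \<Longrightarrow> P \<subseteq> points T \<times> points T \<Longrightarrow>
    \<forall>x\<in>P. slope_of (fst (ab x)) (snd (ab x)) (fst x) (snd x) \<Longrightarrow>
    (\<Sum>x\<in>P. G T (snd x) * weight (ab x)) \<le> Z * W T"
    by (rule sum_weight[OF that])
  define k where "k = mm * (N * C) * (1 + N * C) ^ (mm - 1)"
  have k: "k > 0" using C(1) N_pos mm_pos by (simp add: k_def add_pos_pos)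
  \<comment> \<open>The 2 accounts for the two orders of a pair, \<open>k\<close> for
    \<open>excess_bound\<close>, \<open>Z\<close> for \<open>sum_weight\<close>, and
    \<open>c\<^sub>n\<close> for the relation between \<open>W\<close> and \<Omega>.\<close>
  define K where "K = 2 * dens\<^sup>2 * M * k * Z * c\<^sub>n"
  note M_pos = mat.vol_pos
  show ?thesis
  proof (rule that[of K])
    show "K > 0" using dens_pos M_pos k Z(1) c\<^sub>n_pos by (simp add: K_def)
    fix T \<Omega> assume \<Omega>: "\<Omega> \<ge> (1 :: real)" "W T = c\<^sub>n * \<Omega> ^ mm"
    \<comment> \<open>This contains the diagonal, whose ratio is 1.\<close>
    define D where "D = {x \<in> points T \<times> points T. (\<forall>i j. fst x $ i * snd x $ j = fst x $ j * snd x $ i) \<and>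
      sup_cmod (fst x) \<le> sup_cmod (snd x)}"
    have finD: "finite D" and D_sub: "D \<subseteq> points T \<times> points T" by (auto simp: D_def finite_points)
    have "\<exists>c. slope_of (fst c) (snd c) (fst x) (snd x) \<and>
        (\<forall>z. \<exists>u\<in>\<O>. \<exists>w\<in>\<O>. cmod (z + u + fst c / snd c * w) \<le> C / cmod (snd c))" if x: "x \<in> D" for x
    proof -
      have pts: "fst x \<in> points T" "snd x \<in> points T" using x by (auto simp: D_def)
      have "\<exists>a b. slope_of a b (fst x) (snd x) \<and> (\<forall>z. \<exists>u\<in>\<O>. \<exists>w\<in>\<O>. cmod (z + u + a / b * w) \<le> C / cmod b)"
        using x points_integral[OF pts(1)] points_integral[OF pts(2)] by (intro C(2)) (auto simp: D_def)
      then show ?thesis by simp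
    qed
    then obtain ab where ab: "\<And>x. x \<in> D \<Longrightarrow> slope_of (fst (ab x)) (snd (ab x)) (fst x) (snd x)"
      "\<And>x. x \<in> D \<Longrightarrow> (\<forall>z. \<exists>u\<in>\<O>. \<exists>w\<in>\<O>. cmod (z + u + fst (ab x) / snd (ab x) * w) \<le> C / cmod (snd (ab x)))"
      by metis
    \<comment> \<open>An upper bound for the excess, zero off \<open>D\<close>. Every pair is
      charged \<open>E\<close> of itself and of its swap; pairs of equal size are charged twice,
      which an upper bound tolerates.\<close>
    define E where "E x = (if x \<in> D then dens\<^sup>2 * M * (k * \<Omega> ^ (mm - 1) * (G T (snd x) * weight (ab x))) else 0)" for x
    have w0: "weight c \<ge> 0" for c by (simp add: weight_def case_prod_beta)
    have E0: "E x \<ge> 0" for x using M_pos k \<Omega>(1) G_nonneg w0 by (simp add: E_def)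
    let ?I = "\<lambda>x. \<integral>\<^sup>+\<theta>\<in>mat_cell. ennreal (hit (fst x) \<theta>) * ennreal (hit (snd x) \<theta>) \<partial>lborel"
    have dep: "?I x \<le> ennreal (dens\<^sup>2 * G T (fst x) * G T (snd x) * M + E x)" if x: "x \<in> D" for x
    proof -
      have pts: "fst x \<in> points T" "snd x \<in> points T" using x by (auto simp: D_def)
      have sl: "slope_of (fst (ab x)) (snd (ab x)) (fst x) (snd x)" by (rule ab(1)[OF x])
      have "?I x \<le> ennreal (dens\<^sup>2 * (radius (fst x) + N * (C / cmod (snd (ab x)))) ^ mm * G T (snd x) * M)"
      proof (rule hit_dependent[OF pts])
        show "fst x $ i = fst (ab x) / snd (ab x) * snd x $ i" for i using sl by (simp add: slope_of_def)
        show "\<exists>u\<in>\<O>. \<exists>w\<in>\<O>. cmod (z + u + fst (ab x) / snd (ab x) * w) \<le> C / cmod (snd (ab x))" for z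
          using ab(2)[OF x] by blast
        show "C / cmod (snd (ab x)) \<ge> 0" using C(1) by simp
      qed
      also have "\<dots> \<le> ennreal (dens\<^sup>2 * (G T (fst x) + k * \<Omega> ^ (mm - 1) * weight (ab x)) * G T (snd x) * M)"
        using excess_bound[OF pts sl \<Omega> C(1)] G_nonneg M_pos
        by (intro ennreal_leI mult_right_mono mult_left_mono) (auto simp: k_def)
      also have "dens\<^sup>2 * (G T (fst x) + k * \<Omega> ^ (mm - 1) * weight (ab x)) * G T (snd x) * M
          = dens\<^sup>2 * G T (fst x) * G T (snd x) * M + E x" using x by (simp add: E_def algebra_simps)
      finally show ?thesis .
    qed
    have pair: "?I x \<le> ennreal (dens\<^sup>2 * G T (fst x) * G T (snd x) * M + (E x + E (prod.swap x)))"
      if x: "x \<in> points T \<times> points T" for x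
    proof (cases "\<forall>i j. fst x $ i * snd x $ j = fst x $ j * snd x $ i")
      case False
      then obtain i j where "fst x $ i * snd x $ j \<noteq> fst x $ j * snd x $ i" by blast
      then have "?I x \<le> ennreal (dens\<^sup>2 * G T (fst x) * G T (snd x) * M)"
        using x by (intro hit_independent) auto
      also have "\<dots> \<le> ennreal (dens\<^sup>2 * G T (fst x) * G T (snd x) * M + (E x + E (prod.swap x)))"
        using E0[of x] E0[of "prod.swap x"] by (intro ennreal_leI) simp
      finally show ?thesis .
    next
      case True
      show ?thesis
      proof (cases "sup_cmod (fst x) \<le> sup_cmod (snd x)")
        case le: True
        then have "x \<in> D" using True x by (auto simp: D_def)
        from dep[OF this] show ?thesis
          by (rule order_trans) (use E0[of "prod.swap x"] in \<open>intro ennreal_leI; simp\<close>)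
      next
        case False
        have "snd x $ i * fst x $ j = snd x $ j * fst x $ i" for i j
          using True[rule_format, of j i] by (simp add: mult.commute)
        then have "prod.swap x \<in> D" using False x by (auto simp: D_def)
        from dep[OF this] have "?I x \<le> ennreal (dens\<^sup>2 * G T (fst x) * G T (snd x) * M + E (prod.swap x))"
          by (simp add: mult_ac)
        then show ?thesis
          by (rule order_trans) (use E0[of x] in \<open>intro ennreal_leI; simp\<close>)
      qed
    qed
    let ?PP = "points T \<times> points T"
    have finPP: "finite ?PP" by (simp add: finite_points)
    have EE: "(\<Sum>x\<in>?PP. E (prod.swap x)) = (\<Sum>x\<in>?PP. E x)"
      by (rule sum.reindex_bij_witness[of _ prod.swap prod.swap]) auto
    have "(\<Sum>x\<in>?PP. E x) = (\<Sum>x\<in>D. dens\<^sup>2 * M * (k * \<Omega> ^ (mm - 1) * (G T (snd x) * weight (ab x))))"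
      unfolding E_def using finPP D_sub by (subst sum.inter_restrict[symmetric]) (auto simp: Int_absorb1)
    also have "\<dots> = dens\<^sup>2 * M * (k * \<Omega> ^ (mm - 1) * (\<Sum>x\<in>D. G T (snd x) * weight (ab x)))"
      by (simp add: sum_distrib_left)
    also have "\<dots> \<le> dens\<^sup>2 * M * (k * \<Omega> ^ (mm - 1) * (Z * W T))"
      using Z(2)[OF finD D_sub, of ab] ab(1) k \<Omega>(1) M_pos by (intro mult_left_mono) auto
    finally have E_sum: "(\<Sum>x\<in>?PP. E x) \<le> dens\<^sup>2 * M * (k * \<Omega> ^ (mm - 1) * (Z * W T))" .
    \<comment> \<open>One factor \<Omega>^(mm-1) comes from the excess, the factor \<Omega>^mm from
      \<open>W\<close>: one power of \<Omega> is saved against the square of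
      \<open>W\<close>.\<close>
    have pw: "\<Omega> ^ (mm - 1) * \<Omega> ^ mm = \<Omega> ^ (2 * mm - 1)" using mm_pos by (simp add: mult_2 flip: power_add)
    have "(\<integral>\<^sup>+\<theta>\<in>mat_cell. ennreal ((cnt T \<theta>)\<^sup>2) \<partial>lborel)
        = (\<integral>\<^sup>+\<theta>. (\<Sum>x\<in>?PP. ennreal (hit (fst x) \<theta>) * ennreal (hit (snd x) \<theta>) * indicator mat_cell \<theta>) \<partial>lborel)"
    proof (rule nn_integral_cong)
      fix \<theta>
      have "(cnt T \<theta>)\<^sup>2 = (\<Sum>x\<in>?PP. hit (fst x) \<theta> * hit (snd x) \<theta>)"
        by (simp add: cnt_def power2_eq_square sum_product sum.cartesian_product case_prod_beta)
      then have "ennreal ((cnt T \<theta>)\<^sup>2) = (\<Sum>x\<in>?PP. ennreal (hit (fst x) \<theta>) * ennreal (hit (snd x) \<theta>))"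
        by (simp add: hit_nonneg flip: sum_ennreal ennreal_mult)
      then show "ennreal ((cnt T \<theta>)\<^sup>2) * indicator mat_cell \<theta>
        = (\<Sum>x\<in>?PP. ennreal (hit (fst x) \<theta>) * ennreal (hit (snd x) \<theta>) * indicator mat_cell \<theta>)"
        by (simp add: sum_distrib_right)
    qed
    also have "\<dots> = (\<Sum>x\<in>?PP. ?I x)" by (rule nn_integral_sum) measurable
    also have "\<dots> \<le> (\<Sum>x\<in>?PP. ennreal (dens\<^sup>2 * G T (fst x) * G T (snd x) * M + (E x + E (prod.swap x))))"
      by (intro sum_mono pair)
    also have "\<dots> = ennreal (\<Sum>x\<in>?PP. dens\<^sup>2 * G T (fst x) * G T (snd x) * M + (E x + E (prod.swap x)))"
      using E0 G_nonneg M_pos by (intro sum_ennreal) simp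
    also have "(\<Sum>x\<in>?PP. dens\<^sup>2 * G T (fst x) * G T (snd x) * M + (E x + E (prod.swap x)))
        = dens\<^sup>2 * M * (\<Sum>x\<in>?PP. G T (fst x) * G T (snd x)) + 2 * (\<Sum>x\<in>?PP. E x)"
      by (simp add: sum.distrib EE sum_distrib_left mult_ac)
    also have "(\<Sum>x\<in>?PP. G T (fst x) * G T (snd x)) = (S T)\<^sup>2"
      by (simp add: S_def power2_eq_square sum_product sum.cartesian_product case_prod_beta)
    also have "ennreal (dens\<^sup>2 * M * (S T)\<^sup>2 + 2 * (\<Sum>x\<in>?PP. E x))
        \<le> ennreal ((dens * S T)\<^sup>2 * M + K * \<Omega> ^ (2 * mm - 1))"
    proof (rule ennreal_leI)
      have "2 * (dens\<^sup>2 * M * (k * \<Omega> ^ (mm - 1) * (Z * W T))) = K * \<Omega> ^ (2 * mm - 1)"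
        unfolding \<Omega>(2) K_def pw[symmetric] by (simp add: mult_ac)
      then show "dens\<^sup>2 * M * (S T)\<^sup>2 + 2 * (\<Sum>x\<in>?PP. E x) \<le> (dens * S T)\<^sup>2 * M + K * \<Omega> ^ (2 * mm - 1)"
        using E_sum by (simp add: power_mult_distrib mult_ac)
    qed
    finally show "(\<integral>\<^sup>+\<theta>\<in>mat_cell. ennreal ((cnt T \<theta>)\<^sup>2) \<partial>lborel)
      \<le> ennreal ((dens * S T)\<^sup>2 * M + K * \<Omega> ^ (2 * mm - 1))" .
  qed
qed

lemma variance:
  obtains K where "K > 0" "\<And>T \<Omega>. \<Omega> \<ge> 1 \<Longrightarrow> W T = c\<^sub>n * \<Omega> ^ mm \<Longrightarrow>
    (\<integral>\<^sup>+\<theta>\<in>mat_cell. ennreal ((cnt T \<theta> - dens * S T)\<^sup>2) \<partial>lborel) \<le> ennreal (K * \<Omega> ^ (2 * mm - 1))"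
proof -
  obtain K where K: "K > 0" "\<And>T \<Omega>. \<Omega> \<ge> 1 \<Longrightarrow> W T = c\<^sub>n * \<Omega> ^ mm \<Longrightarrow>
    (\<integral>\<^sup>+\<theta>\<in>mat_cell. ennreal ((cnt T \<theta>)\<^sup>2) \<partial>lborel)
      \<le> ennreal ((dens * S T)\<^sup>2 * M + K * \<Omega> ^ (2 * mm - 1))"
    by (rule second_moment[OF that])
  show ?thesis
  proof (rule that[OF K(1)])
    fix T \<Omega> assume \<Omega>: "\<Omega> \<ge> (1 :: real)" "W T = c\<^sub>n * \<Omega> ^ mm"
    let ?e = "dens * S T"
    have e: "?e \<ge> 0" using dens_pos S_nonneg by simp
    have M_pos: "M > 0" by (rule mat.vol_pos)
    have R: "K * \<Omega> ^ (2 * mm - 1) \<ge> 0" using K(1) \<Omega>(1) by simp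
    let ?V = "\<integral>\<^sup>+\<theta>\<in>mat_cell. ennreal ((cnt T \<theta> - ?e)\<^sup>2) \<partial>lborel"
    \<comment> \<open>Subtraction in \<open>ennreal\<close> is avoided: the identity (x - e)^2 + 2 e
      x = x^2 + e^2 is integrated, and the common finite term is cancelled at the end.\<close>
    have "?V + ennreal (2 * ?e\<^sup>2 * M) = ?V + ennreal (2 * ?e) * (\<integral>\<^sup>+\<theta>\<in>mat_cell. ennreal (cnt T \<theta>) \<partial>lborel)"
      unfolding cnt_mean using e M_pos by (simp add: power2_eq_square mult_ac flip: ennreal_mult)
    also have "\<dots> = (\<integral>\<^sup>+\<theta>. ennreal ((cnt T \<theta> - ?e)\<^sup>2) * indicator mat_cell \<theta> + ennreal (2 * ?e) * (ennreal (cnt T \<theta>) * indicator mat_cell \<theta>) \<partial>lborel)"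
      by (subst nn_integral_add) (simp_all add: nn_integral_cmult)
    also have "\<dots> = (\<integral>\<^sup>+\<theta>. ennreal ((cnt T \<theta>)\<^sup>2) * indicator mat_cell \<theta> + ennreal (?e\<^sup>2) * indicator mat_cell \<theta> \<partial>lborel)"
    proof (rule nn_integral_cong)
      fix \<theta>
      have "(cnt T \<theta> - ?e)\<^sup>2 + 2 * ?e * cnt T \<theta> = (cnt T \<theta>)\<^sup>2 + ?e\<^sup>2" by (simp add: power2_diff)
      then have "ennreal ((cnt T \<theta> - ?e)\<^sup>2) + ennreal (2 * ?e) * ennreal (cnt T \<theta>) = ennreal ((cnt T \<theta>)\<^sup>2) + ennreal (?e\<^sup>2)"
        using e cnt_nonneg[of T \<theta>] by (simp flip: ennreal_plus ennreal_mult)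
      then show "ennreal ((cnt T \<theta> - ?e)\<^sup>2) * indicator mat_cell \<theta> + ennreal (2 * ?e) * (ennreal (cnt T \<theta>) * indicator mat_cell \<theta>)
        = ennreal ((cnt T \<theta>)\<^sup>2) * indicator mat_cell \<theta> + ennreal (?e\<^sup>2) * indicator mat_cell \<theta>"
        by (simp add: distrib_right[symmetric] mult.assoc[symmetric])
    qed
    also have "\<dots> = (\<integral>\<^sup>+\<theta>\<in>mat_cell. ennreal ((cnt T \<theta>)\<^sup>2) \<partial>lborel) + ennreal (?e\<^sup>2 * M)"
      using M_pos by (subst nn_integral_add) (simp_all add: nn_integral_cmult_indicator mat.emeasure_F ennreal_mult)
    also have "\<dots> \<le> ennreal (?e\<^sup>2 * M + K * \<Omega> ^ (2 * mm - 1)) + ennreal (?e\<^sup>2 * M)"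
      by (intro add_right_mono K(2) \<Omega>)
    also have "\<dots> = ennreal (K * \<Omega> ^ (2 * mm - 1)) + ennreal (2 * ?e\<^sup>2 * M)"
      using R M_pos by (simp flip: ennreal_plus)
    finally show "?V \<le> ennreal (K * \<Omega> ^ (2 * mm - 1))"
      by (simp add: ennreal_add_left_cancel_le add.commute[of _ "ennreal (2 * ?e\<^sup>2 * M)"])
  qed
qed

end

section \<open>Almost sure convergence\<close>

text \<open>Monotonicity of \<open>f\<close> and \<open>W\<close> traps f t / W t between quotients
  along the sequence, and the ratio hypothesis makes both bounds tend to L.\<close>

lemma tendsto_of_sparse_sequence:
  fixes f W :: "real \<Rightarrow> real" and T w :: "nat \<Rightarrow> real"
  assumes f: "mono f" "\<And>t. f t \<ge> 0" and W: "mono W" and WT: "\<And>k. W (T k) = w k"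
    and w: "strict_mono w" "w 0 > 0" "filterlim w at_top sequentially"
    and ratio: "(\<lambda>k. w (Suc k) / w k) \<longlonglongrightarrow> 1" and lim: "(\<lambda>k. f (T k) / w k) \<longlonglongrightarrow> L"
    and Winf: "filterlim W at_top at_top"
  shows "((\<lambda>t. f t / W t) \<longlongrightarrow> L) at_top"
proof -
  have w_pos: "w k > 0" for k using w(2) strict_mono_leD[OF w(1), of 0 k] by simp
  define u where "u k = f (T k) / w k" for k
  \<comment> \<open>After cancellation, \<open>g k\<close> is f (T (k+2)) / w (k+1) and
    \<open>h k\<close> is f (T k) / w (k+2), the bounds for t with W t between w (k+1) and w
    (k+2).\<close>
  define g where "g k = u (Suc (Suc k)) * (w (Suc (Suc k)) / w (Suc k))" for k
  define h where "h k = u k / (w (Suc (Suc k)) / w (Suc k) * (w (Suc k) / w k))" for k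
  note u = lim[folded u_def]
  have "g \<longlonglongrightarrow> L * 1" unfolding g_def by (intro tendsto_mult LIMSEQ_Suc u ratio)
  moreover have "h \<longlonglongrightarrow> L / (1 * 1)" unfolding h_def
    by (intro tendsto_divide tendsto_mult LIMSEQ_Suc u ratio) simp
  ultimately have gh: "g \<longlonglongrightarrow> L" "h \<longlonglongrightarrow> L" by simp_all
  show ?thesis unfolding tendsto_iff
  proof (intro allI impI)
    fix e :: real assume e: "e > 0"
    obtain K where K: "\<And>k. k \<ge> K \<Longrightarrow> dist (g k) L < e \<and> dist (h k) L < e"
      using eventually_conj[OF tendstoD[OF gh(1) e] tendstoD[OF gh(2) e]]
      unfolding eventually_sequentially by blast
    have "\<forall>\<^sub>F t in at_top. W t \<ge> w (Suc (Suc K))" using Winf unfolding filterlim_at_top by blast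
    then show "\<forall>\<^sub>F t in at_top. dist (f t / W t) L < e"
    proof eventually_elim
      fix t assume t: "w (Suc (Suc K)) \<le> W t"
      obtain j0 where "w j0 > W t" using w(3) unfolding filterlim_at_top_dense eventually_sequentially by blast
      then have ex: "\<exists>j. w j > W t" by blast
      define j where "j = (LEAST j. w j > W t)"
      have j: "w j > W t" unfolding j_def using LeastI_ex[OF ex] .
      have "w (Suc (Suc K)) < w j" using t j by simp
      then have "Suc (Suc K) < j" using strict_mono_less[OF w(1)] by simp
      \<comment> \<open>Going back two steps instead of one gives w k < W t strictly, and hence T k
        < t although \<open>W\<close> is only weakly increasing.\<close>
      then obtain k where k: "j = Suc (Suc k)" "k \<ge> K" by (metis Suc_le_D Suc_le_lessD Suc_less_eq less_Suc_eq_le not_less_eq_eq less_imp_le)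
      have wk: "w (Suc k) \<le> W t"
        using not_less_Least[of "Suc k" "\<lambda>j. w j > W t"] k(1) j_def by (simp add: not_less)
      have "T k < t"
      proof (rule ccontr)
        assume "\<not> T k < t"
        then have "W t \<le> w k" using monoD[OF W, of t "T k"] by (simp add: WT)
        then show False using wk strict_monoD[OF w(1), of k "Suc k"] by simp
      qed
      then have lo: "f (T k) \<le> f t" using f(1) by (simp add: mono_def)
      have "t < T j"
      proof (rule ccontr)
        assume "\<not> t < T j"
        then have "w j \<le> W t" using monoD[OF W, of "T j" t] by (simp add: WT)
        then show False using j by simp
      qed
      then have up: "f t \<le> f (T j)" using f(1) by (simp add: mono_def)
      have Wt: "W t > 0" using wk w_pos[of "Suc k"] by simp
      have "f t / W t \<le> f (T j) / w (Suc k)"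
        using up wk f(2) w_pos by (intro frac_le) auto
      also have "\<dots> = g k" using w_pos[of "Suc (Suc k)"] by (simp add: g_def u_def k(1))
      finally have 1: "f t / W t \<le> g k" .
      have "h k = f (T k) / w j" using w_pos[of k] w_pos[of "Suc k"] by (simp add: h_def u_def k(1))
      also have "\<dots> \<le> f t / W t" using lo j f(2) Wt by (intro frac_le) auto
      finally have 2: "h k \<le> f t / W t" .
      show "dist (f t / W t) L < e" using K[OF k(2)] 1 2 by (simp add: dist_real_def abs_less_iff)
    qed
  qed
qed

context khintchine_groshev_dim
begin

lemma hit_invariant: "q \<in> points T \<Longrightarrow> l \<in> mat_lat \<Longrightarrow> hit q (\<theta> + l) = hit q \<theta>"
  using periodization_linear_form_periodic[of q l "indicator (polydisc (radius q))" "fst v" \<theta>]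
    points_integral[of q T]
  unfolding ennreal_hit[symmetric] by (simp add: hit_nonneg)

lemma cnt_invariant: "l \<in> mat_lat \<Longrightarrow> cnt T (\<theta> + l) = cnt T \<theta>"
  unfolding cnt_def by (intro sum.cong refl hit_invariant)

lemma cnt_mono: "mono (\<lambda>T. cnt T \<theta>)"
proof (rule monoI)
  fix s t :: real assume "s \<le> t"
  then show "cnt s \<theta> \<le> cnt t \<theta>"
    unfolding cnt_def by (intro sum_mono2 finite_points hit_nonneg) (auto simp: points_def)
qed

theorem cnt_asymptotic:
  "AE \<theta> in lborel. ((\<lambda>T. cnt T \<theta> / W T) \<longlongrightarrow> dens / \<kappa> ^ CARD('n)) at_top"
proof (rule mat.AE_of_AE_F)
  fix \<theta> l :: "complex ^ 'n ^ 'm"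
  assume "l \<in> mat_lat" "((\<lambda>T. cnt T (\<theta> + l) / W T) \<longlongrightarrow> dens / \<kappa> ^ CARD('n)) at_top"
  then show "((\<lambda>T. cnt T \<theta> / W T) \<longlongrightarrow> dens / \<kappa> ^ CARD('n)) at_top" by (simp add: cnt_invariant)
next
  obtain K where K: "K > 0" "\<And>T \<Omega>. \<Omega> \<ge> 1 \<Longrightarrow> W T = c\<^sub>n * \<Omega> ^ mm \<Longrightarrow>
    (\<integral>\<^sup>+\<theta>\<in>mat_cell. ennreal ((cnt T \<theta> - dens * S T)\<^sup>2) \<partial>lborel) \<le> ennreal (K * \<Omega> ^ (2 * mm - 1))"
    by (rule variance[OF that])
  \<comment> \<open>The offset lifts every target value above W 1, as \<open>W_surj\<close>
    demands.\<close>
  obtain k1 :: nat where k1: "real k1 > W 1 / c\<^sub>n" using reals_Archimedean2 by blast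
  define k0 where "k0 = Suc k1"
  \<comment> \<open>The square makes 1/\<Omega> summable, while polynomial growth keeps consecutive
    ratios tending to 1.\<close>
  define \<Omega> where "\<Omega> k = (real (k + k0))\<^sup>2" for k
  have \<Omega>1: "\<Omega> k \<ge> 1" for k by (simp add: \<Omega>_def k0_def)
  define w where "w k = c\<^sub>n * \<Omega> k ^ mm" for k
  have w_W1: "w k > W 1" for k
  proof -
    have "real k1 \<le> real (k + k0)" by (simp add: k0_def)
    also have "\<dots> \<le> \<Omega> k" unfolding \<Omega>_def by (rule self_le_power) (simp_all add: k0_def)
    also have "\<dots> \<le> \<Omega> k ^ mm" using \<Omega>1 mm_pos by (intro self_le_power)
    finally have "W 1 / c\<^sub>n < \<Omega> k ^ mm" using k1 by simp
    then show ?thesis using c\<^sub>n_pos by (simp add: w_def pos_divide_less_eq mult.commute)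
  qed
  have "\<exists>t. W t = w k" for k using W_surj[OF w_W1[of k]] by metis
  then obtain T where T: "\<And>k. W (T k) = w k" by metis
  have w_strict: "strict_mono w"
    unfolding strict_mono_Suc_iff w_def \<Omega>_def using c\<^sub>n_pos mm_pos
    by (auto intro!: mult_strict_left_mono power_strict_mono)
  have w_pos: "w k > 0" for k using w_W1[of k] W_nonneg[of 1] by simp
  have w_ge: "w k \<ge> c\<^sub>n * real k" for k
  proof -
    have "real k \<le> real (k + k0)" by simp
    also have "\<dots> \<le> \<Omega> k" unfolding \<Omega>_def by (rule self_le_power) (simp_all add: k0_def)
    also have "\<dots> \<le> \<Omega> k ^ mm" using \<Omega>1 mm_pos by (intro self_le_power)
    finally show ?thesis unfolding w_def using c\<^sub>n_pos by (intro mult_left_mono) auto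
  qed
  have w_inf: "filterlim w at_top sequentially"
  proof (rule filterlim_at_top_mono)
    show "filterlim (\<lambda>k. c\<^sub>n * real k) at_top sequentially"
      using c\<^sub>n_pos by (intro filterlim_tendsto_pos_mult_at_top[OF tendsto_const] filterlim_real_sequentially)
  qed (simp add: w_ge)
  have w_ratio: "(\<lambda>k. w (Suc k) / w k) \<longlonglongrightarrow> 1"
  proof -
    have "(\<lambda>k. (1 + 1 / real (k + k0)) ^ (2 * mm)) \<longlonglongrightarrow> (1 + 0) ^ (2 * mm)"
      by (intro tendsto_intros LIMSEQ_ignore_initial_segment[OF lim_1_over_n])
    moreover have "w (Suc k) / w k = (1 + 1 / real (k + k0)) ^ (2 * mm)" for k
    proof -
      have "w (Suc k) / w k = (real (Suc k + k0) / real (k + k0)) ^ (2 * mm)"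
        using c\<^sub>n_pos by (simp add: w_def \<Omega>_def power_divide power_mult)
      also have "real (Suc k + k0) / real (k + k0) = 1 + 1 / real (k + k0)"
        by (simp add: k0_def field_simps)
      finally show ?thesis .
    qed
    ultimately show ?thesis by simp
  qed
  have T_inf: "filterlim T at_top sequentially"
    unfolding filterlim_at_top
  proof
    fix Z
    have "\<forall>\<^sub>F k in sequentially. w k > W Z" using w_inf unfolding filterlim_at_top_dense by blast
    then show "\<forall>\<^sub>F k in sequentially. Z \<le> T k"
    proof eventually_elim
      fix k assume "W Z < w k"
      then show "Z \<le> T k" using W_mono[of "T k" Z] T[of k] by (cases "Z \<le> T k") auto
    qed
  qed
  \<comment> \<open>The squared deviation relative to the square of the scale;
    \<open>variance\<close> bounds its integral by a constant times 1/\<Omega>.\<close>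
  define y where "y k \<theta> = (cnt (T k) \<theta> - dens * S (T k))\<^sup>2 / (\<Omega> k ^ mm)\<^sup>2" for k \<theta>
  have y_int: "(\<integral>\<^sup>+\<theta>\<in>mat_cell. ennreal (y k \<theta>) \<partial>lborel) \<le> ennreal (K * (1 / \<Omega> k))" for k
  proof -
    have O: "\<Omega> k ^ mm > 0" using \<Omega>1[of k] by simp
    have "(\<integral>\<^sup>+\<theta>\<in>mat_cell. ennreal (y k \<theta>) \<partial>lborel)
      = (\<integral>\<^sup>+\<theta>. ennreal (1 / (\<Omega> k ^ mm)\<^sup>2) * (ennreal ((cnt (T k) \<theta> - dens * S (T k))\<^sup>2) * indicator mat_cell \<theta>) \<partial>lborel)"
      by (intro nn_integral_cong) (simp add: y_def mult.assoc[symmetric] flip: ennreal_mult)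
    also have "\<dots> = ennreal (1 / (\<Omega> k ^ mm)\<^sup>2) * (\<integral>\<^sup>+\<theta>\<in>mat_cell. ennreal ((cnt (T k) \<theta> - dens * S (T k))\<^sup>2) \<partial>lborel)"
      by (rule nn_integral_cmult) measurable
    also have "\<dots> \<le> ennreal (1 / (\<Omega> k ^ mm)\<^sup>2) * ennreal (K * \<Omega> k ^ (2 * mm - 1))"
      by (intro mult_left_mono K(2) \<Omega>1) (simp_all add: T w_def)
    also have "\<dots> = ennreal (1 / (\<Omega> k ^ mm)\<^sup>2 * (K * \<Omega> k ^ (2 * mm - 1)))"
      using K(1) \<Omega>1[of k] by (simp flip: ennreal_mult)
    also have "1 / (\<Omega> k ^ mm)\<^sup>2 * (K * \<Omega> k ^ (2 * mm - 1)) = K * (1 / \<Omega> k)"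
    proof -
      have "(\<Omega> k ^ mm)\<^sup>2 = \<Omega> k ^ (2 * mm - 1) * \<Omega> k"
        using mm_pos by (simp add: power2_eq_square mult_2 flip: power_add power_Suc2)
      then show ?thesis using \<Omega>1[of k] by simp
    qed
    finally show ?thesis .
  qed
  have "summable (\<lambda>k. 1 / real k ^ 2)" using inverse_power_summable[of 2, where 'a = real] by (simp add: inverse_eq_divide)
  then have "summable (\<lambda>k. 1 / real (k + k0) ^ 2)" by (rule summable_ignore_initial_segment)
  then have sm: "summable (\<lambda>k. K * (1 / \<Omega> k))" unfolding \<Omega>_def by (rule summable_mult)
  have "(\<integral>\<^sup>+\<theta>. (\<Sum>k. ennreal (y k \<theta>) * indicator mat_cell \<theta>) \<partial>lborel)
      = (\<Sum>k. \<integral>\<^sup>+\<theta>\<in>mat_cell. ennreal (y k \<theta>) \<partial>lborel)"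
    by (rule nn_integral_suminf) (simp add: y_def)
  also have "\<dots> \<le> (\<Sum>k. ennreal (K * (1 / \<Omega> k)))" by (intro suminf_le y_int) auto
  also have "\<dots> = ennreal (\<Sum>k. K * (1 / \<Omega> k))"
  proof (rule suminf_ennreal2[OF _ sm])
    show "0 \<le> K * (1 / \<Omega> k)" for k using K(1) by (simp add: \<Omega>_def)
  qed
  finally have fin: "(\<integral>\<^sup>+\<theta>. (\<Sum>k. ennreal (y k \<theta>) * indicator mat_cell \<theta>) \<partial>lborel) \<noteq> \<infinity>"
    by (auto simp: top_unique)
  \<comment> \<open>A series with finite integral is finite almost everywhere, so its terms tend to
    0. This does the work of Chebyshev and Borel-Cantelli in one stroke.\<close>
  have "AE \<theta> in lborel. (\<Sum>k. ennreal (y k \<theta>) * indicator mat_cell \<theta>) \<noteq> \<infinity>"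
    by (rule nn_integral_PInf_AE[OF _ fin]) (simp add: y_def)
  then show "AE \<theta> in lborel. \<theta> \<in> mat_cell \<longrightarrow> ((\<lambda>T. cnt T \<theta> / W T) \<longlongrightarrow> dens / \<kappa> ^ CARD('n)) at_top"
  proof eventually_elim
    fix \<theta> assume ae: "(\<Sum>k. ennreal (y k \<theta>) * indicator mat_cell \<theta>) \<noteq> \<infinity>"
    show "\<theta> \<in> mat_cell \<longrightarrow> ((\<lambda>T. cnt T \<theta> / W T) \<longlongrightarrow> dens / \<kappa> ^ CARD('n)) at_top"
    proof
      assume "\<theta> \<in> mat_cell"
      then have "(\<Sum>k. ennreal (y k \<theta>)) \<noteq> \<infinity>" using ae by simp
      then have "summable (\<lambda>k. y k \<theta>)" by (intro summable_suminf_not_top) (simp_all add: y_def infinity_ennreal_def)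
      then have "(\<lambda>k. y k \<theta>) \<longlonglongrightarrow> 0" by (rule summable_LIMSEQ_zero)
      then have "(\<lambda>k. sqrt (y k \<theta>)) \<longlonglongrightarrow> sqrt 0" by (rule tendsto_real_sqrt)
      moreover have "sqrt (y k \<theta>) = \<bar>(cnt (T k) \<theta> - dens * S (T k)) / \<Omega> k ^ mm\<bar>" for k
        by (simp add: y_def flip: power_divide)
      ultimately have "(\<lambda>k. \<bar>(cnt (T k) \<theta> - dens * S (T k)) / \<Omega> k ^ mm\<bar>) \<longlonglongrightarrow> 0"
        by (simp only: real_sqrt_zero)
      then have dev: "(\<lambda>k. (cnt (T k) \<theta> - dens * S (T k)) / \<Omega> k ^ mm) \<longlonglongrightarrow> 0"
        by (rule tendsto_rabs_zero_cancel)
      have "(\<lambda>k. \<kappa> ^ CARD('n) * S (T k) / W (T k)) \<longlonglongrightarrow> 1"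
        by (rule filterlim_compose[OF S_asymptotic T_inf])
      \<comment> \<open>The quotient splits into the relative deviation, which vanishes in the
        limit, and the mean, governed by \<open>S_asymptotic\<close>.\<close>
      then have "(\<lambda>k. 1 / c\<^sub>n * ((cnt (T k) \<theta> - dens * S (T k)) / \<Omega> k ^ mm) +
          dens / \<kappa> ^ CARD('n) * (\<kappa> ^ CARD('n) * S (T k) / W (T k)))
        \<longlonglongrightarrow> 1 / c\<^sub>n * 0 + dens / \<kappa> ^ CARD('n) * 1"
        by (intro tendsto_intros dev)
      moreover have "1 / c\<^sub>n * ((cnt (T k) \<theta> - dens * S (T k)) / \<Omega> k ^ mm) +
          dens / \<kappa> ^ CARD('n) * (\<kappa> ^ CARD('n) * S (T k) / W (T k)) = cnt (T k) \<theta> / w k" for k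
      proof -
        have "\<kappa> ^ CARD('n) \<noteq> 0" using \<kappa>_pos by simp
        then have "dens / \<kappa> ^ CARD('n) * (\<kappa> ^ CARD('n) * S (T k) / W (T k)) = dens * S (T k) / w k"
          by (simp add: T)
        moreover have "1 / c\<^sub>n * ((cnt (T k) \<theta> - dens * S (T k)) / \<Omega> k ^ mm) = (cnt (T k) \<theta> - dens * S (T k)) / w k"
          by (simp add: w_def)
        ultimately show ?thesis by (simp add: diff_divide_distrib)
      qed
      ultimately have lim: "(\<lambda>k. cnt (T k) \<theta> / w k) \<longlonglongrightarrow> dens / \<kappa> ^ CARD('n)" by simp
      show "((\<lambda>T. cnt T \<theta> / W T) \<longlongrightarrow> dens / \<kappa> ^ CARD('n)) at_top"
        by (rule tendsto_of_sparse_sequence[where f = "\<lambda>T. cnt T \<theta>" and W = W and T = T and w = w])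
          (use cnt_mono cnt_nonneg W_mono T w_strict w_pos w_inf w_ratio lim W_at_top in \<open>auto simp: mono_def\<close>)
    qed
  qed
qed

section \<open>The counting function as a sum of hits\<close>

context
  fixes T :: real and \<theta> :: "complex ^ 'n ^ 'm"
begin

definition solutions :: "((complex ^ 'm) \<times> (complex ^ 'n)) set" where
  "solutions = {(p, q). p \<in> integer_vectors D \<and> q \<in> integer_vectors D \<and>
       norm_inf (\<theta> *v q + p) ^ CARD('m) \<le> \<psi> (norm_inf q ^ CARD('n)) \<and>
       1 \<le> norm_inf q ^ CARD('n) \<and> norm_inf q ^ CARD('n) < T \<and>
       cong_mod (multiples N) p (fst v) \<and> cong_mod (multiples N) q (snd v)}"

abbreviation approximants :: "complex ^ 'n \<Rightarrow> (complex ^ 'm) set" where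
  "approximants q \<equiv> {l \<in> lat. sup_cmod (fst v + \<theta> *v q + l) \<le> radius q}"

lemma solutions_eq: "solutions = (\<lambda>(q, l). (fst v + l, q)) ` (SIGMA q:points T. approximants q)"
proof -
  have mem: "z \<in> integer_vectors D \<longleftrightarrow> z \<in> vec_set \<O>" for z :: "complex ^ 'k"
    by (simp add: integer_vectors_def vec_set_def)
  have cong: "cong_mod (multiples N) x y \<longleftrightarrow> x - y \<in> lat" for x y :: "complex ^ 'k"
    by (simp add: cong_mod_def vec_set_iff)
  have p_int: "p \<in> vec_set \<O>" if "p - fst v \<in> lat" for p
  proof -
    have "p $ i \<in> \<O>" for i
    proof -
      have "p $ i - fst v $ i \<in> \<O>" "fst v $ i \<in> \<O>"
        using that v_integral(1) by (auto simp: vec_set_iff dest: subsetD[OF multiples_subset])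
      from add_mem[OF this] show ?thesis by simp
    qed
    then show ?thesis by (simp add: vec_set_iff)
  qed
  have rad: "sup_cmod x ^ mm \<le> \<psi> (sup_cmod q ^ nn) \<longleftrightarrow> sup_cmod x \<le> radius q" if "q \<in> points T" for x :: "complex ^ 'm" and q
  proof -
    have "\<psi> (sup_cmod q ^ nn) = radius q ^ mm" using radius_pow(1)[OF that] G_points[OF that] by simp
    then show ?thesis
      using power_mono_iff[OF sup_cmod_nonneg radius_pow(2)[OF that] mm_pos] by simp
  qed
  show ?thesis (is "?L = ?R")
  proof (intro equalityI subsetI)
    fix x assume "x \<in> ?L"
    then obtain p q where x: "x = (p, q)" "p - fst v \<in> lat" "q - snd v \<in> lat"
      "sup_cmod (\<theta> *v q + p) ^ mm \<le> \<psi> (sup_cmod q ^ nn)" "1 \<le> sup_cmod q ^ nn" "sup_cmod q ^ nn < T"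
      by (auto simp: solutions_def cong norm_inf_power mm[symmetric] nn[symmetric])
    then have q: "q \<in> points T" by (simp add: points_def)
    have "sup_cmod (\<theta> *v q + p) \<le> radius q" using x(4) rad[OF q] by blast
    then have "p - fst v \<in> approximants q" using x(2) by (simp add: add.commute)
    then show "x \<in> ?R" using q x(1) by (intro image_eqI[of _ _ "(q, p - fst v)"]) auto
  next
    fix x assume "x \<in> ?R"
    then obtain q l where x: "x = (fst v + l, q)" "q \<in> points T" "l \<in> lat" "sup_cmod (fst v + \<theta> *v q + l) \<le> radius q" by auto
    have "sup_cmod (\<theta> *v q + (fst v + l)) ^ mm \<le> \<psi> (sup_cmod q ^ nn)"
      using x(4) rad[OF x(2)] by (simp add: ac_simps)
    then show "x \<in> ?L"
      using x(2,3) p_int[of "fst v + l"] points_integral[OF x(2)]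
      by (simp add: solutions_def x(1) mem cong norm_inf_power mm[symmetric] nn[symmetric] points_def)
  qed
qed

lemma finite_approximants: "finite (SIGMA q:points T. approximants q)"
  using finite_points finite_lat_le by (intro finite_SigmaI)

text \<open>The set is spelled out to match the premise of \<open>counting_residues\<close>, where
  finiteness is what makes cardinalities of disjoint pieces add up.\<close>

lemma finite_solutions:
  "finite {(p, q). p \<in> integer_vectors D \<and> q \<in> integer_vectors D \<and>
       norm_inf (\<theta> *v q + p) ^ CARD('m) \<le> \<psi> (norm_inf q ^ CARD('n)) \<and>
       1 \<le> norm_inf q ^ CARD('n) \<and> norm_inf q ^ CARD('n) < T \<and>
       cong_mod (multiples N) p (fst v) \<and> cong_mod (multiples N) q (snd v)}"
  using finite_imageI[OF finite_approximants] unfolding solutions_def[symmetric] solutions_eq .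

lemma counting_eq: "real (counting D \<psi> \<theta> T v (multiples N)) = cnt T \<theta>"
proof -
  have "inj_on (\<lambda>(q, l). (fst v + l, q)) (SIGMA q:points T. approximants q)" by (auto simp: inj_on_def)
  then have "counting D \<psi> \<theta> T v (multiples N) = card (SIGMA q:points T. approximants q)"
    unfolding counting_def solutions_def[symmetric] solutions_eq by (rule card_image)
  also have "\<dots> = (\<Sum>q\<in>points T. card (approximants q))"
    using finite_points finite_lat_le by (intro card_SigmaI) auto
  finally show ?thesis by (simp add: cnt_def hit_def)
qed

end

text \<open>The slice at fixed \<open>y\<close> is a polydisc of volume
  \<open>c\<^sub>m * G T y\<close>. The subtracted term belongs to \<open>y\<close> of sup modulus
  below 1, where \<open>rate\<close> was continued by \<psi> 1.\<close>

lemma measure_region: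
  assumes "T > 1"
  shows "measure lebesgue (region \<psi> T :: ((complex ^ 'm) \<times> (complex ^ 'n)) set) = c\<^sub>m * (W T - c\<^sub>n * \<psi> 1)"
proof -
  let ?R = "region \<psi> T :: ((complex ^ 'm) \<times> (complex ^ 'n)) set"
  let ?J = "{y :: complex ^ 'n. 1 \<le> sup_cmod y ^ nn}"
  have R_iff: "(x, y) \<in> ?R \<longleftrightarrow> sup_cmod x ^ mm \<le> rate T (sup_cmod y ^ nn) \<and> 1 \<le> sup_cmod y ^ nn \<and> sup_cmod y ^ nn < T" for x y
    by (auto simp: region_def norm_inf_power mm[symmetric] nn[symmetric] rate_def)
  then have "?R = {p \<in> space (lborel \<Otimes>\<^sub>M lborel). sup_cmod (fst p) ^ mm \<le> rate T (sup_cmod (snd p) ^ nn) \<and>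
      1 \<le> sup_cmod (snd p) ^ nn \<and> sup_cmod (snd p) ^ nn < T}"
    by (auto simp: space_pair_measure)
  also have "\<dots> \<in> sets (lborel \<Otimes>\<^sub>M lborel)" by measurable
  finally have meas: "?R \<in> sets (lborel \<Otimes>\<^sub>M lborel)" .
  have slice: "emeasure lborel ((\<lambda>x. (x, y)) -` ?R) = ennreal c\<^sub>m * (ennreal (G T y) * indicator ?J y)" for y
  proof (cases "1 \<le> sup_cmod y ^ nn \<and> sup_cmod y ^ nn < T")
    case True
    define r where "r = root mm (G T y)"
    have r: "r \<ge> 0" "r ^ mm = G T y" using mm_pos G_nonneg by (simp_all add: r_def)
    have "(\<lambda>x. (x, y)) -` ?R = polydisc r"
    proof (rule Set.set_eqI)
      fix x :: "complex ^ 'm"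
      have "sup_cmod x ^ mm \<le> G T y \<longleftrightarrow> sup_cmod x \<le> r"
        using power_mono_iff[OF sup_cmod_nonneg r(1) mm_pos, of x] unfolding r(2) .
      then show "x \<in> (\<lambda>x. (x, y)) -` ?R \<longleftrightarrow> x \<in> polydisc r"
        using True by (simp add: R_iff polydisc_def G_def)
    qed
    then show ?thesis using True c\<^sub>m_pos G_nonneg by (simp add: emeasure_polydisc_m[OF r(1)] r(2) ennreal_mult)
  next
    case False
    then have "(\<lambda>x. (x, y)) -` ?R = {}" by (auto simp: R_iff)
    then show ?thesis using False by (auto simp: indicator_def G_def rate_def)
  qed
  have cpl: "(\<integral>\<^sup>+y. ennreal (G T y) * indicator (- ?J) y \<partial>lborel) = ennreal (c\<^sub>n * \<psi> 1)"
  proof -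
    have "(\<integral>\<^sup>+y. ennreal (G T y) * indicator (- ?J) y \<partial>lborel)
        = (\<integral>\<^sup>+y. ennreal (\<psi> 1) * indicator {y :: complex ^ 'n. sup_cmod y < 1} y \<partial>lborel)"
    proof (rule nn_integral_cong)
      fix y :: "complex ^ 'n"
      have "sup_cmod y ^ nn < 1 \<longleftrightarrow> sup_cmod y < 1"
        using power_mono_iff[OF zero_le_one sup_cmod_nonneg nn_pos, of y] unfolding power_one by linarith
      then show "ennreal (G T y) * indicator (- ?J) y = ennreal (\<psi> 1) * indicator {y. sup_cmod y < 1} y"
        using assms by (auto simp: indicator_def G_def rate_def max_def)
    qed
    also have "\<dots> = ennreal (\<psi> 1) * emeasure lborel {y :: complex ^ 'n. sup_cmod y < 1}"
      by (rule nn_integral_cmult_indicator) simp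
    also have "\<dots> = ennreal (c\<^sub>n * \<psi> 1)"
      using psi_pos[of 1] c\<^sub>n_pos emeasure_open_polydisc[of 1, where 'k = 'n]
      by (simp add: c\<^sub>n[symmetric] mult.commute flip: ennreal_mult)
    finally show ?thesis .
  qed
  let ?I = "\<integral>\<^sup>+y. ennreal (G T y) * indicator ?J y \<partial>lborel"
  have "ennreal (W T) = (\<integral>\<^sup>+y. ennreal (G T y) * indicator ?J y + ennreal (G T y) * indicator (- ?J) y \<partial>lborel)"
    unfolding W[symmetric] by (intro nn_integral_cong) (auto simp: indicator_def)
  also have "\<dots> = ?I + ennreal (c\<^sub>n * \<psi> 1)"
    by (subst nn_integral_add) (simp_all add: cpl)
  finally have WI: "ennreal (W T) = ?I + ennreal (c\<^sub>n * \<psi> 1)" .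
  have P: "c\<^sub>n * \<psi> 1 \<ge> 0" using c\<^sub>n_pos psi_pos[of 1] by simp
  have I: "?I = ennreal (W T - c\<^sub>n * \<psi> 1)" and W_ge: "W T \<ge> c\<^sub>n * \<psi> 1"
  proof -
    have "ennreal (c\<^sub>n * \<psi> 1) \<le> ennreal (W T)" unfolding WI by simp
    then show W_ge: "W T \<ge> c\<^sub>n * \<psi> 1" using W_nonneg[of T] by simp
    have "?I = ennreal (W T) - ennreal (c\<^sub>n * \<psi> 1)" unfolding WI by simp
    then show "?I = ennreal (W T - c\<^sub>n * \<psi> 1)" using P by (simp add: ennreal_minus)
  qed
  have "emeasure (lborel \<Otimes>\<^sub>M lborel) ?R = (\<integral>\<^sup>+y. emeasure lborel ((\<lambda>x. (x, y)) -` ?R) \<partial>lborel)"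
    by (rule lborel_pair.emeasure_pair_measure_alt2[OF meas])
  also have "\<dots> = ennreal c\<^sub>m * ?I" unfolding slice by (rule nn_integral_cmult) simp
  finally have "emeasure lborel ?R = ennreal (c\<^sub>m * (W T - c\<^sub>n * \<psi> 1))"
    using c\<^sub>m_pos W_ge by (simp add: lborel_prod I ennreal_mult)
  then have "measure lborel ?R = c\<^sub>m * (W T - c\<^sub>n * \<psi> 1)"
    using c\<^sub>m_pos W_ge by (simp add: measure_def)
  moreover have "?R \<in> sets lborel" using meas unfolding lborel_prod .
  ultimately show ?thesis by simp
qed

lemma region_asymptotic:
  "((\<lambda>T. measure lebesgue (region \<psi> T :: ((complex ^ 'm) \<times> (complex ^ 'n)) set) / W T) \<longlongrightarrow> c\<^sub>m) at_top"
proof -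
  have "((\<lambda>T. c\<^sub>m * (1 - c\<^sub>n * \<psi> 1 * inverse (W T))) \<longlongrightarrow> c\<^sub>m * (1 - c\<^sub>n * \<psi> 1 * 0)) at_top"
    by (intro tendsto_intros filterlim_compose[OF tendsto_inverse_0_at_top] W_at_top tendsto_inverse_0_at_top)
  moreover have "\<forall>\<^sub>F T in at_top. c\<^sub>m * (1 - c\<^sub>n * \<psi> 1 * inverse (W T))
      = measure lebesgue (region \<psi> T :: ((complex ^ 'm) \<times> (complex ^ 'n)) set) / W T"
  proof -
    have "\<forall>\<^sub>F T in at_top. W T > 0" using W_at_top unfolding filterlim_at_top_dense by blast
    then show ?thesis using eventually_gt_at_top[of 1]
    proof eventually_elim
      fix T assume "W T > 0" "T > (1 :: real)"
      then show "c\<^sub>m * (1 - c\<^sub>n * \<psi> 1 * inverse (W T))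
        = measure lebesgue (region \<psi> T :: ((complex ^ 'm) \<times> (complex ^ 'n)) set) / W T"
        by (simp add: measure_region field_simps)
    qed
  qed
  ultimately show ?thesis by (simp add: tendsto_cong)
qed

end

section \<open>Counting in residue classes of an ideal\<close>

context imag_quad
begin

text \<open>Congruence modulo \<open>I\<close> splits coordinate by coordinate into congruences
  modulo N shifted by a unique element of \<open>R\<close>; finiteness of the pieces lets
  \<open>card\<close> add.\<close>

lemma counting_residues:
  fixes v :: "(complex ^ 'm) \<times> (complex ^ 'n)" and \<theta> :: "complex ^ 'n ^ 'm"
  assumes N: "N > 0" and sub: "multiples N \<subseteq> I" "I \<subseteq> \<O>"
    and I_diff: "\<And>x y. x \<in> I \<Longrightarrow> y \<in> I \<Longrightarrow> x - y \<in> I" and I_add: "\<And>x y. x \<in> I \<Longrightarrow> y \<in> I \<Longrightarrow> x + y \<in> I"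
    and R: "finite R" "R \<subseteq> I" "\<And>z. z \<in> I \<Longrightarrow> \<exists>!r. r \<in> R \<and> z - r \<in> multiples N"
    and fin: "\<And>r. r \<in> vec_set R \<times> vec_set R \<Longrightarrow> finite {(p, q). p \<in> integer_vectors D \<and> q \<in> integer_vectors D \<and>
       norm_inf (\<theta> *v q + p) ^ CARD('m) \<le> \<psi> (norm_inf q ^ CARD('n)) \<and>
       1 \<le> norm_inf q ^ CARD('n) \<and> norm_inf q ^ CARD('n) < T \<and>
       cong_mod (multiples N) p (fst (v + r)) \<and> cong_mod (multiples N) q (snd (v + r))}"
  shows "counting D \<psi> \<theta> T v I = (\<Sum>r\<in>vec_set R \<times> vec_set R. counting D \<psi> \<theta> T (v + r) (multiples N))"
proof -
  let ?P = "\<lambda>p q. p \<in> integer_vectors D \<and> q \<in> integer_vectors D \<and>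
       norm_inf (\<theta> *v q + p) ^ CARD('m) \<le> \<psi> (norm_inf q ^ CARD('n)) \<and>
       1 \<le> norm_inf q ^ CARD('n) \<and> norm_inf q ^ CARD('n) < T"
  let ?A = "\<lambda>r. {(p, q). ?P p q \<and> cong_mod (multiples N) p (fst (v + r)) \<and> cong_mod (multiples N) q (snd (v + r))}"
  have step: "cong_mod I x y \<longleftrightarrow> (\<exists>r\<in>vec_set R. cong_mod (multiples N) x (y + r))" for x y :: "complex ^ 'k"
  proof
    assume "cong_mod I x y"
    then have "\<exists>r. r \<in> R \<and> x $ i - y $ i - r \<in> multiples N" for i
      using R(3) unfolding cong_mod_def by (metis (no_types, lifting))
    then obtain r where r: "\<And>i. r i \<in> R \<and> x $ i - y $ i - r i \<in> multiples N" by metis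
    then show "\<exists>r\<in>vec_set R. cong_mod (multiples N) x (y + r)"
      by (intro bexI[of _ "\<chi> i. r i"]) (auto simp: cong_mod_def vec_set_iff diff_diff_eq)
  next
    assume "\<exists>r\<in>vec_set R. cong_mod (multiples N) x (y + r)"
    then obtain r where r: "r \<in> vec_set R" "cong_mod (multiples N) x (y + r)" by blast
    show "cong_mod I x y" unfolding cong_mod_def
    proof
      fix i
      have "x $ i - (y $ i + r $ i) \<in> I" "r $ i \<in> I" using r sub(1) R(2) by (auto simp: cong_mod_def vec_set_iff)
      from I_add[OF this] show "x $ i - y $ i \<in> I" by simp
    qed
  qed
  have uniq: "r = s" if rs: "r \<in> vec_set R" "s \<in> vec_set R" "cong_mod (multiples N) x (y + r)" "cong_mod (multiples N) x (y + s)"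
    for x y r s :: "complex ^ 'k"
  proof -
    have "r $ i = s $ i" for i
    proof -
      have "r $ i \<in> R" "s $ i \<in> R" using rs by (simp_all add: vec_set_iff)
      moreover have *: "x $ i - y $ i - r $ i \<in> multiples N" "x $ i - y $ i - s $ i \<in> multiples N"
        using rs by (simp_all add: cong_mod_def diff_diff_eq)
      moreover have "x $ i - y $ i \<in> I"
        using I_add[of "x $ i - y $ i - r $ i" "r $ i"] * sub(1) R(2) \<open>r $ i \<in> R\<close> by auto
      ultimately show ?thesis using R(3) by metis
    qed
    then show ?thesis by (simp add: vec_eq_iff)
  qed
  have "{(p, q). ?P p q \<and> cong_mod I p (fst v) \<and> cong_mod I q (snd v)} = (\<Union>r\<in>vec_set R \<times> vec_set R. ?A r)"
    unfolding step by auto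
  then have "counting D \<psi> \<theta> T v I = card (\<Union>r\<in>vec_set R \<times> vec_set R. ?A r)"
    unfolding counting_def by (simp add: conj_assoc)
  also have "\<dots> = (\<Sum>r\<in>vec_set R \<times> vec_set R. card (?A r))"
  proof (rule card_UN_disjoint)
    show "finite (vec_set R \<times> vec_set R :: ((complex ^ 'm) \<times> (complex ^ 'n)) set)"
      using R(1) by (simp add: finite_vec_set)
    show "\<forall>r\<in>vec_set R \<times> vec_set R. finite (?A r)" using fin by (simp add: conj_assoc)
    show "\<forall>r\<in>vec_set R \<times> vec_set R. \<forall>s\<in>vec_set R \<times> vec_set R. r \<noteq> s \<longrightarrow> ?A r \<inter> ?A s = {}"
    proof (intro ballI impI equals0I)
      fix r s x assume rs: "r \<in> vec_set R \<times> vec_set R" "s \<in> vec_set R \<times> vec_set R" "r \<noteq> s" "x \<in> ?A r \<inter> ?A s"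
      have "fst r = fst s" "snd r = snd s"
        using rs by (auto intro!: uniq[of _ _ "fst x" "fst v"] uniq[of _ _ "snd x" "snd v"])
      then show False using rs(3) by (simp add: prod_eq_iff)
    qed
  qed
  also have "\<dots> = (\<Sum>r\<in>vec_set R \<times> vec_set R. counting D \<psi> \<theta> T (v + r) (multiples N))"
    unfolding counting_def by (simp add: conj_assoc)
  finally show ?thesis .
qed

end

section \<open>Summation over the residue classes and identification of the constant\<close>

theorem theorem1p2:
  fixes D :: nat and I :: "complex set" and \<psi> :: "real \<Rightarrow> real"
    and v :: "(complex ^ 'm) \<times> (complex ^ 'n)"
  defines "d \<equiv> CARD('m) + CARD('n)"
  assumes "d \<ge> 3"
    and "D > 0" and "squarefree D"
    and "ideal I (quad_ring D)" and "I \<noteq> {0}"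
    and "v \<in> integer_vectors D \<times> integer_vectors D"
    and "\<And>t. t \<ge> 1 \<Longrightarrow> \<psi> t > 0" and "antimono_on {1..} \<psi>"
    and "(\<integral>\<^sup>+t\<in>{1..}. ennreal (\<psi> t) \<partial>lborel) = \<infinity>"
  shows "AE \<theta> :: complex ^ 'n ^ 'm in lebesgue.
    ((\<lambda>T. real (counting D \<psi> \<theta> T v I) /
        (2 ^ d * \<bar>real_of_int (discriminant D)\<bar> powr (- (real d / 2)) *
         real (ideal_norm D I) powr (- real d) *
         measure lebesgue (region \<psi> T :: ((complex ^ 'm) \<times> (complex ^ 'n)) set)))
      \<longlongrightarrow> 1) at_top"
proof -
  interpret imag_quad D by unfold_locales (use assms in auto)
  obtain N :: nat and R where N: "N > 0" "multiples N \<subseteq> I" "I \<subseteq> \<O>"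
    "\<And>x y. x \<in> I \<Longrightarrow> y \<in> I \<Longrightarrow> x - y \<in> I" "\<And>x y. x \<in> I \<Longrightarrow> y \<in> I \<Longrightarrow> x + y \<in> I"
    and R: "finite R" "R \<subseteq> I" "card R * ideal_norm D I = N\<^sup>2"
    "\<And>z. z \<in> I \<Longrightarrow> \<exists>!r. r \<in> R \<and> z - r \<in> multiples N"
    using ideal_residues[OF assms(5,6)] by metis
  interpret congruence_lattice D N by unfold_locales (rule N(1))
  let ?RR = "vec_set R \<times> vec_set R :: ((complex ^ 'm) \<times> (complex ^ 'n)) set"
  let ?mm = "2 * CARD('m)" and ?nn = "2 * CARD('n)"
  let ?cm = "polydisc_vol TYPE('m)" and ?cn = "polydisc_vol TYPE('n)"
  let ?M = "measure lborel (mat_cell :: (complex ^ 'n ^ 'm) set)"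
  have v: "v \<in> vec_set \<O> \<times> vec_set \<O>" using assms(7) by (simp add: integer_vectors_def vec_set_def)
  have RO: "r \<in> R \<Longrightarrow> r \<in> \<O>" for r using R(2) N(3) by blast
  have loc: "khintchine_groshev_dim D N \<psi> (v + r) ?mm ?nn ?cm ?cn ?M" if r: "r \<in> ?RR" for r
  proof unfold_locales
    show "fst (v + r) \<in> vec_set \<O>" "snd (v + r) \<in> vec_set \<O>"
      using r v RO add_mem by (auto simp: vec_set_iff)
  qed (use assms in auto)
  have "0 \<in> I" using N(2) zero_mem by (auto simp: multiples_def image_subset_iff)
  then have "R \<noteq> {}" using R(4)[of 0] by auto
  then obtain \<rho> where "\<rho> \<in> R" by blast
  then have r0: "(\<chi> i. \<rho>, \<chi> i. \<rho>) \<in> ?RR" by (simp add: vec_set_iff)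
  \<comment> \<open>One class is fixed in order to name \<open>W\<close>; the instances for the
    other classes refer to the same function, so their limits can be added.\<close>
  interpret L: khintchine_groshev_dim D N \<psi> "v + (\<chi> i. \<rho>, \<chi> i. \<rho>)" ?mm ?nn ?cm ?cn ?M
    by (rule loc[OF r0])
  define W where "W = L.W"
  have W_at_top: "filterlim W at_top at_top" unfolding W_def by (rule L.W_at_top)
  have ae: "AE \<theta> :: complex ^ 'n ^ 'm in lborel. ((\<lambda>T. real (counting D \<psi> \<theta> T (v + r) (multiples N)) / W T)
      \<longlongrightarrow> ?cm / \<kappa> ^ d) at_top" if r: "r \<in> ?RR" for r
  proof -
    interpret K: khintchine_groshev_dim D N \<psi> "v + r" ?mm ?nn ?cm ?cn ?M by (rule loc[OF r])
    have "AE \<theta> in lborel. ((\<lambda>T. K.cnt T \<theta> / L.W T) \<longlongrightarrow> L.dens / \<kappa> ^ CARD('n)) at_top"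
      by (rule K.cnt_asymptotic)
    moreover have "L.dens / \<kappa> ^ CARD('n) = ?cm / \<kappa> ^ d" by (simp add: L.dens_eq d_def power_add)
    ultimately show ?thesis by (simp add: K.counting_eq W_def)
  qed
  have finRR: "finite ?RR" using R(1) by (simp add: finite_vec_set)
  have card_RR: "card ?RR = card R ^ d"
    by (simp add: card_cartesian_product card_vec_set d_def power_add)
  have total: "counting D \<psi> \<theta> T v I = (\<Sum>r\<in>?RR. counting D \<psi> \<theta> T (v + r) (multiples N))"
    for \<theta> :: "complex ^ 'n ^ 'm" and T
  proof (rule counting_residues[OF N R(1,2,4)])
    fix r assume r: "r \<in> ?RR"
    interpret K: khintchine_groshev_dim D N \<psi> "v + r" ?mm ?nn ?cm ?cn ?M by (rule loc[OF r])
    show "finite {(p, q). p \<in> integer_vectors D \<and> q \<in> integer_vectors D \<and>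
       norm_inf (\<theta> *v q + p) ^ CARD('m) \<le> \<psi> (norm_inf q ^ CARD('n)) \<and>
       1 \<le> norm_inf q ^ CARD('n) \<and> norm_inf q ^ CARD('n) < T \<and>
       cong_mod (multiples N) p (fst (v + r)) \<and> cong_mod (multiples N) q (snd (v + r))}"
      by (rule K.finite_solutions)
  qed
  define E where "E = 2 ^ d * \<bar>real_of_int (discriminant D)\<bar> powr (- (real d / 2)) * real (ideal_norm D I) powr (- real d)"
  have norm_pos: "ideal_norm D I > 0" "card R > 0" using R(3) N(1) by (auto intro!: Nat.gr0I)
  \<comment> \<open>As |\<Delta>| is (2 \<eta>)^2, the powers of 2 cancel, and E is the inverse d-th
    power of the covolume \<eta> N(I) of the ideal.\<close>
  have E: "E = 1 / (\<eta> * real (ideal_norm D I)) ^ d"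
  proof -
    have pos: "2 * \<eta> > 0" using \<eta>_pos by simp
    have "\<bar>real_of_int (discriminant D)\<bar> = (2 * \<eta>) powr 2"
      using pos unfolding abs_discriminant by (intro powr_numeral[symmetric]) simp
    then have "\<bar>real_of_int (discriminant D)\<bar> powr (- (real d / 2)) = (2 * \<eta>) powr (2 * (- (real d / 2)))"
      by (simp only: powr_powr)
    also have "\<dots> = 1 / (2 * \<eta>) ^ d"
      using powr_realpow[OF pos, of d] by (simp add: powr_minus_divide)
    finally show ?thesis
      unfolding E_def using norm_pos \<eta>_pos
      by (simp add: powr_minus_divide powr_realpow power_mult_distrib)
  qed
  have E_pos: "E > 0" unfolding E using norm_pos \<eta>_pos by simp
  \<comment> \<open>The ideal consists of \<open>card R\<close> classes modulo N \<O>, so its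
    covolume is \<kappa> / \<open>card R\<close>; hence the equal densities of all classes add up to
    E times the unit volume.\<close>
  have card_E: "real (card ?RR) * (?cm / \<kappa> ^ d) = E * ?cm"
  proof -
    have "real (card R) * (\<eta> * real (ideal_norm D I)) = \<kappa>"
      using arg_cong[OF R(3), of real] by (simp add: \<kappa>_def mult_ac)
    then have "real (card R) ^ d * (\<eta> * real (ideal_norm D I)) ^ d = \<kappa> ^ d"
      by (simp only: power_mult_distrib[symmetric])
    then show ?thesis using \<kappa>_pos norm_pos \<eta>_pos unfolding E card_RR by (simp add: field_simps)
  qed
  have "AE \<theta> :: complex ^ 'n ^ 'm in lborel. \<forall>r\<in>?RR. ((\<lambda>T. real (counting D \<psi> \<theta> T (v + r) (multiples N)) / W T)
      \<longlongrightarrow> ?cm / \<kappa> ^ d) at_top"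
    using ae finRR by (simp only: AE_ball_countable[OF countable_finite[OF finRR]] ball_simps) blast
  then have "AE \<theta> :: complex ^ 'n ^ 'm in lborel.
    ((\<lambda>T. real (counting D \<psi> \<theta> T v I) / (E * measure lebesgue (region \<psi> T :: ((complex ^ 'm) \<times> (complex ^ 'n)) set)))
      \<longlongrightarrow> 1) at_top"
  proof eventually_elim
    fix \<theta> :: "complex ^ 'n ^ 'm"
    assume lim: "\<forall>r\<in>?RR. ((\<lambda>T. real (counting D \<psi> \<theta> T (v + r) (multiples N)) / W T) \<longlongrightarrow> ?cm / \<kappa> ^ d) at_top"
    let ?V = "\<lambda>T. measure lebesgue (region \<psi> T :: ((complex ^ 'm) \<times> (complex ^ 'n)) set)"
    have "((\<lambda>T. \<Sum>r\<in>?RR. real (counting D \<psi> \<theta> T (v + r) (multiples N)) / W T) \<longlongrightarrow> (\<Sum>r\<in>?RR. ?cm / \<kappa> ^ d)) at_top"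
      using lim by (intro tendsto_sum) blast
    then have 1: "((\<lambda>T. real (counting D \<psi> \<theta> T v I) / W T) \<longlongrightarrow> E * ?cm) at_top"
      by (simp only: total of_nat_sum sum_divide_distrib sum_constant card_E)
    have 2: "((\<lambda>T. E * (?V T / W T)) \<longlongrightarrow> E * ?cm) at_top"
      by (intro tendsto_intros L.region_asymptotic[folded W_def])
    have "E * ?cm \<noteq> 0" using E_pos L.c\<^sub>m_pos by simp
    from tendsto_divide[OF 1 2 this] this
    have "((\<lambda>T. (real (counting D \<psi> \<theta> T v I) / W T) / (E * (?V T / W T))) \<longlongrightarrow> 1) at_top" by simp
    moreover have "\<forall>\<^sub>F T in at_top. W T > 0" using W_at_top unfolding filterlim_at_top_dense by blast
    then have "\<forall>\<^sub>F T in at_top. (real (counting D \<psi> \<theta> T v I) / W T) / (E * (?V T / W T))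
        = real (counting D \<psi> \<theta> T v I) / (E * ?V T)"
      by eventually_elim simp
    ultimately show "((\<lambda>T. real (counting D \<psi> \<theta> T v I) / (E * ?V T)) \<longlongrightarrow> 1) at_top"
      by (rule Lim_transform_eventually)
  qed
  then have "AE \<theta> :: complex ^ 'n ^ 'm in lebesgue.
    ((\<lambda>T. real (counting D \<psi> \<theta> T v I) / (E * measure lebesgue (region \<psi> T :: ((complex ^ 'm) \<times> (complex ^ 'n)) set)))
      \<longlongrightarrow> 1) at_top"
    by (rule AE_completion)
  then show ?thesis unfolding E_def .
qed

end
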